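(* Let $H$ be a separable Hilbert space, $E$ a separable Banach space, and $\{\eta_k\}_{k\in\mathbb Z}$ a stationary $E$-valued process such that $\mathcal K:=\operatorname{supp}\mathcal D(\eta_k)$ is a compact subset of $E$. Let $S:H\times E\to H$ be twice continuously differentiable and bounded on bounded subsets together with its derivatives up to second order, and let $X\subset H$ be a compact set such that $S(X\times\mathcal K)\subset X$. Suppose that Hypotheses (SF), (GD), (ALC), (DLP$'$) and (SRZ) stated in the context are fulfilled. Let $u$ be an $X$-valued random variable independent of $\{\eta_k\}$ and let $\{u_k,k\in\mathbb Z_+\}$ be the trajectory defined by $u_k=S(u_{k-1},\eta_k)$, $k\ge1$, $u_0=u$. Then, for any integer $s\ge1$, the process $[u_k,\dots,u_{k+s}]$ converges in law, as $k\to\infty$, in the dual-Lipschitz metric to $[\hat u_0,\dots,\hat u_s]$, where $\{\hat u_k\}$ is the stationary trajectory described in the context. Moreover, the convergence is uniform with respect to all such initial conditions $u$.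
   Context: Notation. $\mathcal P(Y)$: Borel probability measures on $Y$; $\mathcal D(\cdot)$: law; $\|\mu-\nu\|_{\mathrm{var}}=\sup_\Gamma|\mu(\Gamma)-\nu(\Gamma)|$; $\|\mu-\nu\|_L^*=\sup|\langle f,\mu\rangle-\langle f,\nu\rangle|$ over Lipschitz $f$ with $|f|\le1$, $\operatorname{Lip}(f)\le1$. $\mathbb Z_-=\{0,-1,-2,\dots\}$; $\boldsymbol{\mathcal K}=\mathcal K^{\mathbb Z_-}$ carries the distance $\mathrm d(\boldsymbol\xi,\boldsymbol\xi')=\sum_{k\le0}\iota^k\|\xi_k-\xi'_k\|_E$ with a fixed $\iota>1$. $\sigma\in\mathcal P(\boldsymbol{\mathcal K})$ is the law of $\{\eta_k,k\in\mathbb Z_-\}$ and $\mathcal E:=\operatorname{supp}\sigma$. $Q(\boldsymbol\xi;\cdot)$ is the conditional law of $\eta_1$ given $\{\eta_k\}_{k\in\mathbb Z_-}=\boldsymbol\xi$. For integers $k\ge1$, $$\boldsymbol Q_k(\boldsymbol\xi;dy_1,\dots,dy_k)=Q(\boldsymbol\xi;dy_1)Q(\boldsymbol\xi_1;dy_2)\cdots Q(\boldsymbol\xi_{k-1};dy_k),$$ where $\boldsymbol\xi_l=(\boldsymbol\xi,y_1,\dots,y_l)$ is the concatenation; for $k\ge0,m\ge1$, $Q_k^m(\boldsymbol\xi;\cdot)$ is the projection of $\boldsymbol Q_{k+m}(\boldsymbol\xi;\cdot)$ to the last $m$ components. $\mathbf 0_n=(0,\dots,0)\in E^n$ and $\mathcal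 O_\delta(\mathbf 0_n)$ is the product of $n$ open $\delta$-balls of $E$ centred at $0$. $S_k(u;\mathbf 0_k)$ is the value $u_k$ of the trajectory $u_j=S(u_{j-1},0)$, $u_0=u$. (SF) $Q(\boldsymbol\xi;\cdot)$ can be chosen to be a continuous map from $\mathcal E$ to $\mathcal P(\mathcal K)\subset\mathcal P(E)$ (weak topology), and there is $C>0$ with $\|Q(\boldsymbol\xi;\cdot)-Q(\boldsymbol\xi';\cdot)\|_{\mathrm{var}}\le C\,\mathrm d(\boldsymbol\xi,\boldsymbol\xi')$ for $\boldsymbol\xi,\boldsymbol\xi'\in\mathcal E$. (GD) There are an integer $k\ge1$ and $a\in(0,1)$ such that $\|S_k(u;\mathbf 0_k)\|_H\le a\|u\|_H$ for any $u\in H$. (ALC) There are an open set $O\supset X\times\mathcal K$ in $H\times E$ and a finite-dimensional determining subspace $G\subset H$ such that the closure of the image of $D_\eta S(u,\eta):E\to H$ contains $G$ for any $(u,\eta)\in O$. Here a closed subspace $G\subset H$ is determining if there is $\varkappa\in(0,1)$ such that $\|(I-\mathsf P_G)D_uS(u,\eta)\|_{\mathcal L(H)}\le\varkappa$ for any $u\in X$, $\eta\in\mathcal K$, where $\mathsf P_G$ is the orthogonal projection to $G$. (DLP$'$) There is an increasing sequence of finite-dimensional subspaces $F_n\subset E$ with complementary subspaces $F_n^\dagger\subset E$ and projections $\mathsf P_n:E\to F_n$ (along $F_n^\dagger$) such that $\cup_nF_n$ is dense in $E$, the norms of $\mathsf P_n$ are bounded uniformly in $n$, and for each $n\ge1$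 and $\boldsymbol\xi\in\mathcal E$, $Q(\boldsymbol\xi;dy)=Q_n^\dagger(\boldsymbol\xi;dy_n^\dagger)\,\rho_n(\boldsymbol\xi,y_n^\dagger,y_n)\,\ell_n(dy_n)$, where $y=(y_n,y_n^\dagger)$ corresponds to $E=F_n\dotplus F_n^\dagger$, $Q_n^\dagger(\boldsymbol\xi;\cdot)$ is the image of $Q(\boldsymbol\xi;\cdot)$ under $I-\mathsf P_n$, $\ell_n$ is Lebesgue measure on $F_n$, and $\rho_n:\mathcal E\times E\to\mathbb R_+$ is Lipschitz continuous. (SRZ) For any $n\in\mathbb N$ and $\delta>0$ there is an integer $s\ge0$ such that $\inf_{\boldsymbol\xi\in\mathcal E}Q_s^n(\boldsymbol\xi;\mathcal O_\delta(\mathbf 0_n))>0$. The stationary trajectory. The $U$-process is the Markov process in $X\times\mathcal E$ whose one-step transition from $(v,\boldsymbol\xi)$ is to $(S(v,\zeta),(\boldsymbol\xi,\zeta))$, where $\zeta$ is a random variable with law $Q(\boldsymbol\xi;\cdot)$ and $(\boldsymbol\xi,\zeta)$ is the concatenation. If $\{\eta_k\}_{k\in\mathbb Z}$ is a stationary process in the separable Banach space $E$ with compact $\mathcal K=\operatorname{supp}\mathcal D(\eta_k)$, $S:H\times E\to H$ is twice continuously differentiable and bounded on bounded subsets together with its derivatives up to second order ($H$ being a separable Hilbert space), $X\subset H$ is a compact set with $S(X\times\mathcal K)\subset X$, and (SF), (GD), (ALC), (DLP$'$) and (SRZ) hold, then the $U$-process has a unique stationary measure $\boldsymbol\mu\in\mathcal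 P(X\times\mathcal E)$. Let $\{V_k=(v_k,\boldsymbol\xi_k),k\in\mathbb Z_+\}$ be a trajectory of the $U$-process with $\mathcal D(V_k)\equiv\boldsymbol\mu$; then $\hat u_k:=v_k$, $k\ge0$. The space $X^{s+1}$ carries the product metric (sum of the distances of components). *)

theory Defs
  imports "HOL-Probability.Probability"
begin

definition msupport :: "'a::topological_space measure \<Rightarrow> 'a set" where
  "msupport \<mu> = {x. \<forall>U. open U \<and> x \<in> U \<longrightarrow> emeasure \<mu> U > 0}"

definition var_dist :: "'a measure \<Rightarrow> 'a measure \<Rightarrow> real" where
  "var_dist \<mu> \<nu> = (SUP A\<in>sets \<mu>. \<bar>measure \<mu> A - measure \<nu> A\<bar>)"

text \<open>The dual-Lipschitz distance of two probability measures on the same space, which carries the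
  metric \<open>d\<close>.  The distance is a parameter since the finite products used below are not
  types with a metric of their own.\<close>

definition dual_lip :: "('a \<Rightarrow> 'a \<Rightarrow> real) \<Rightarrow> 'a measure \<Rightarrow> 'a measure \<Rightarrow> real" where
  "dual_lip d \<mu> \<nu> =
     (SUP f \<in> {f :: 'a \<Rightarrow> real. (\<forall>x\<in>space \<mu>. \<bar>f x\<bar> \<le> 1) \<and>
                 (\<forall>x\<in>space \<mu>. \<forall>y\<in>space \<mu>. \<bar>f x - f y\<bar> \<le> d x y)}.
        \<bar>(\<integral>x. f x \<partial>\<mu>) - (\<integral>x. f x \<partial>\<nu>)\<bar>)"

definition stationary_process :: "'w measure \<Rightarrow> (int \<Rightarrow> 'w \<Rightarrow> 'e::topological_space) \<Rightarrow> bool" where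
  "stationary_process M \<eta> \<longleftrightarrow>
     (\<forall>k. \<eta> k \<in> borel_measurable M) \<and>
     (\<forall>m. distr M (borel :: (int \<Rightarrow> 'e) measure) (\<lambda>\<omega> k. \<eta> (k + m) \<omega>) =
          distr M borel (\<lambda>\<omega> k. \<eta> k \<omega>))"

text \<open>A past \<open>(\<xi>\<^sub>k)\<close> with \<open>k = 0, -1, -2, \<dots>\<close> is a function on \<open>nat\<close> whose value at \<open>n\<close> is the entry
  of index \<open>k = -n\<close>.  The topology of the type \<open>nat \<Rightarrow> 'e\<close> is the product topology; on sequences with
  entries in a bounded set it is also the topology of \<open>past_dist\<close>.\<close>

definition past :: "(int \<Rightarrow> 'w \<Rightarrow> 'e) \<Rightarrow> 'w \<Rightarrow> nat \<Rightarrow> 'e" where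
  "past \<eta> \<omega> = (\<lambda>n. \<eta> (- int n) \<omega>)"

definition past_law :: "'w measure \<Rightarrow> (int \<Rightarrow> 'w \<Rightarrow> 'e::topological_space) \<Rightarrow> (nat \<Rightarrow> 'e) measure" where
  "past_law M \<eta> = distr M borel (past \<eta>)"

definition past_dist :: "real \<Rightarrow> (nat \<Rightarrow> 'e::real_normed_vector) \<Rightarrow> (nat \<Rightarrow> 'e) \<Rightarrow> real" where
  "past_dist \<iota> \<xi> \<xi>' = (\<Sum>n. norm (\<xi> n - \<xi>' n) / \<iota> ^ n)"

definition snoc :: "(nat \<Rightarrow> 'e) \<Rightarrow> 'e \<Rightarrow> nat \<Rightarrow> 'e" where
  "snoc \<xi> y = case_nat y \<xi>"

primrec concat_past :: "(nat \<Rightarrow> 'e) \<Rightarrow> (nat \<Rightarrow> 'e) \<Rightarrow> nat \<Rightarrow> (nat \<Rightarrow> 'e)" where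
  "concat_past \<xi> y 0 = \<xi>"
| "concat_past \<xi> y (Suc l) = snoc (concat_past \<xi> y l) (y (Suc l))"

text \<open>\<open>Q\<close> is a regular version of the conditional law of \<open>\<eta>\<^sub>1\<close> given the past.  Being a kernel on all of
  \<open>nat \<Rightarrow> 'e\<close> is no restriction: a kernel on the support of the law of the past, which is closed and
  of full measure, can be extended by a constant.\<close>

definition cond_law_next ::
  "'w measure \<Rightarrow> (int \<Rightarrow> 'w \<Rightarrow> 'e::topological_space) \<Rightarrow> ((nat \<Rightarrow> 'e) \<Rightarrow> 'e measure) \<Rightarrow> bool" where
  "cond_law_next M \<eta> Q \<longleftrightarrow>
     Q \<in> borel \<rightarrow>\<^sub>M prob_algebra borel \<and>
     (\<forall>A\<in>sets borel. \<forall>B\<in>sets borel.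
        measure M {\<omega> \<in> space M. past \<eta> \<omega> \<in> A \<and> \<eta> 1 \<omega> \<in> B} =
        (LINT \<xi>:A|past_law M \<eta>. measure (Q \<xi>) B))"

text \<open>The joint law of \<open>(y\<^sub>1, \<dots>, y\<^sub>k)\<close>, as a measure on the product over \<open>{1..k}\<close>.\<close>

primrec Q_joint :: "((nat \<Rightarrow> 'e::topological_space) \<Rightarrow> 'e measure) \<Rightarrow> nat \<Rightarrow> (nat \<Rightarrow> 'e) \<Rightarrow> (nat \<Rightarrow> 'e) measure" where
  "Q_joint Q 0 \<xi> = return (Pi\<^sub>M {1..0} (\<lambda>_. borel)) (\<lambda>_. undefined)"
| "Q_joint Q (Suc k) \<xi> =
     Q_joint Q k \<xi> \<bind>
       (\<lambda>y. distr (Q (concat_past \<xi> y k)) (Pi\<^sub>M {1..Suc k} (\<lambda>_. borel)) (\<lambda>z. y(Suc k := z)))"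

definition Q_last ::
  "((nat \<Rightarrow> 'e::topological_space) \<Rightarrow> 'e measure) \<Rightarrow> nat \<Rightarrow> nat \<Rightarrow> (nat \<Rightarrow> 'e) \<Rightarrow> (nat \<Rightarrow> 'e) measure" where
  "Q_last Q k m \<xi> =
     distr (Q_joint Q (k + m) \<xi>) (Pi\<^sub>M {1..m} (\<lambda>_. borel)) (\<lambda>y. \<lambda>i\<in>{1..m}. y (k + i))"

primrec trajectory :: "('h \<times> 'e \<Rightarrow> 'h) \<Rightarrow> 'h \<Rightarrow> (nat \<Rightarrow> 'e) \<Rightarrow> nat \<Rightarrow> 'h" where
  "trajectory S u \<zeta> 0 = u"
| "trajectory S u \<zeta> (Suc k) = S (trajectory S u \<zeta> k, \<zeta> (Suc k))"

definition C2_bounded_on_bounded :: "('a::real_normed_vector \<Rightarrow> 'b::real_normed_vector) \<Rightarrow> bool" where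
  "C2_bounded_on_bounded S \<longleftrightarrow>
     (\<exists>(S' :: 'a \<Rightarrow> 'a \<Rightarrow>\<^sub>L 'b) (S'' :: 'a \<Rightarrow> 'a \<Rightarrow>\<^sub>L 'a \<Rightarrow>\<^sub>L 'b).
        (\<forall>x. (S has_derivative blinfun_apply (S' x)) (at x)) \<and>
        (\<forall>x. (S' has_derivative blinfun_apply (S'' x)) (at x)) \<and>
        continuous_on UNIV S'' \<and>
        (\<forall>B. bounded B \<longrightarrow> bounded (S ` B) \<and> bounded (S' ` B) \<and> bounded (S'' ` B)))"

definition D_u :: "('h::real_normed_vector \<times> 'e \<Rightarrow> 'h) \<Rightarrow> 'h \<Rightarrow> 'e \<Rightarrow> 'h \<Rightarrow> 'h" where
  "D_u S u y = frechet_derivative (\<lambda>v. S (v, y)) (at u)"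

definition D_eta :: "('h::real_normed_vector \<times> 'e::real_normed_vector \<Rightarrow> 'h) \<Rightarrow> 'h \<Rightarrow> 'e \<Rightarrow> 'e \<Rightarrow> 'h" where
  "D_eta S u y = frechet_derivative (\<lambda>z. S (u, z)) (at y)"

definition orth_proj :: "'h::real_inner set \<Rightarrow> 'h \<Rightarrow> 'h" where
  "orth_proj G x = (THE p. p \<in> G \<and> (\<forall>g\<in>G. inner (x - p) g = 0))"

definition finite_dim_subspace :: "'a::real_vector set \<Rightarrow> bool" where
  "finite_dim_subspace F \<longleftrightarrow> (\<exists>B. finite B \<and> F = span B)"

definition determining :: "('h::real_inner \<times> 'e \<Rightarrow> 'h) \<Rightarrow> 'h set \<Rightarrow> 'e set \<Rightarrow> 'h set \<Rightarrow> bool" where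
  "determining S X K G \<longleftrightarrow>
     subspace G \<and> closed G \<and>
     (\<exists>\<kappa>. 0 < \<kappa> \<and> \<kappa> < 1 \<and>
        (\<forall>u\<in>X. \<forall>y\<in>K. onorm (\<lambda>h. D_u S u y h - orth_proj G (D_u S u y h)) \<le> \<kappa>))"

text \<open>Lebesgue measure on a finite-dimensional subspace is fixed only up to a positive factor, i.e. up
  to the choice of a basis \<open>B\<close> that provides the coordinates.\<close>

definition lebesgue_measure_of :: "'e::real_normed_vector set \<Rightarrow> 'e measure \<Rightarrow> bool" where
  "lebesgue_measure_of F \<nu> \<longleftrightarrow>
     (\<exists>B. finite B \<and> independent B \<and> span B = F \<and>
        \<nu> = distr (Pi\<^sub>M B (\<lambda>_. lborel)) borel (\<lambda>c. \<Sum>b\<in>B. c b *\<^sub>R b))"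

text \<open>Continuity into \<open>\<P>(E)\<close> with its weak topology is continuity of the integrals of all bounded
  continuous functions.\<close>

definition hyp_SF ::
  "real \<Rightarrow> 'e::real_normed_vector set \<Rightarrow> (nat \<Rightarrow> 'e) set \<Rightarrow> ((nat \<Rightarrow> 'e) \<Rightarrow> 'e measure) \<Rightarrow> bool" where
  "hyp_SF \<iota> K \<E> Q \<longleftrightarrow>
     (\<forall>\<xi>\<in>\<E>. emeasure (Q \<xi>) K = 1) \<and>
     (\<forall>f :: 'e \<Rightarrow> real. continuous_on UNIV f \<and> bounded (range f) \<longrightarrow>
        continuous_on \<E> (\<lambda>\<xi>. \<integral>y. f y \<partial>Q \<xi>)) \<and>
     (\<exists>C>0. \<forall>\<xi>\<in>\<E>. \<forall>\<xi>'\<in>\<E>. var_dist (Q \<xi>) (Q \<xi>') \<le> C * past_dist \<iota> \<xi> \<xi>')"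

definition hyp_GD :: "('h::real_normed_vector \<times> 'e::zero \<Rightarrow> 'h) \<Rightarrow> bool" where
  "hyp_GD S \<longleftrightarrow>
     (\<exists>k\<ge>1. \<exists>a. 0 < a \<and> a < 1 \<and> (\<forall>u. norm (trajectory S u (\<lambda>_. 0) k) \<le> a * norm u))"

definition hyp_ALC ::
  "('h::real_inner \<times> 'e::real_normed_vector \<Rightarrow> 'h) \<Rightarrow> 'h set \<Rightarrow> 'e set \<Rightarrow> bool" where
  "hyp_ALC S X K \<longleftrightarrow>
     (\<exists>W G. open W \<and> X \<times> K \<subseteq> W \<and> finite_dim_subspace G \<and> determining S X K G \<and>
        (\<forall>(u, y)\<in>W. G \<subseteq> closure (range (D_eta S u y))))"

text \<open>\<open>F' n\<close> is the complementary subspace and \<open>P n\<close> the projection onto \<open>F n\<close> along it.  A pair of components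
  \<open>w \<in> F n\<close>, \<open>z \<in> F' n\<close> is identified with \<open>w + z\<close>, so the density is a function of the past and of a
  point of \<open>E\<close>.\<close>

definition hyp_DLP ::
  "real \<Rightarrow> (nat \<Rightarrow> 'e::real_normed_vector) set \<Rightarrow> ((nat \<Rightarrow> 'e) \<Rightarrow> 'e measure) \<Rightarrow> bool" where
  "hyp_DLP \<iota> \<E> Q \<longleftrightarrow>
     (\<exists>(F :: nat \<Rightarrow> 'e set) (F' :: nat \<Rightarrow> 'e set) (P :: nat \<Rightarrow> 'e \<Rightarrow> 'e).
        (\<forall>n\<ge>1. finite_dim_subspace (F n) \<and> F n \<subseteq> F (Suc n) \<and>
           subspace (F' n) \<and> F n \<inter> F' n = {0} \<and>
           bounded_linear (P n) \<and> (\<forall>x. P n x \<in> F n \<and> x - P n x \<in> F' n)) \<and>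
        closure (\<Union>n\<in>{1..}. F n) = UNIV \<and>
        (\<exists>C. \<forall>n\<ge>1. onorm (P n) \<le> C) \<and>
        (\<forall>n\<ge>1. \<exists>(\<rho> :: (nat \<Rightarrow> 'e) \<Rightarrow> 'e \<Rightarrow> real) \<nu> L.
           lebesgue_measure_of (F n) \<nu> \<and>
           (\<forall>\<xi>\<in>\<E>. \<forall>y. 0 \<le> \<rho> \<xi> y) \<and>
           (\<forall>\<xi>\<in>\<E>. \<forall>\<xi>'\<in>\<E>. \<forall>y y'. \<bar>\<rho> \<xi> y - \<rho> \<xi>' y'\<bar> \<le> L * (past_dist \<iota> \<xi> \<xi>' + norm (y - y'))) \<and>
           (\<forall>\<xi>\<in>\<E>. \<forall>A\<in>sets borel. emeasure (Q \<xi>) A =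
              (\<integral>\<^sup>+ z. (\<integral>\<^sup>+ w. indicator A (w + z) * ennreal (\<rho> \<xi> (w + z)) \<partial>\<nu>)
                 \<partial>distr (Q \<xi>) borel (\<lambda>x. x - P n x)))))"

definition hyp_SRZ ::
  "(nat \<Rightarrow> 'e::real_normed_vector) set \<Rightarrow> ((nat \<Rightarrow> 'e) \<Rightarrow> 'e measure) \<Rightarrow> bool" where
  "hyp_SRZ \<E> Q \<longleftrightarrow>
     (\<forall>n\<ge>1. \<forall>\<delta>>0. \<exists>s.
        (INF \<xi>\<in>\<E>. measure (Q_last Q s n \<xi>) (Pi\<^sub>E {1..n} (\<lambda>_. ball 0 \<delta>))) > 0)"

definition U_kernel ::
  "('h::topological_space \<times> 'e \<Rightarrow> 'h) \<Rightarrow> ((nat \<Rightarrow> 'e::topological_space) \<Rightarrow> 'e measure) \<Rightarrow>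
     'h \<times> (nat \<Rightarrow> 'e) \<Rightarrow> ('h \<times> (nat \<Rightarrow> 'e)) measure" where
  "U_kernel S Q = (\<lambda>(v, \<xi>). distr (Q \<xi>) borel (\<lambda>\<zeta>. (S (v, \<zeta>), snoc \<xi> \<zeta>)))"

text \<open>A measure on a subset \<open>Y\<close> is represented by a Borel measure on the whole type that gives \<open>Y\<close> mass 1.\<close>

definition stationary_measure :: "'a::topological_space set \<Rightarrow> ('a \<Rightarrow> 'a measure) \<Rightarrow> 'a measure \<Rightarrow> bool" where
  "stationary_measure Y R \<mu> \<longleftrightarrow>
     prob_space \<mu> \<and> sets \<mu> = sets borel \<and> emeasure \<mu> Y = 1 \<and> \<mu> \<bind> R = \<mu>"

definition markov_trajectory :: "('a::topological_space \<Rightarrow> 'a measure) \<Rightarrow> 'v measure \<Rightarrow> (nat \<Rightarrow> 'v \<Rightarrow> 'a) \<Rightarrow> bool" where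
  "markov_trajectory R N V \<longleftrightarrow>
     prob_space N \<and> (\<forall>k. V k \<in> borel_measurable N) \<and>
     (\<forall>k. \<forall>A\<in>sets (Pi\<^sub>M {..k} (\<lambda>_. borel)). \<forall>B\<in>sets borel.
        measure N {\<omega> \<in> space N. (\<lambda>i\<in>{..k}. V i \<omega>) \<in> A \<and> V (Suc k) \<omega> \<in> B} =
        (\<integral>\<omega>. indicator A (\<lambda>i\<in>{..k}. V i \<omega>) * measure (R (V k \<omega>)) B \<partial>N))"

definition admissible_initial ::
  "'w measure \<Rightarrow> (int \<Rightarrow> 'w \<Rightarrow> 'e::topological_space) \<Rightarrow> 'h::topological_space set \<Rightarrow> ('w \<Rightarrow> 'h) \<Rightarrow> bool" where
  "admissible_initial M \<eta> X u \<longleftrightarrow>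
     u \<in> borel_measurable M \<and> (\<forall>\<omega>\<in>space M. u \<omega> \<in> X) \<and>
     prob_space.indep_set M
       (sets (vimage_algebra (space M) u borel))
       (sets (vimage_algebra (space M) (\<lambda>\<omega> k. \<eta> k \<omega>) (borel :: (int \<Rightarrow> 'e) measure)))"

definition sum_dist :: "nat \<Rightarrow> (nat \<Rightarrow> 'h::metric_space) \<Rightarrow> (nat \<Rightarrow> 'h) \<Rightarrow> real" where
  "sum_dist s x y = (\<Sum>i\<le>s. dist (x i) (y i))"

text \<open>The law of \<open>[x\<^sub>k, \<dots>, x\<^sub>k\<^sub>+\<^sub>s]\<close> as a measure on \<open>X\<^sup>s\<^sup>+\<^sup>1\<close>, for a process that stays in the measurable
  set \<open>X\<close> almost surely.  It is obtained by restriction because the processes below are in \<open>X\<close> only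
  up to null sets.\<close>

definition segment_law ::
  "'w measure \<Rightarrow> 'h::topological_space set \<Rightarrow> nat \<Rightarrow> (nat \<Rightarrow> 'w \<Rightarrow> 'h) \<Rightarrow> nat \<Rightarrow> (nat \<Rightarrow> 'h) measure" where
  "segment_law M X s x k =
     restrict_space (distr M (Pi\<^sub>M {..s} (\<lambda>_. borel)) (\<lambda>\<omega>. \<lambda>i\<in>{..s}. x (k + i) \<omega>))
       (Pi\<^sub>E {..s} (\<lambda>_. X))"

end

(*
  The U-process has the e-property and reaches a neighbourhood of one state uniformly, and these two
  facts force the oscillation of P^k g to zero uniformly over bounded Lipschitz g.

  E-property: for two nearby states (u, xi), (u', xi'), approximate linearised controllability gives
  finitely many linear maps R_i into some F_n such that shifting the noise y near the i-th point by
  R_i (u' - u) contracts the distance of the trajectories.  As the noise has Lipschitz densities along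
  F_n, such shifts change its law by O(|u' - u|) in total variation, and (SF) bounds the effect of the
  different pasts.  Hence |P g z - P g z'| is at most (a q + C) d(z, z') with q < 1 if g is bounded by 1
  and a-Lipschitz, so that the Lipschitz constants of P^k g stay bounded.  No coupling of
  whole trajectories is needed.

  Irreducibility: by (SRZ) the noise is small during n consecutive steps with a probability bounded
  below, and then (GD) brings the trajectory close to 0 and the recent past close to the zero sequence.

  Segments of length s + 1 are reduced to single states by integrating out the last s steps one by one,
  and the trajectory (u_k, (eta_j) for j <= k) is itself a trajectory of the U-process.
*)

theory Submission
  imports Defs
begin

section \<open>Support and variation distance\<close>

text \<open>Three obstacles shape the estimate of |P g z - P g z'|. The shifted noise is appended to
  the past of the second state, so every shift costs distance between the pasts; the metric
  therefore weighs the first component by a large A, and the contraction there pays for this cost.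
  The shifted noise may also lead out of the support \<open>\<E>\<close> of the pasts, where nothing
  is known about g; the probability of this is O(d(z, z')), because the shifted law is that close in
  total variation to a law that never leaves. Finally, (SF) and the densities speak only of pasts in
  \<open>\<E>\<close>, so the kernel has to be shown not to leave \<open>\<E>\<close> from every
  point of it, not merely from almost every one. The estimate is proved for two functions g, g' that
  are close up to an additive constant, because integrating out the end of a segment produces
  functions that depend on its beginning.\<close>

lemma closed_msupport: "closed (msupport \<mu>)"
proof -
  have "- msupport \<mu> = \<Union>{U. open U \<and> emeasure \<mu> U = 0}"
    by (auto simp: msupport_def zero_less_iff_neq_zero)
  then show ?thesis
    by (metis (no_types, lifting) closed_def mem_Collect_eq open_Union)
qed

text \<open>Second countability is the point: the complement is covered by the null members of a
  countable basis.\<close>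

lemma emeasure_Compl_msupport:
  fixes \<mu> :: "'a::second_countable_topology measure"
  assumes "sets \<mu> = sets borel"
  shows "emeasure \<mu> (- msupport \<mu>) = 0"
proof -
  obtain B :: "'a set set" where B: "countable B" "topological_basis B"
    using ex_countable_basis by blast
  define C where "C = {b \<in> B. emeasure \<mu> b = 0}"
  have bo: "open b" if "b \<in> B" for b using B(2) that topological_basis_open by blast
  have "- msupport \<mu> \<subseteq> (\<Union>b\<in>C. b)"
  proof
    fix x assume "x \<in> - msupport \<mu>"
    then obtain U where U: "open U" "x \<in> U" "emeasure \<mu> U = 0"
      by (auto simp: msupport_def zero_less_iff_neq_zero)
    then obtain b where "b \<in> B" "x \<in> b" "b \<subseteq> U"
      using topological_basisE[OF B(2)] by metis
    moreover have "emeasure \<mu> b \<le> emeasure \<mu> U"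
      by (rule emeasure_mono) (use U \<open>b \<subseteq> U\<close> assms in auto)
    ultimately show "x \<in> (\<Union>b\<in>C. b)" using U by (auto simp: C_def)
  qed
  moreover have "(\<Union>b\<in>C. b) \<in> null_sets \<mu>"
    by (rule null_sets_UN') (use B bo assms in \<open>auto simp: C_def intro: countable_subset[OF _ B(1)]\<close>)
  moreover have "- msupport \<mu> \<in> sets \<mu>"
    using assms closed_msupport[of \<mu>] by auto
  ultimately show ?thesis
    by (meson null_setsD1 null_sets_subset)
qed

lemma AE_msupport:
  fixes \<mu> :: "'a::second_countable_topology measure"
  assumes "sets \<mu> = sets borel" "prob_space \<mu>"
  shows "AE x in \<mu>. x \<in> msupport \<mu>"
proof (rule AE_I[where N = "- msupport \<mu>"])
  show "- msupport \<mu> \<in> sets \<mu>"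
    using assms closed_msupport[of \<mu>] by auto
qed (use assms emeasure_Compl_msupport in auto)

lemma measure_diff_le_var_dist:
  assumes "prob_space \<mu>" "prob_space \<nu>" "A \<in> sets \<mu>"
  shows "\<bar>measure \<mu> A - measure \<nu> A\<bar> \<le> var_dist \<mu> \<nu>"
  unfolding var_dist_def
proof (rule cSUP_upper[OF assms(3)])
  show "bdd_above ((\<lambda>A. \<bar>measure \<mu> A - measure \<nu> A\<bar>) ` sets \<mu>)"
  proof (rule bdd_aboveI2)
    fix A show "\<bar>measure \<mu> A - measure \<nu> A\<bar> \<le> 1"
      using prob_space.prob_le_1[OF assms(1), of A] prob_space.prob_le_1[OF assms(2), of A]
        measure_nonneg[of \<mu> A] measure_nonneg[of \<nu> A]
      by linarith
  qed
qed

lemma integral_diff_le_var_dist_unit: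
  fixes f :: "'a \<Rightarrow> real"
  assumes mu: "prob_space \<mu>" and nu: "prob_space \<nu>" and s: "sets \<nu> = sets \<mu>"
    and f[measurable]: "f \<in> borel_measurable \<mu>" and f01: "\<And>x. 0 \<le> f x" "\<And>x. f x \<le> 1"
  shows "(\<integral>x. f x \<partial>\<mu>) - (\<integral>x. f x \<partial>\<nu>) \<le> var_dist \<mu> \<nu>"
proof -
  interpret mu: prob_space \<mu> by fact
  interpret nu: prob_space \<nu> by fact
  have fn[measurable]: "f \<in> borel_measurable \<nu>" using f s measurable_cong_sets by blast
  have sp: "space \<nu> = space \<mu>" using s sets_eq_imp_space_eq by blast
  \<comment> \<open>Layer cake, discretised: \<open>f\<close> is within \<open>1 / m\<close> of the average of the indicators of
      \<open>{f \<ge> j / m}\<close>, \<open>j = 1, \<dots>, m\<close>.\<close>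
  have key: "(\<integral>x. f x \<partial>\<mu>) - (\<integral>x. f x \<partial>\<nu>) \<le> var_dist \<mu> \<nu> + 1 / real m" if m: "m > 0" for m :: nat
  proof -
    define A where "A j = {x \<in> space \<mu>. real j \<le> real m * f x}" for j
    have A[measurable]: "A j \<in> sets \<mu>" for j unfolding A_def by measurable
    have An[measurable]: "A j \<in> sets \<nu>" for j using A s by simp
    define g where "g x = (\<Sum>j=1..m. indicator (A j) x / real m :: real)" for x
    have gx: "g x = real_of_int \<lfloor>real m * f x\<rfloor> / real m" if x: "x \<in> space \<mu>" for x
    proof -
      have "real m * f x \<le> real m" using f01(2)[of x] m by (simp add: mult_left_le)
      then have fl: "nat \<lfloor>real m * f x\<rfloor> \<le> m" by linarith
      have "(\<Sum>j=1..m. indicator (A j) x :: real) = (\<Sum>j\<in>{1..m}. if j \<le> nat \<lfloor>real m * f x\<rfloor> then 1 else 0)"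
      proof (rule sum.cong)
        fix j assume "j \<in> {1..m}"
        have "real j \<le> real m * f x \<longleftrightarrow> j \<le> nat \<lfloor>real m * f x\<rfloor>"
          using f01(1)[of x] m by (simp add: le_nat_iff le_floor_iff)
        then show "indicator (A j) x = (if j \<le> nat \<lfloor>real m * f x\<rfloor> then 1 else (0::real))"
          using x by (auto simp: A_def indicator_def)
      qed simp
      also have "\<dots> = real (card {j\<in>{1..m}. j \<le> nat \<lfloor>real m * f x\<rfloor>})"
        by (subst sum.inter_filter[symmetric]) auto
      also have "{j\<in>{1..m}. j \<le> nat \<lfloor>real m * f x\<rfloor>} = {1..nat \<lfloor>real m * f x\<rfloor>}" using fl by auto
      finally have "(\<Sum>j=1..m. indicator (A j) x :: real) = real (nat \<lfloor>real m * f x\<rfloor>)" by simp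
      moreover have "real (nat \<lfloor>real m * f x\<rfloor>) = real_of_int \<lfloor>real m * f x\<rfloor>"
        using f01(1)[of x] by simp
      ultimately show ?thesis by (simp add: g_def sum_divide_distrib[symmetric])
    qed
    have le: "g x \<le> f x" and ge: "f x \<le> g x + 1 / m" if x: "x \<in> space \<mu>" for x
    proof -
      have "real_of_int \<lfloor>real m * f x\<rfloor> \<le> real m * f x" "real m * f x \<le> real_of_int \<lfloor>real m * f x\<rfloor> + 1"
        by linarith+
      then show "g x \<le> f x" "f x \<le> g x + 1 / m"
        using m by (simp_all add: gx[OF x] field_simps)
    qed
    have if1: "integrable \<mu> f" "integrable \<nu> f"
      by (auto intro!: mu.integrable_const_bound[where B=1] nu.integrable_const_bound[where B=1] simp: f01 abs_of_nonneg)
    have ig: "integrable \<mu> g" "integrable \<nu> g"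
      unfolding g_def by (auto intro!: Bochner_Integration.integrable_sum integrable_divide integrable_real_indicator simp: less_top[symmetric])
    have "(\<integral>x. f x \<partial>\<mu>) \<le> (\<integral>x. g x + 1 / m \<partial>\<mu>)"
      by (rule integral_mono) (use if1 ig ge in auto)
    then have 1: "(\<integral>x. f x \<partial>\<mu>) \<le> (\<integral>x. g x \<partial>\<mu>) + 1 / m"
      using ig by (simp add: mu.prob_space)
    have 2: "(\<integral>x. g x \<partial>\<nu>) \<le> (\<integral>x. f x \<partial>\<nu>)"
      by (rule integral_mono) (use if1 ig le sp in auto)
    have "(\<integral>x. g x \<partial>\<mu>) - (\<integral>x. g x \<partial>\<nu>) = (\<Sum>j=1..m. (measure \<mu> (A j) - measure \<nu> (A j)) / m)"
    proof -
      have "integrable \<mu> (\<lambda>x. indicator (A j) x / real m :: real)" "integrable \<nu> (\<lambda>x. indicator (A j) x / real m :: real)" for j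
        by (auto intro!: integrable_divide integrable_real_indicator simp: less_top[symmetric])
      then have "(\<integral>x. g x \<partial>\<mu>) = (\<Sum>j=1..m. measure \<mu> (A j) / m)" "(\<integral>x. g x \<partial>\<nu>) = (\<Sum>j=1..m. measure \<nu> (A j) / m)"
        unfolding g_def by (subst Bochner_Integration.integral_sum; simp)+
      then show ?thesis by (simp add: sum_subtractf[symmetric] diff_divide_distrib)
    qed
    also have "\<dots> \<le> (\<Sum>j=1..m. var_dist \<mu> \<nu> / m)"
      by (intro sum_mono divide_right_mono order_trans[OF abs_ge_self measure_diff_le_var_dist[OF mu nu]]) auto
    also have "\<dots> = var_dist \<mu> \<nu>" using m by simp
    finally show ?thesis using 1 2 by linarith
  qed
  show ?thesis
  proof (rule field_le_epsilon)
    fix e :: real assume "e > 0"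
    then obtain m :: nat where "m > 0" "1 / real m < e"
      by (metis nat_approx_posE zero_less_Suc)
    then show "(\<integral>x. f x \<partial>\<mu>) - (\<integral>x. f x \<partial>\<nu>) \<le> var_dist \<mu> \<nu> + e" using key[of m] by linarith
  qed
qed

text \<open>The factor 2 comes from squeezing [-1, 1] into [0, 1]: the unit case for (1 + f) / 2 and
  for (1 - f) / 2 gives the two signs.\<close>

lemma integral_diff_le_var_dist:
  fixes f :: "'a \<Rightarrow> real"
  assumes mu: "prob_space \<mu>" and nu: "prob_space \<nu>" and s: "sets \<nu> = sets \<mu>"
    and f[measurable]: "f \<in> borel_measurable \<mu>" and f1: "\<And>x. \<bar>f x\<bar> \<le> 1"
  shows "\<bar>(\<integral>x. f x \<partial>\<mu>) - (\<integral>x. f x \<partial>\<nu>)\<bar> \<le> 2 * var_dist \<mu> \<nu>"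
proof -
  interpret mu: prob_space \<mu> by fact
  interpret nu: prob_space \<nu> by fact
  have fn[measurable]: "f \<in> borel_measurable \<nu>" using f s measurable_cong_sets by blast
  have if1: "integrable \<mu> f" "integrable \<nu> f"
    by (auto intro!: mu.integrable_const_bound[where B=1] nu.integrable_const_bound[where B=1] simp: f1)
  have *: "0 \<le> 1 + f x" "f x \<le> 1" for x using f1[of x] by linarith+
  have "(\<integral>x. (1 + f x) / 2 \<partial>\<mu>) - (\<integral>x. (1 + f x) / 2 \<partial>\<nu>) \<le> var_dist \<mu> \<nu>"
    by (rule integral_diff_le_var_dist_unit[OF mu nu s]) (use * in \<open>auto simp: field_simps\<close>)
  moreover have "(\<integral>x. (1 - f x) / 2 \<partial>\<mu>) - (\<integral>x. (1 - f x) / 2 \<partial>\<nu>) \<le> var_dist \<mu> \<nu>"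
    by (rule integral_diff_le_var_dist_unit[OF mu nu s]) (use * in \<open>auto simp: field_simps\<close>)
  ultimately show ?thesis
    using if1 by (simp add: mu.prob_space nu.prob_space abs_le_iff field_simps)
qed

section \<open>Conditional kernels and pasts\<close>

lemma measure_eqI_rectangles:
  assumes "prob_space \<mu>" "prob_space \<nu>"
    and sm: "sets \<mu> = sets (A \<Otimes>\<^sub>M B)" and sn: "sets \<nu> = sets (A \<Otimes>\<^sub>M B)"
    and eq: "\<And>a b. a \<in> sets A \<Longrightarrow> b \<in> sets B \<Longrightarrow> measure \<mu> (a \<times> b) = measure \<nu> (a \<times> b)"
  shows "\<mu> = \<nu>"
proof -
  interpret mu: prob_space \<mu> by fact
  interpret nu: prob_space \<nu> by fact
  show ?thesis
  proof (rule measure_eqI_generator_eq[OF Int_stable_pair_measure_generator[of A B] pair_measure_closed])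
    show "sets \<mu> = sigma_sets (space A \<times> space B) {a \<times> b |a b. a \<in> sets A \<and> b \<in> sets B}"
      "sets \<nu> = sigma_sets (space A \<times> space B) {a \<times> b |a b. a \<in> sets A \<and> b \<in> sets B}"
      using sm sn by (simp_all add: sets_pair_measure)
    show "range (\<lambda>_::nat. space A \<times> space B) \<subseteq> {a \<times> b |a b. a \<in> sets A \<and> b \<in> sets B}" by auto
  qed (auto simp: eq mu.emeasure_eq_measure nu.emeasure_eq_measure)
qed

text \<open>The law of \<open>(X, Y)\<close> is the law of \<open>X\<close> bound with the kernel
  that attaches x to a sample of \<open>\<kappa> x\<close>; agreement on rectangles suffices. The
  lemma serves both for the noise given its past and for the next state given the path.\<close>

lemma integral_conditional_kernel:
  fixes f :: "'a \<times> 'b \<Rightarrow> real"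
  assumes "prob_space M"
    and [measurable]: "X \<in> measurable M A" "Y \<in> measurable M B" "\<kappa> \<in> measurable A (prob_algebra B)"
    and rect: "\<And>a b. a \<in> sets A \<Longrightarrow> b \<in> sets B \<Longrightarrow>
        measure M {\<omega> \<in> space M. X \<omega> \<in> a \<and> Y \<omega> \<in> b} = (\<integral>\<omega>. indicator a (X \<omega>) * measure (\<kappa> (X \<omega>)) b \<partial>M)"
    and f[measurable]: "f \<in> borel_measurable (A \<Otimes>\<^sub>M B)" and bd: "\<And>x. \<bar>f x\<bar> \<le> c"
  shows "(\<integral>\<omega>. f (X \<omega>, Y \<omega>) \<partial>M) = (\<integral>\<omega>. (\<integral>y. f (X \<omega>, y) \<partial>\<kappa> (X \<omega>)) \<partial>M)"
proof -
  interpret M: prob_space M by fact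
  define k where "k x = distr (\<kappa> x) (A \<Otimes>\<^sub>M B) (\<lambda>y. (x, y))" for x
  have k[measurable]: "k \<in> measurable A (prob_algebra (A \<Otimes>\<^sub>M B))"
    unfolding k_def by measurable
  have k'[measurable]: "k \<in> measurable A (subprob_algebra (A \<Otimes>\<^sub>M B))"
    by (rule measurable_prob_algebraD) (rule k)
  define L where "L = distr M A X"
  have sL[measurable_cong]: "sets L = sets A" by (simp add: L_def)
  have spL: "space L = space A" by (simp add: L_def)
  interpret L: prob_space L unfolding L_def by (rule M.prob_space_distr) simp
  have Lp: "L \<in> space (prob_algebra A)" by (simp add: space_prob_algebra sL L.prob_space_axioms)
  have kap: "prob_space (\<kappa> x)" "sets (\<kappa> x) = sets B" if "x \<in> space A" for x
    using measurable_space[OF \<open>\<kappa> \<in> measurable A (prob_algebra B)\<close> that] by (auto simp: space_prob_algebra)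
  have kL: "k \<in> measurable L (subprob_algebra (A \<Otimes>\<^sub>M B))" by measurable
  have "distr M (A \<Otimes>\<^sub>M B) (\<lambda>\<omega>. (X \<omega>, Y \<omega>)) = L \<bind> k"
  proof (rule measure_eqI_rectangles[where A=A and B=B])
    show "prob_space (distr M (A \<Otimes>\<^sub>M B) (\<lambda>\<omega>. (X \<omega>, Y \<omega>)))" by (rule M.prob_space_distr) simp
    show "prob_space (L \<bind> k)" by (rule prob_space_bind'[OF Lp k])
    show "sets (L \<bind> k) = sets (A \<Otimes>\<^sub>M B)" by (rule sets_bind'[OF Lp k])
    fix a b assume [measurable]: "a \<in> sets A" "b \<in> sets B"
    have "measure (distr M (A \<Otimes>\<^sub>M B) (\<lambda>\<omega>. (X \<omega>, Y \<omega>))) (a \<times> b) = measure M {\<omega> \<in> space M. X \<omega> \<in> a \<and> Y \<omega> \<in> b}"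
      by (subst measure_distr) (auto intro!: arg_cong[where f="measure M"])
    also have "\<dots> = (\<integral>x. indicator a x * measure (\<kappa> x) b \<partial>L)"
      unfolding L_def by (subst integral_distr) (auto simp: rect)
    also have "\<dots> = (\<integral>x. measure (k x) (a \<times> b) \<partial>L)"
    proof (rule Bochner_Integration.integral_cong[OF refl])
      fix x assume "x \<in> space L"
      then have x: "x \<in> space A" by (simp add: spL)
      have [measurable_cong]: "sets (\<kappa> x) = sets B" by (rule kap[OF x])
      have spk: "space (\<kappa> x) = space B" using kap(2)[OF x] sets_eq_imp_space_eq by blast
      have "Pair x -` (a \<times> b) \<inter> space (\<kappa> x) = (if x \<in> a then b else {})"
        using sets.sets_into_space[OF \<open>b \<in> sets B\<close>] by (auto simp: spk)
      then show "indicator a x * measure (\<kappa> x) b = measure (k x) (a \<times> b)"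
        unfolding k_def using x by (subst measure_distr) (auto simp: indicator_def)
    qed
    also have "\<dots> = measure (L \<bind> k) (a \<times> b)"
      by (rule L.measure_bind[symmetric, OF kL]) auto
    finally show "measure (distr M (A \<Otimes>\<^sub>M B) (\<lambda>\<omega>. (X \<omega>, Y \<omega>))) (a \<times> b) = measure (L \<bind> k) (a \<times> b)" .
  qed simp
  then have "(\<integral>\<omega>. f (X \<omega>, Y \<omega>) \<partial>M) = integral\<^sup>L (L \<bind> k) f"
    by (subst (asm) eq_commute) (simp add: integral_distr)
  also have "\<dots> = (\<integral>x. integral\<^sup>L (k x) f \<partial>L)"
  proof (rule integral_bind[where K = "A \<Otimes>\<^sub>M B" and B' = 1 and B = c])
    show "AE x in L. emeasure (k x) (space (k x)) \<le> ennreal 1"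
    proof (rule AE_I2)
      fix x assume "x \<in> space L"
      then have "k x \<in> space (prob_algebra (A \<Otimes>\<^sub>M B))" using measurable_space[OF k] by (simp add: spL)
      then interpret prob_space "k x" by (simp add: space_prob_algebra)
      show "emeasure (k x) (space (k x)) \<le> ennreal 1" by (simp add: emeasure_space_1)
    qed
    show "finite_measure L" by (rule L.finite_measure_axioms)
  qed (use bd f kL in auto)
  also have "\<dots> = (\<integral>x. (\<integral>y. f (x, y) \<partial>\<kappa> x) \<partial>L)"
  proof (rule Bochner_Integration.integral_cong[OF refl])
    fix x assume "x \<in> space L"
    then have x: "x \<in> space A" by (simp add: spL)
    have [measurable_cong]: "sets (\<kappa> x) = sets B" by (rule kap[OF x])
    show "integral\<^sup>L (k x) f = (\<integral>y. f (x, y) \<partial>\<kappa> x)"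
      unfolding k_def using x by (subst integral_distr) auto
  qed
  also have "\<dots> = (\<integral>\<omega>. (\<integral>y. f (X \<omega>, y) \<partial>\<kappa> (X \<omega>)) \<partial>M)"
  proof -
    have "(\<lambda>x. \<integral>y. f (x, y) \<partial>\<kappa> x) \<in> borel_measurable A"
    proof (subst measurable_cong)
      show "(\<lambda>x. integral\<^sup>L (k x) f) \<in> borel_measurable A"
        by (rule measurable_compose[OF k' integral_measurable_subprob_algebra]) simp
      fix x assume x: "x \<in> space A"
      have [measurable_cong]: "sets (\<kappa> x) = sets B" by (rule kap[OF x])
      show "(\<integral>y. f (x, y) \<partial>\<kappa> x) = integral\<^sup>L (k x) f"
        unfolding k_def using x by (subst integral_distr) auto
    qed
    then show ?thesis unfolding L_def by (subst integral_distr) auto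
  qed
  finally show ?thesis .
qed

section \<open>Pasts: concatenation and the weighted distance\<close>

lemma snoc_0 [simp]: "snoc \<xi> y 0 = y"
  and snoc_Suc [simp]: "snoc \<xi> y (Suc n) = \<xi> n"
  by (simp_all add: snoc_def)

lemma continuous_snoc: "continuous_on UNIV (\<lambda>p::(nat \<Rightarrow> 'e::topological_space) \<times> 'e. snoc (fst p) (snd p))"
proof (rule continuous_on_coordinatewise_then_product)
  fix n show "continuous_on UNIV (\<lambda>p::(nat \<Rightarrow> 'e) \<times> 'e. snoc (fst p) (snd p) n)"
  proof (cases n)
    case (Suc m)
    have "continuous_on UNIV (\<lambda>p::(nat \<Rightarrow> 'e) \<times> 'e. fst p m)"
      by (rule continuous_on_product_then_coordinatewise) (intro continuous_intros)
    then show ?thesis by (simp add: Suc)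
  qed (auto intro!: continuous_intros)
qed

lemma continuous_on_snoc [continuous_intros]:
  assumes "continuous_on A f" "continuous_on A g"
  shows "continuous_on A (\<lambda>x. snoc (f x) (g x))"
  using continuous_on_compose2[OF continuous_snoc continuous_on_Pair[OF assms]] by simp

lemma snoc_measurable [measurable (raw)]:
  fixes g :: "'a \<Rightarrow> 'e::second_countable_topology"
  assumes "f \<in> borel_measurable M" "g \<in> borel_measurable M"
  shows "(\<lambda>x. snoc (f x) (g x)) \<in> borel_measurable M"
proof -
  have "(\<lambda>x. (f x, g x)) \<in> borel_measurable M"
    using assms borel_measurable_Pair by blast
  then show ?thesis
    using measurable_compose[OF _ borel_measurable_continuous_onI[OF continuous_snoc], of _ M] by force
qed

lemma coordinate_measurable:
  "(\<lambda>\<xi> :: 'i \<Rightarrow> 'e::topological_space. \<xi> i) \<in> borel_measurable borel"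
  by (rule borel_measurable_continuous_onI[OF continuous_on_product_coordinates])

context
  fixes \<iota> :: real and R :: real
  assumes \<iota>: "\<iota> > 1"
begin

text \<open>For unbounded pasts the series defining \<open>past_dist\<close> may diverge and
  \<open>suminf\<close> loses its meaning, hence the bound \<open>R\<close> throughout.\<close>

lemma past_dist_summable:
  fixes \<xi> \<xi>' :: "nat \<Rightarrow> 'e::real_normed_vector"
  assumes "\<And>n. norm (\<xi> n) \<le> R" "\<And>n. norm (\<xi>' n) \<le> R"
  shows "summable (\<lambda>n. norm (\<xi> n - \<xi>' n) / \<iota> ^ n)"
proof (rule summable_comparison_test')
  show "summable (\<lambda>n. 2 * R * (1 / \<iota>) ^ n)"
    using \<iota> by (intro summable_mult summable_geometric) auto
  fix n
  have "norm (\<xi> n - \<xi>' n) \<le> 2 * R"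
    using norm_triangle_ineq4[of "\<xi> n" "\<xi>' n"] assms[of n] by linarith
  then show "norm (norm (\<xi> n - \<xi>' n) / \<iota> ^ n) \<le> 2 * R * (1 / \<iota>) ^ n"
    using \<iota> by (simp add: power_divide divide_right_mono)
qed

lemma past_dist_nonneg: "0 \<le> past_dist \<iota> \<xi> \<xi>'" if "\<And>n. norm (\<xi> n) \<le> R" "\<And>n. norm (\<xi>' n) \<le> R"
  unfolding past_dist_def using \<iota> past_dist_summable[OF that] by (intro suminf_nonneg) auto

text \<open>Appending an entry moves all others one place back, where their weight is smaller by the
  factor \<iota>. This is the contraction rate of the past component.\<close>

lemma past_dist_snoc:
  assumes "\<And>n. norm (\<xi> n) \<le> R" "\<And>n. norm (\<xi>' n) \<le> R"
  shows "past_dist \<iota> (snoc \<xi> y) (snoc \<xi>' y') = norm (y - y') + past_dist \<iota> \<xi> \<xi>' / \<iota>"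
proof -
  let ?f = "\<lambda>n. norm (snoc \<xi> y n - snoc \<xi>' y' n) / \<iota> ^ n"
  have eq: "?f (Suc n) = norm (\<xi> n - \<xi>' n) / \<iota> ^ n / \<iota>" for n by (simp add: divide_divide_eq_left mult.commute)
  have "summable (\<lambda>n. ?f (Suc n))"
    unfolding eq by (rule summable_divide[OF past_dist_summable[OF assms]])
  then have "summable ?f" using summable_Suc_iff[of ?f] by blast
  then have "(\<Sum>n. ?f (Suc n)) = suminf ?f - ?f 0" by (rule suminf_split_head)
  moreover have "(\<Sum>n. ?f (Suc n)) = past_dist \<iota> \<xi> \<xi>' / \<iota>"
    unfolding eq past_dist_def by (rule suminf_divide[OF past_dist_summable[OF assms]])
  ultimately show ?thesis by (simp add: past_dist_def)
qed

text \<open>Shows that a neighbourhood in the product topology, which constrains finitely many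
  entries, is small in \<open>past_dist\<close>: the tail after \<open>m\<close> entries contributes
  at most a geometric series. With m = 0 it bounds all distances.\<close>

lemma past_dist_le:
  fixes \<xi> \<xi>' :: "nat \<Rightarrow> 'e::real_normed_vector"
  assumes "\<And>n. norm (\<xi> n) \<le> R" "\<And>n. norm (\<xi>' n) \<le> R" and "\<And>i. i < m \<Longrightarrow> norm (\<xi> i - \<xi>' i) \<le> \<delta>" "0 \<le> \<delta>"
  shows "past_dist \<iota> \<xi> \<xi>' \<le> (\<delta> + 2 * R / \<iota> ^ m) * (\<iota> / (\<iota> - 1))"
proof -
  have g: "(\<lambda>n. (1 / \<iota>) ^ n) sums (\<iota> / (\<iota> - 1))"
    using geometric_sums[of "1 / \<iota>"] \<iota> by (simp add: field_simps)
  have R: "0 \<le> R" using assms(1)[of 0] norm_ge_zero order_trans by blast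
  have d: "norm (\<xi> n - \<xi>' n) \<le> 2 * R" for n
    using norm_triangle_ineq4[of "\<xi> n" "\<xi>' n"] assms(1)[of n] assms(2)[of n] by linarith
  have h: "(\<lambda>n. \<delta> * (1 / \<iota>) ^ n) sums (\<delta> * (\<iota> / (\<iota> - 1)))" by (rule sums_mult[OF g])
  have past: "past_dist \<iota> \<xi> \<xi>' = (\<Sum>i. norm (\<xi> (i + m) - \<xi>' (i + m)) / \<iota> ^ (i + m)) + (\<Sum>i<m. norm (\<xi> i - \<xi>' i) / \<iota> ^ i)"
    unfolding past_dist_def by (rule suminf_split_initial_segment[OF past_dist_summable[OF assms(1,2)]])
  have "(\<Sum>i. norm (\<xi> (i + m) - \<xi>' (i + m)) / \<iota> ^ (i + m)) \<le> (\<Sum>i. 2 * R / \<iota> ^ m * (1 / \<iota>) ^ i)"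
  proof (rule suminf_le)
    show "norm (\<xi> (i + m) - \<xi>' (i + m)) / \<iota> ^ (i + m) \<le> 2 * R / \<iota> ^ m * (1 / \<iota>) ^ i" for i
      using d[of "i + m"] \<iota> by (simp add: power_add power_divide divide_right_mono mult.commute)
    show "summable (\<lambda>i. norm (\<xi> (i + m) - \<xi>' (i + m)) / \<iota> ^ (i + m))"
      using past_dist_summable[OF assms(1,2)] summable_iff_shift[of "\<lambda>n. norm (\<xi> n - \<xi>' n) / \<iota> ^ n" m] by simp
    show "summable (\<lambda>i. 2 * R / \<iota> ^ m * (1 / \<iota>) ^ i)" using g by (intro summable_mult) (rule sums_summable)
  qed
  also have "\<dots> = 2 * R / \<iota> ^ m * (\<iota> / (\<iota> - 1))"
    using sums_unique[OF sums_mult[OF g, of "2 * R / \<iota> ^ m"]] by simp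
  finally have 1: "(\<Sum>i. norm (\<xi> (i + m) - \<xi>' (i + m)) / \<iota> ^ (i + m)) \<le> 2 * R / \<iota> ^ m * (\<iota> / (\<iota> - 1))" .
  have "(\<Sum>i<m. norm (\<xi> i - \<xi>' i) / \<iota> ^ i) \<le> \<delta> * (\<iota> / (\<iota> - 1))"
  proof -
    have "(\<Sum>i<m. norm (\<xi> i - \<xi>' i) / \<iota> ^ i) \<le> (\<Sum>i<m. \<delta> * (1 / \<iota>) ^ i)"
      using assms(3) \<iota> by (intro sum_mono) (simp add: power_divide divide_right_mono)
    also have "\<dots> \<le> (\<Sum>i. \<delta> * (1 / \<iota>) ^ i)"
      using sums_summable[OF h] \<iota> \<open>0 \<le> \<delta>\<close> by (intro sum_le_suminf) auto
    finally show ?thesis using sums_unique[OF h] by simp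
  qed
  then show ?thesis using 1 past by (simp add: algebra_simps)
qed

end

section \<open>The conditional law of the noise\<close>

text \<open>The process is forgotten here. Contraction and mixing use only the kernel and a closed
  set of pasts that it does not leave.\<close>

locale noise_kernel =
  fixes K :: "'e::{banach, second_countable_topology} set" and \<E> :: "(nat \<Rightarrow> 'e) set"
    and Q :: "(nat \<Rightarrow> 'e) \<Rightarrow> 'e measure" and \<iota> C\<^sub>Q :: real
  assumes compact_K: "compact K" and closed_\<E>: "closed \<E>"
    and \<E>_K: "\<And>\<xi> n. \<xi> \<in> \<E> \<Longrightarrow> \<xi> n \<in> K"
    and Q_measurable [measurable]: "Q \<in> borel \<rightarrow>\<^sub>M prob_algebra borel"
    and \<iota>: "\<iota> > 1"
    and Q_\<E>: "\<And>\<xi>. \<xi> \<in> \<E> \<Longrightarrow> AE y in Q \<xi>. snoc \<xi> y \<in> \<E>"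
    and C\<^sub>Q: "C\<^sub>Q > 0"
    and Q_var: "\<And>\<xi> \<xi>'. \<xi> \<in> \<E> \<Longrightarrow> \<xi>' \<in> \<E> \<Longrightarrow> var_dist (Q \<xi>) (Q \<xi>') \<le> C\<^sub>Q * past_dist \<iota> \<xi> \<xi>'"
begin

lemma sets_Q [simp, measurable_cong]: "sets (Q \<xi>) = sets borel"
  and prob_Q: "prob_space (Q \<xi>)"
  using measurable_space[OF Q_measurable, of \<xi>] by (auto simp: space_prob_algebra)

lemma space_Q [simp]: "space (Q \<xi>) = UNIV"
  using sets_eq_imp_space_eq[OF sets_Q] by simp

lemma Q_K: "\<xi> \<in> \<E> \<Longrightarrow> AE y in Q \<xi>. y \<in> K"
  by (drule Q_\<E>, erule eventually_mono) (metis \<E>_K snoc_0)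

end

locale stationary_noise = prob_space M
  for M :: "'w measure" +
  fixes \<eta> :: "int \<Rightarrow> 'w \<Rightarrow> 'e::{banach, second_countable_topology}"
    and K :: "'e set" and \<E> :: "(nat \<Rightarrow> 'e) set" and Q :: "(nat \<Rightarrow> 'e) \<Rightarrow> 'e measure" and \<iota> :: real
  assumes stationary: "stationary_process M \<eta>"
    and K: "\<And>k. K = msupport (distr M borel (\<eta> k))" "compact K"
    and \<E>: "\<E> = msupport (past_law M \<eta>)"
    and cond: "cond_law_next M \<eta> Q" and iota: "\<iota> > 1"
    and SF: "hyp_SF \<iota> K \<E> Q"
begin

definition past_at :: "nat \<Rightarrow> 'w \<Rightarrow> nat \<Rightarrow> 'e" where
  "past_at k \<omega> = (\<lambda>n. \<eta> (int k - int n) \<omega>)"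

lemma past_at_0: "past_at 0 = past \<eta>"
  by (simp add: past_at_def past_def fun_eq_iff)

lemma past_at_Suc: "past_at (Suc k) \<omega> = snoc (past_at k \<omega>) (\<eta> (int (Suc k)) \<omega>)"
proof
  fix n show "past_at (Suc k) \<omega> n = snoc (past_at k \<omega>) (\<eta> (int (Suc k)) \<omega>) n"
    by (cases n) (auto simp: past_at_def)
qed

lemma eta_measurable [measurable]: "\<eta> k \<in> borel_measurable M"
  using stationary unfolding stationary_process_def by blast

lemma eta_path_measurable [measurable]: "(\<lambda>\<omega> k. \<eta> k \<omega>) \<in> borel_measurable M"
  by (rule measurable_coordinatewise_then_product) simp

lemma past_at_measurable [measurable]: "past_at k \<in> borel_measurable M"
  unfolding past_at_def by (rule measurable_coordinatewise_then_product) simp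

lemma Q_kernel [measurable]: "Q \<in> borel \<rightarrow>\<^sub>M prob_algebra borel"
  using cond by (simp add: cond_law_next_def)

lemma sets_Q' [simp, measurable_cong]: "sets (Q \<xi>) = sets borel"
  and prob_Q': "prob_space (Q \<xi>)"
  using measurable_space[OF Q_kernel, of \<xi>] by (auto simp: space_prob_algebra)

lemma distr_shift:
  assumes [measurable]: "f \<in> borel \<rightarrow>\<^sub>M N"
  shows "distr M N (\<lambda>\<omega>. f (\<lambda>k. \<eta> (k + m) \<omega>)) = distr M N (\<lambda>\<omega>. f (\<lambda>k. \<eta> k \<omega>))"
proof -
  have [measurable]: "(\<lambda>\<omega> k. \<eta> (k + m) \<omega>) \<in> borel_measurable M"
    by (rule measurable_coordinatewise_then_product) simp
  have "distr M N (\<lambda>\<omega>. f (\<lambda>k. \<eta> (k + m) \<omega>)) = distr (distr M borel (\<lambda>\<omega> k. \<eta> (k + m) \<omega>)) N f"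
    by (subst distr_distr) (auto simp: comp_def)
  also have "\<dots> = distr (distr M borel (\<lambda>\<omega> k. \<eta> k \<omega>)) N f"
    using stationary unfolding stationary_process_def by metis
  also have "\<dots> = distr M N (\<lambda>\<omega>. f (\<lambda>k. \<eta> k \<omega>))"
    by (subst distr_distr) (auto simp: comp_def)
  finally show ?thesis .
qed

lemma past_of_path_measurable [measurable]:
  "(\<lambda>p::int \<Rightarrow> 'e. (\<lambda>n. p (- int n))) \<in> borel_measurable borel"
  by (rule measurable_coordinatewise_then_product) (rule coordinate_measurable)

lemma distr_past_at: "distr M borel (past_at k) = past_law M \<eta>"
  using distr_shift[of "\<lambda>p n. p (- int n)" borel "int k"]
  by (simp add: past_law_def past_at_def[abs_def] past_def[abs_def] algebra_simps)

lemma distr_past_next: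
  "distr M (borel \<Otimes>\<^sub>M borel) (\<lambda>\<omega>. (past_at k \<omega>, \<eta> (int (Suc k)) \<omega>)) =
    distr M (borel \<Otimes>\<^sub>M borel) (\<lambda>\<omega>. (past_at 0 \<omega>, \<eta> 1 \<omega>))"
  using distr_shift[of "\<lambda>p. (\<lambda>n. p (- int n), p 1)" "borel \<Otimes>\<^sub>M borel" "int k",
      OF measurable_Pair[OF past_of_path_measurable coordinate_measurable]]
  by (simp add: past_at_def[abs_def] algebra_simps)

text \<open>The conditional law is given at time 0 only; stationarity carries it to every time
  k.\<close>

lemma prob_past_next:
  assumes [measurable]: "A \<in> sets borel" "B \<in> sets borel"
  shows "prob {\<omega> \<in> space M. past_at k \<omega> \<in> A \<and> \<eta> (int (Suc k)) \<omega> \<in> B} =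
    (\<integral>\<omega>. indicator A (past_at k \<omega>) * measure (Q (past_at k \<omega>)) B \<partial>M)"
proof -
  have "prob {\<omega> \<in> space M. past_at k \<omega> \<in> A \<and> \<eta> (int (Suc k)) \<omega> \<in> B} =
    measure (distr M (borel \<Otimes>\<^sub>M borel) (\<lambda>\<omega>. (past_at k \<omega>, \<eta> (int (Suc k)) \<omega>))) (A \<times> B)"
    by (subst measure_distr) (auto intro!: arg_cong[where f=prob])
  also have "\<dots> = prob {\<omega> \<in> space M. past \<eta> \<omega> \<in> A \<and> \<eta> 1 \<omega> \<in> B}"
    unfolding distr_past_next past_at_0[symmetric]
    by (subst measure_distr) (auto intro!: arg_cong[where f=prob])
  also have "\<dots> = (LINT \<xi>:A|past_law M \<eta>. measure (Q \<xi>) B)"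
    using cond by (simp add: cond_law_next_def)
  also have "\<dots> = (\<integral>\<xi>. indicator A \<xi> * measure (Q \<xi>) B \<partial>distr M borel (past_at k))"
    by (simp add: set_lebesgue_integral_def distr_past_at)
  also have "\<dots> = (\<integral>\<omega>. indicator A (past_at k \<omega>) * measure (Q (past_at k \<omega>)) B \<partial>M)"
    by (subst integral_distr) auto
  finally show ?thesis .
qed

lemma closed_E: "closed \<E>"
  unfolding \<E> by (rule closed_msupport)

lemma AE_past_at: "AE \<omega> in M. past_at k \<omega> \<in> \<E>"
proof -
  have "AE \<xi> in distr M borel (past_at k). \<xi> \<in> \<E>"
    unfolding distr_past_at \<E>
    by (rule AE_msupport) (auto simp: past_law_def past_at_0[symmetric] intro!: prob_space_distr)
  then show ?thesis using closed_E by (subst (asm) AE_distr_iff) auto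
qed

lemma AE_eta: "AE \<omega> in M. \<eta> k \<omega> \<in> K"
proof -
  have "AE y in distr M borel (\<eta> k). y \<in> K"
    unfolding K(1)[of k] by (rule AE_msupport) (auto intro!: prob_space_distr)
  then show ?thesis using compact_imp_closed[OF K(2)] by (subst (asm) AE_distr_iff) auto
qed

text \<open>The sequences whose n-th entry lies outside the closed set \<open>K\<close> form an open
  set that is null for the law of the past, so no point of the support is among them.\<close>

lemma E_K: "\<xi> n \<in> K" if "\<xi> \<in> \<E>"
proof (rule ccontr)
  assume n: "\<xi> n \<notin> K"
  define U where "U = {\<xi> :: nat \<Rightarrow> 'e. \<xi> n \<in> - K}"
  have "open U"
    using open_vimage[OF open_Compl[OF compact_imp_closed[OF K(2)]] continuous_on_product_coordinates[of n]]
    by (simp add: U_def vimage_def)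
  moreover have "emeasure (past_law M \<eta>) U = 0"
  proof -
    have [measurable]: "U \<in> sets borel" using \<open>open U\<close> by auto
    have "AE \<omega> in M. past_at 0 \<omega> \<notin> U"
      using AE_eta[of "- int n"] by eventually_elim (auto simp: U_def past_at_def)
    moreover have "past_at 0 -` U \<inter> space M \<in> sets M" by measurable
    ultimately have "emeasure M (past_at 0 -` U \<inter> space M) = 0"
      by (subst (asm) AE_iff_measurable) (auto intro!: arg_cong[where f="emeasure M"])
    then show ?thesis by (simp add: past_law_def past_at_0[symmetric] emeasure_distr)
  qed
  ultimately show False using that n by (auto simp: \<E> msupport_def U_def)
qed

text \<open>The past at time 1 lies in \<open>\<E>\<close> almost surely, and it is the past at time
  0 extended by the noise of time 1. Disintegrating shows that the mass which \<open>Q \<xi>\<close>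
  gives to staying in \<open>\<E>\<close> has mean 1; being at most 1, it equals 1 almost
  surely.\<close>

lemma AE_Q_past: "AE \<xi> in past_law M \<eta>. AE y in Q \<xi>. snoc \<xi> y \<in> \<E>"
proof -
  have cE[measurable]: "\<E> \<in> sets borel" using closed_E by auto
  define f :: "(nat \<Rightarrow> 'e) \<times> 'e \<Rightarrow> real" where "f = (\<lambda>p. indicator \<E> (snoc (fst p) (snd p)))"
  have [measurable]: "f \<in> borel_measurable (borel \<Otimes>\<^sub>M borel)" unfolding f_def by measurable
  have g1: "(\<integral>y. f (\<xi>, y) \<partial>Q \<xi>) = measure (Q \<xi>) {y. snoc \<xi> y \<in> \<E>}" for \<xi>
  proof -
    interpret Q: prob_space "Q \<xi>" by (rule prob_Q')
    have "(\<integral>y. f (\<xi>, y) \<partial>Q \<xi>) = (\<integral>y. indicator {y. snoc \<xi> y \<in> \<E>} y \<partial>Q \<xi>)"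
      by (rule Bochner_Integration.integral_cong) (auto simp: f_def indicator_def)
    also have "\<dots> = measure (Q \<xi>) {y. snoc \<xi> y \<in> \<E>}" by simp
    finally show ?thesis .
  qed
  have mg[measurable]: "(\<lambda>\<xi>. measure (Q \<xi>) {y. snoc \<xi> y \<in> \<E>}) \<in> borel_measurable borel"
  proof (rule measure_measurable_prob_algebra2[OF _ Q_kernel])
    have "{p. snoc (fst p) (snd p) \<in> \<E>} \<in> sets (borel \<Otimes>\<^sub>M borel :: ((nat \<Rightarrow> 'e) \<times> 'e) measure)"
      using measurable_sets[OF snoc_measurable[OF measurable_fst measurable_snd] cE]
      by (simp add: vimage_def space_pair_measure)
    then show "Sigma (space borel) (\<lambda>\<xi>. {y. snoc \<xi> y \<in> \<E>}) \<in> sets (borel \<Otimes>\<^sub>M borel)"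
      by (auto simp: Sigma_def elim!: back_subst[of "\<lambda>S. S \<in> _"])
  qed
  have "(\<integral>\<omega>. f (past_at 0 \<omega>, \<eta> (int (Suc 0)) \<omega>) \<partial>M) = (\<integral>\<omega>. (\<integral>y. f (past_at 0 \<omega>, y) \<partial>Q (past_at 0 \<omega>)) \<partial>M)"
    by (rule integral_conditional_kernel[where c=1, OF prob_space_axioms _ _ Q_kernel prob_past_next])
       (auto simp: f_def)
  also have "(\<integral>\<omega>. f (past_at 0 \<omega>, \<eta> (int (Suc 0)) \<omega>) \<partial>M) = (\<integral>\<omega>. 1 \<partial>M)"
  proof (rule integral_cong_AE)
    show "AE \<omega> in M. f (past_at 0 \<omega>, \<eta> (int (Suc 0)) \<omega>) = 1"
      using AE_past_at[of "Suc 0"] by eventually_elim (simp add: f_def past_at_Suc)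
  qed auto
  finally have 1: "(\<integral>\<omega>. measure (Q (past_at 0 \<omega>)) {y. snoc (past_at 0 \<omega>) y \<in> \<E>} \<partial>M) = 1"
    by (simp add: g1 prob_space)
  have b1: "\<bar>1 - measure (Q \<xi>) A\<bar> \<le> 1" for \<xi> A
    using prob_space.prob_le_1[OF prob_Q', of \<xi> A] measure_nonneg[of "Q \<xi>" A] by linarith
  have "(\<integral>\<omega>. 1 - measure (Q (past_at 0 \<omega>)) {y. snoc (past_at 0 \<omega>) y \<in> \<E>} \<partial>M) = 0"
    by (subst Bochner_Integration.integral_diff)
       (auto simp: 1 prob_space intro!: integrable_const_bound[where B=1] prob_space.prob_le_1 prob_Q')
  then have "AE \<omega> in M. 1 - measure (Q (past_at 0 \<omega>)) {y. snoc (past_at 0 \<omega>) y \<in> \<E>} = 0"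
    by (subst (asm) integral_nonneg_eq_0_iff_AE)
       (auto intro!: integrable_const_bound[where B=1] prob_space.prob_le_1 prob_Q' simp: b1)
  then have "AE \<xi> in distr M borel (past_at 0). measure (Q \<xi>) {y. snoc \<xi> y \<in> \<E>} = 1"
    by (subst AE_distr_iff) auto
  then show ?thesis
    unfolding past_law_def past_at_0
  proof eventually_elim
    fix \<xi> assume m1: "measure (Q \<xi>) {y. snoc \<xi> y \<in> \<E>} = 1"
    interpret Q: prob_space "Q \<xi>" by (rule prob_Q')
    have "{y. snoc \<xi> y \<in> \<E>} \<in> sets (Q \<xi>)" by simp
    then show "AE y in Q \<xi>. snoc \<xi> y \<in> \<E>" using m1 Q.AE_in_set_eq_1[of "{y. snoc \<xi> y \<in> \<E>}"] by simp
  qed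
qed

text \<open>A point charged by \<open>Q \<xi>\<close> that leads out of \<open>\<E>\<close> would do so for all nearby pasts, and
  these include pasts \<open>\<xi>'\<close> for which \<open>Q \<xi>'\<close> does not leave \<open>\<E>\<close>.\<close>

lemma AE_Q_E:
  assumes xi: "\<xi> \<in> \<E>"
  shows "AE y in Q \<xi>. snoc \<xi> y \<in> \<E>"
proof -
  interpret Q: prob_space "Q \<xi>" by (rule prob_Q')
  have "y \<notin> msupport (Q \<xi>)" if y: "snoc \<xi> y \<notin> \<E>" for y
  proof
    assume ysup: "y \<in> msupport (Q \<xi>)"
    have "open ((\<lambda>p. snoc (fst p) (snd p)) -` (- \<E>))"
      by (rule open_vimage[OF _ continuous_snoc]) (use closed_E in auto)
    then obtain W B where WB: "open W" "open B" "\<xi> \<in> W" "y \<in> B"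
        "W \<times> B \<subseteq> (\<lambda>p. snoc (fst p) (snd p)) -` (- \<E>)"
      using y by (elim open_prod_elim[where x="(\<xi>, y)"]) auto
    have pos: "measure (Q \<xi>) B > 0"
      using ysup WB by (auto simp: msupport_def Q.emeasure_eq_measure)
    obtain R where R: "\<And>z. z \<in> K \<Longrightarrow> norm z \<le> R" using compact_imp_bounded[OF K(2)] bounded_iff by metis
    have R0: "0 \<le> R" using R[OF E_K[OF xi, of 0]] norm_ge_zero order_trans by blast
    obtain C where C: "C > 0" "\<And>\<xi> \<xi>'. \<xi> \<in> \<E> \<Longrightarrow> \<xi>' \<in> \<E> \<Longrightarrow> var_dist (Q \<xi>) (Q \<xi>') \<le> C * past_dist \<iota> \<xi> \<xi>'"
      using SF unfolding hyp_SF_def by blast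
    \<comment> \<open>Chosen so that a past within distance
      \<open>b * (\<iota> / (\<iota> - 1))\<close> of \<open>\<xi>\<close> changes the mass of
      \<open>B\<close> by less than half of it, by (SF).\<close>
    define b where "b = measure (Q \<xi>) B / (2 * C) / (\<iota> / (\<iota> - 1))"
    have b: "b > 0" using pos C iota by (simp add: b_def)
    have "(\<lambda>m. 2 * R * (1 / \<iota>) ^ m) \<longlonglongrightarrow> 2 * R * 0"
      using iota by (intro tendsto_mult_left LIMSEQ_power_zero) auto
    then have "\<forall>\<^sub>F m in sequentially. 2 * R * (1 / \<iota>) ^ m < b / 2"
      using b by (intro order_tendstoD) auto
    then obtain m where m: "2 * R * (1 / \<iota>) ^ m < b / 2" using eventually_happens sequentially_bot by blast
    define W' where "W' = W \<inter> (\<Inter>i<m. (\<lambda>\<xi>. \<xi> i) -` ball (\<xi> i) (b / 2))"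
    have "open W'" unfolding W'_def
      using WB by (intro open_Int open_INT ballI open_vimage continuous_on_product_coordinates) auto
    moreover have "\<xi> \<in> W'" using WB b by (simp add: W'_def)
    ultimately have "emeasure (past_law M \<eta>) W' > 0" using xi by (auto simp: \<E> msupport_def)
    \<comment> \<open>\<open>W'\<close> is a neighbourhood of a point of the support, hence has
      positive mass and must contain one of the almost all good pasts.\<close>
    have "\<exists>\<xi>'\<in>W'. \<xi>' \<in> \<E> \<and> (AE y in Q \<xi>'. snoc \<xi>' y \<in> \<E>)"
    proof (rule ccontr)
      assume neg: "\<not> ?thesis"
      have "AE \<xi>' in past_law M \<eta>. \<xi>' \<in> \<E>"
        unfolding \<E> by (rule AE_msupport) (auto simp: past_law_def past_at_0[symmetric] intro!: prob_space_distr)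
      with AE_Q_past have "AE \<xi>' in past_law M \<eta>. \<xi>' \<notin> W'"
        by eventually_elim (use neg in blast)
      moreover have "W' \<in> sets (past_law M \<eta>)" using \<open>open W'\<close> by (auto simp: past_law_def)
      ultimately have "emeasure (past_law M \<eta>) W' = 0"
        by (subst (asm) AE_iff_measurable[where N=W']) (use sets.sets_into_space in auto)
      then show False using \<open>emeasure (past_law M \<eta>) W' > 0\<close> by simp
    qed
    then obtain \<xi>' where xi': "\<xi>' \<in> W'" "\<xi>' \<in> \<E>" "AE y in Q \<xi>'. snoc \<xi>' y \<in> \<E>" by blast
    interpret Q': prob_space "Q \<xi>'" by (rule prob_Q')
    have "AE z in Q \<xi>'. z \<notin> B"
      using xi'(3) by eventually_elim (use WB(5) xi'(1) in \<open>auto simp: W'_def\<close>)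
    moreover have Bm: "B \<in> sets (Q \<xi>')" using WB by simp
    ultimately have B0: "measure (Q \<xi>') B = 0"
      using Q'.prob_eq_0[OF Bm] by simp
    have "measure (Q \<xi>) B \<le> var_dist (Q \<xi>) (Q \<xi>')"
      using measure_diff_le_var_dist[OF Q.prob_space_axioms Q'.prob_space_axioms, of B] WB B0 by simp
    also have "\<dots> \<le> C * past_dist \<iota> \<xi> \<xi>'" using C xi xi' by blast
    also have "\<dots> \<le> C * ((b / 2 + 2 * R / \<iota> ^ m) * (\<iota> / (\<iota> - 1)))"
      using C b xi'(1) by (intro mult_left_mono past_dist_le[OF iota R[OF E_K[OF xi]] R[OF E_K[OF xi'(2)]]])
        (auto simp: W'_def dist_norm less_imp_le)
    also have "\<dots> < C * (b * (\<iota> / (\<iota> - 1)))"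
      using m C iota by (intro mult_strict_left_mono mult_strict_right_mono) (auto simp: power_divide)
    also have "\<dots> = measure (Q \<xi>) B / 2" using C iota by (simp add: b_def)
    finally show False using pos by simp
  qed
  then show ?thesis
    using AE_msupport[OF sets_Q'[of \<xi>] Q.prob_space_axioms] by (auto elim: eventually_mono)
qed

lemma ex_noise_kernel: "\<exists>C\<^sub>Q. noise_kernel K \<E> Q \<iota> C\<^sub>Q"
proof -
  obtain C where "C > 0" "\<And>\<xi> \<xi>'. \<xi> \<in> \<E> \<Longrightarrow> \<xi>' \<in> \<E> \<Longrightarrow> var_dist (Q \<xi>) (Q \<xi>') \<le> C * past_dist \<iota> \<xi> \<xi>'"
    using SF unfolding hyp_SF_def by blast
  then show ?thesis
    by (intro exI[of _ C]) (unfold_locales, use K(2) closed_E E_K Q_kernel iota AE_Q_E in auto)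
qed

end

section \<open>Translations of measures with Lipschitz densities\<close>

text \<open>By homogeneity it suffices to look at the faces of the unit cube on which one coordinate
  equals 1. There the norm attains its minimum, which is positive by independence.\<close>

lemma coordinates_bounded:
  fixes B :: "'e::real_normed_vector set"
  assumes fin: "finite B" and ind: "independent B"
  obtains c where "c \<ge> 0" "\<And>x b. b \<in> B \<Longrightarrow> \<bar>x b\<bar> \<le> c * norm (\<Sum>b\<in>B. x b *\<^sub>R b)"
proof -
  \<comment> \<open>Coordinates outside \<open>B\<close> are pinned to 0, so that the face is a
    product of compact sets in the full function space and Tychonoff applies.\<close>
  define T where "T b0 = PiE UNIV (\<lambda>b. if b = b0 then {1} else if b \<in> B then {-1..1::real} else {0})" for b0 :: 'e
  define g where "g x = norm (\<Sum>b\<in>B. x b *\<^sub>R b)" for x :: "'e \<Rightarrow> real"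
  have contg: "continuous_on A g" for A
    unfolding g_def by (intro continuous_intros) (rule continuous_on_subset[OF continuous_on_product_coordinates], simp)
  have "\<exists>m>0. \<forall>x\<in>T b0. m \<le> g x" if b0: "b0 \<in> B" for b0
  proof -
    have "compactin (product_topology (\<lambda>i. euclidean) UNIV) (T b0)"
      unfolding T_def by (subst compactin_PiE) (auto simp: compactin_euclidean_iff)
    then have comp: "compact (T b0)"
      by (simp add: euclidean_product_topology compactin_euclidean_iff)
    have "(\<lambda>b. if b = b0 then 1 else 0) \<in> T b0" by (auto simp: T_def)
    then obtain x where x: "x \<in> T b0" "\<forall>y\<in>T b0. g x \<le> g y"
      using continuous_attains_inf[OF comp _ contg] by blast
    have "g x \<noteq> 0"
    proof
      assume "g x = 0"
      then have "(\<Sum>b\<in>B. x b *\<^sub>R b) = 0" by (simp add: g_def)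
      then have "x b0 = 0" using independentD[OF ind fin subset_refl _ b0] by blast
      moreover have "x b0 \<in> {1}" using PiE_mem[OF x(1)[unfolded T_def], of b0] by simp
      ultimately show False by simp
    qed
    then show ?thesis using x by (intro exI[of _ "g x"]) (auto simp: g_def)
  qed
  then obtain m where m: "\<And>b0. b0 \<in> B \<Longrightarrow> m b0 > 0 \<and> (\<forall>x\<in>T b0. m b0 \<le> g x)" by metis
  define c where "c = (\<Sum>b\<in>B. 1 / m b)"
  have c0: "c \<ge> 0" unfolding c_def using m by (intro sum_nonneg) (simp add: less_imp_le)
  have "\<bar>x b\<bar> \<le> c * g x" if b: "b \<in> B" for x b
  proof -
    \<comment> \<open>Dividing by the coordinate \<open>x b0\<close> of largest modulus puts the
      vector on the face \<open>T b0\<close>.\<close>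
    define v where "v = Max ((\<lambda>b. \<bar>x b\<bar>) ` B)"
    have "v \<in> (\<lambda>b. \<bar>x b\<bar>) ` B" unfolding v_def using fin b by (intro Max_in) auto
    then obtain b0 where b0: "b0 \<in> B" "v = \<bar>x b0\<bar>" by auto
    have vm: "\<bar>x b\<bar> \<le> \<bar>x b0\<bar>" if "b \<in> B" for b
      unfolding b0(2)[symmetric] v_def using fin that by auto
    show ?thesis
    proof (cases "x b0 = 0")
      case True
      then show ?thesis using vm[OF b] c0 by (simp add: g_def)
    next
      case False
      define y where "y b = (if b \<in> B then x b / x b0 else 0)" for b
      have "\<bar>y b\<bar> \<le> 1" for b using vm False by (auto simp: y_def abs_divide)
      then have y1: "y b \<le> 1" "- 1 \<le> y b" for b by (simp_all add: abs_le_iff minus_le_iff)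
      have "y b0 = 1" "\<And>b. b \<notin> B \<Longrightarrow> y b = 0" using False b0 by (simp_all add: y_def)
      then have "y \<in> T b0" unfolding T_def using y1 by auto
      then have "m b0 \<le> g y" using m b0 by blast
      also have "g y = norm ((1 / x b0) *\<^sub>R (\<Sum>b\<in>B. x b *\<^sub>R b))"
        unfolding g_def scaleR_sum_right by (intro arg_cong[where f=norm] sum.cong) (auto simp: y_def divide_inverse mult.commute)
      also have "\<dots> = g x / \<bar>x b0\<bar>" by (simp add: g_def)
      finally have "\<bar>x b0\<bar> \<le> 1 / m b0 * g x" using m[OF b0(1)] False by (simp add: field_simps)
      also have "1 / m b0 \<le> c" unfolding c_def using fin b0 m
        by (intro member_le_sum) (auto simp: less_imp_le)
      then have "1 / m b0 * g x \<le> c * g x" by (intro mult_right_mono) (auto simp: g_def)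
      finally show ?thesis using vm[OF b] by linarith
    qed
  qed
  then show ?thesis using that[OF c0] by (simp add: g_def)
qed

lemma PiM_lborel_translate:
  fixes B :: "'i set"
  assumes fin: "finite B"
  shows "distr (Pi\<^sub>M B (\<lambda>_. lborel)) (Pi\<^sub>M B (\<lambda>_. lborel)) (\<lambda>c. \<lambda>b\<in>B. c b + a b) = Pi\<^sub>M B (\<lambda>_. lborel :: real measure)"
proof -
  interpret product_sigma_finite "\<lambda>_::'i. lborel :: real measure" by standard
  show ?thesis
  proof (rule PiM_eqI[OF fin])
    fix A assume A: "\<And>i. i \<in> B \<Longrightarrow> A i \<in> sets (lborel :: real measure)"
    have pre: "(\<lambda>t. t + a b) -` A b \<in> sets borel" if "b \<in> B" for b
      using measurable_sets[of "\<lambda>t. t + a b" borel borel "A b"] A[OF that] by simp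
    have "emeasure (distr (Pi\<^sub>M B (\<lambda>_. lborel)) (Pi\<^sub>M B (\<lambda>_. lborel)) (\<lambda>c. \<lambda>b\<in>B. c b + a b)) (Pi\<^sub>E B A) =
      emeasure (Pi\<^sub>M B (\<lambda>_. lborel)) ((\<lambda>c. \<lambda>b\<in>B. c b + a b) -` Pi\<^sub>E B A \<inter> space (Pi\<^sub>M B (\<lambda>_. lborel)))"
      using A fin by (intro emeasure_distr) (auto intro!: sets_PiM_I_finite)
    also have "(\<lambda>c. \<lambda>b\<in>B. c b + a b) -` Pi\<^sub>E B A \<inter> space (Pi\<^sub>M B (\<lambda>_. lborel)) = Pi\<^sub>E B (\<lambda>b. (\<lambda>t. t + a b) -` A b)"
      by (auto simp: space_PiM PiE_iff extensional_def)
    also have "emeasure (Pi\<^sub>M B (\<lambda>_. lborel)) \<dots> = (\<Prod>b\<in>B. emeasure lborel ((\<lambda>t. t + a b) -` A b))"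
      using pre by (intro emeasure_PiM[OF fin]) auto
    also have "\<dots> = (\<Prod>b\<in>B. emeasure lborel (A b))"
    proof (rule prod.cong[OF refl])
      fix b assume b: "b \<in> B"
      have "emeasure lborel (A b) = emeasure (distr lborel borel ((+) (a b))) (A b)"
        by (simp add: lborel_distr_plus)
      also have "\<dots> = emeasure lborel ((+) (a b) -` A b)" using A[OF b] by (subst emeasure_distr) auto
      finally show "emeasure lborel ((\<lambda>t. t + a b) -` A b) = emeasure lborel (A b)"
        by (simp add: vimage_def add.commute)
    qed
    finally show "emeasure (distr (Pi\<^sub>M B (\<lambda>_. lborel)) (Pi\<^sub>M B (\<lambda>_. lborel)) (\<lambda>c. \<lambda>b\<in>B. c b + a b)) (Pi\<^sub>E B A) =
      (\<Prod>b\<in>B. emeasure lborel (A b))" .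
  qed simp
qed

text \<open>Everything is read off in coordinates: a translation by a vector of \<open>F\<close> is
  a translation of the coordinates, and the preimage of a ball lies in a cube because coordinates
  are bounded by the norm.\<close>

lemma
  fixes F :: "'e::{banach, second_countable_topology} set"
  assumes \<nu>: "lebesgue_measure_of F \<nu>"
  shows sets_lebesgue_measure_of: "sets \<nu> = sets borel"
    and lebesgue_measure_of_translate: "\<Phi> \<in> F \<Longrightarrow> distr \<nu> borel (\<lambda>w. w + \<Phi>) = \<nu>"
    and lebesgue_measure_of_cball: "emeasure \<nu> (cball 0 r) < \<infinity>"
    and sigma_finite_lebesgue_measure_of: "sigma_finite_measure \<nu>"
proof -
  obtain B where B: "finite B" "independent B" "span B = F"
    and nu: "\<nu> = distr (Pi\<^sub>M B (\<lambda>_. lborel)) borel (\<lambda>c. \<Sum>b\<in>B. c b *\<^sub>R b)"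
    using \<nu> unfolding lebesgue_measure_of_def by blast
  let ?P = "Pi\<^sub>M B (\<lambda>_. lborel :: real measure)"
  let ?h = "\<lambda>c. \<Sum>b\<in>B. c b *\<^sub>R b"
  have h[measurable]: "?h \<in> borel_measurable ?P" by measurable
  show sets: "sets \<nu> = sets borel" by (simp add: nu)
  show "distr \<nu> borel (\<lambda>w. w + \<Phi>) = \<nu>" if "\<Phi> \<in> F"
  proof -
    have "\<Phi> \<in> range ?h" using that B(3) span_finite[OF B(1)] by simp
    then obtain a where a: "\<Phi> = ?h a" by blast
    have T[measurable]: "(\<lambda>c. \<lambda>b\<in>B. c b + a b) \<in> measurable ?P ?P" by measurable
    have "distr \<nu> borel (\<lambda>w. w + \<Phi>) = distr ?P borel (\<lambda>c. ?h c + \<Phi>)"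
      unfolding nu by (subst distr_distr) (auto simp: comp_def)
    also have "(\<lambda>c. ?h c + \<Phi>) = ?h \<circ> (\<lambda>c. \<lambda>b\<in>B. c b + a b)"
      by (auto simp: a fun_eq_iff scaleR_left_distrib sum.distrib)
    also have "distr ?P borel (?h \<circ> (\<lambda>c. \<lambda>b\<in>B. c b + a b)) = distr (distr ?P ?P (\<lambda>c. \<lambda>b\<in>B. c b + a b)) borel ?h"
      by (rule distr_distr[symmetric]) auto
    also have "\<dots> = \<nu>" by (simp only: PiM_lborel_translate[OF B(1)] nu)
    finally show ?thesis .
  qed
  show ball: "emeasure \<nu> (cball 0 r) < \<infinity>" for r
  proof -
    interpret product_sigma_finite "\<lambda>_::'e. lborel :: real measure" by standard
    obtain c where c: "c \<ge> 0" "\<And>x b. b \<in> B \<Longrightarrow> \<bar>x b\<bar> \<le> c * norm (?h x)"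
      using coordinates_bounded[OF B(1,2)] by metis
    have "emeasure \<nu> (cball 0 r) = emeasure ?P (?h -` cball 0 r \<inter> space ?P)"
      unfolding nu by (rule emeasure_distr) auto
    also have "\<dots> \<le> emeasure ?P (Pi\<^sub>E B (\<lambda>_. {- (c * r)..c * r}))"
    proof (rule emeasure_mono)
      show "?h -` cball 0 r \<inter> space ?P \<subseteq> Pi\<^sub>E B (\<lambda>_. {- (c * r)..c * r})"
      proof
        fix x assume x: "x \<in> ?h -` cball 0 r \<inter> space ?P"
        have "\<bar>x b\<bar> \<le> c * r" if "b \<in> B" for b
          using c(2)[OF that, of x] mult_left_mono[OF _ c(1), of "norm (?h x)" r] x by (auto intro: order_trans)
        then show "x \<in> Pi\<^sub>E B (\<lambda>_. {- (c * r)..c * r})"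
          using x by (force simp: space_PiM PiE_iff abs_le_iff)
      qed
    qed (auto intro!: sets_PiM_I_finite B)
    also have "\<dots> = (\<Prod>b\<in>B. emeasure lborel {- (c * r)..c * r})"
      by (rule emeasure_PiM[OF B(1)]) auto
    also have "\<dots> < \<infinity>" by (auto simp: emeasure_lborel_Icc_eq power_less_top_ennreal)
    finally show ?thesis .
  qed
  show "sigma_finite_measure \<nu>"
  proof
    show "\<exists>A. countable A \<and> A \<subseteq> sets \<nu> \<and> \<Union> A = space \<nu> \<and> (\<forall>a\<in>A. emeasure \<nu> a \<noteq> \<infinity>)"
    proof (intro exI[of _ "range (\<lambda>n::nat. cball 0 (real n))"] conjI)
      show "\<Union> (range (\<lambda>n::nat. cball 0 (real n))) = space \<nu>"
        using real_arch_simple by (auto simp: nu)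
    qed (use ball sets in \<open>auto simp: less_top\<close>)
  qed
qed

text \<open>The error is confined to a ball because the measure on \<open>F\<close> is in general
  infinite: a bound that holds everywhere could not be integrated. The density is bounded by
  \<open>b\<close> only on the ball, which is enough since \<theta> vanishes outside.\<close>

lemma lipschitz_mult_cutoff:
  fixes \<theta> \<rho> :: "'e::real_normed_vector \<Rightarrow> real"
  assumes \<theta>: "\<And>y. 0 \<le> \<theta> y" "\<And>y. \<theta> y \<le> 1" "\<And>y y'. \<bar>\<theta> y - \<theta> y'\<bar> \<le> L1 * norm (y - y')"
      "\<And>y. norm y > r \<Longrightarrow> \<theta> y = 0"
    and \<rho>: "\<And>y. 0 \<le> \<rho> y" "\<And>y. norm y \<le> r \<Longrightarrow> \<rho> y \<le> b" "\<And>y y'. \<bar>\<rho> y - \<rho> y'\<bar> \<le> L2 * norm (y - y')"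
  shows "\<theta> y * \<rho> y \<le> \<theta> y' * \<rho> y' + (L1 * b + L2) * norm (y - y') * indicator (cball 0 r) y"
proof (cases "norm y \<le> r")
  case True
  have L1: "0 \<le> L1 * norm (y - y')" and L2: "0 \<le> L2 * norm (y - y')"
    using \<theta>(3)[of y y'] \<rho>(3)[of y y'] abs_ge_zero order_trans by blast+
  have "\<theta> y * \<rho> y - \<theta> y' * \<rho> y' = (\<theta> y - \<theta> y') * \<rho> y + \<theta> y' * (\<rho> y - \<rho> y')"
    by (simp add: algebra_simps)
  also have "\<dots> \<le> (L1 * norm (y - y')) * b + 1 * (L2 * norm (y - y'))"
  proof (rule add_mono)
    have "(\<theta> y - \<theta> y') * \<rho> y \<le> (L1 * norm (y - y')) * \<rho> y"
      using \<theta>(3)[of y y'] \<rho>(1)[of y] by (intro mult_right_mono) auto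
    also have "\<dots> \<le> (L1 * norm (y - y')) * b" using \<rho>(2)[OF True] L1 by (rule mult_left_mono)
    finally show "(\<theta> y - \<theta> y') * \<rho> y \<le> (L1 * norm (y - y')) * b" .
    have "\<theta> y' * (\<rho> y - \<rho> y') \<le> \<theta> y' * (L2 * norm (y - y'))"
      using \<rho>(3)[of y y'] \<theta>(1)[of y'] by (intro mult_left_mono) auto
    also have "\<dots> \<le> 1 * (L2 * norm (y - y'))" using \<theta>(2)[of y'] L2 by (rule mult_right_mono)
    finally show "\<theta> y' * (\<rho> y - \<rho> y') \<le> 1 * (L2 * norm (y - y'))" .
  qed
  finally show ?thesis using True by (simp add: algebra_simps)
qed (use \<theta> \<rho> in auto)

context
  fixes \<mu> :: "'e::{banach, second_countable_topology} measure" and \<nu> F P \<rho> and r b L1 L2 R\<^sub>z :: real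
  assumes prob: "prob_space \<mu>" and sets_mu: "sets \<mu> = sets borel"
    and \<nu>: "lebesgue_measure_of F \<nu>"
    and P: "P \<in> borel_measurable borel" and Rz: "AE x in \<mu>. norm (x - P x) \<le> R\<^sub>z"
    and \<rho>: "\<And>y. 0 \<le> \<rho> y" "\<And>y. norm y \<le> r \<Longrightarrow> \<rho> y \<le> b" "\<And>y y'. \<bar>\<rho> y - \<rho> y'\<bar> \<le> L2 * norm (y - y')"
    and disint: "\<And>A. A \<in> sets borel \<Longrightarrow> emeasure \<mu> A =
              (\<integral>\<^sup>+ z. (\<integral>\<^sup>+ w. indicator A (w + z) * ennreal (\<rho> (w + z)) \<partial>\<nu>) \<partial>distr \<mu> borel (\<lambda>x. x - P x))"
begin

lemma density_borel [measurable]: "\<rho> \<in> borel_measurable borel"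
proof (rule borel_measurable_continuous_onI)
  \<comment> \<open>\<open>L2\<close> carries no sign. It is nonnegative as soon as the space has
    two points, and on a single point \<rho> is constant.\<close>
  have "L2-lipschitz_on UNIV \<rho>" if "L2 \<ge> 0"
    using \<rho>(3) that by (auto simp: lipschitz_on_def dist_norm)
  moreover have "L2 \<ge> 0" if "y \<noteq> y'" for y y' :: 'e
  proof -
    have "0 \<le> L2 * norm (y - y')" using \<rho>(3)[of y y'] abs_ge_zero order_trans by blast
    then show ?thesis using that by (simp add: zero_le_mult_iff)
  qed
  moreover have "continuous_on UNIV \<rho>" if "\<And>y y'::'e. y = y'"
  proof -
    have "\<rho> = (\<lambda>_. \<rho> 0)" by (rule ext) (metis that)
    then show ?thesis by (metis continuous_on_const)
  qed
  ultimately show "continuous_on UNIV \<rho>" using lipschitz_on_continuous_on by blast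
qed

text \<open>\<open>disint\<close> speaks of sets. Recognising \<mu> as the image under addition of a
  density on a product measure extends it to functions.\<close>

lemma nn_integral_disintegrate:
  assumes [measurable]: "h \<in> borel_measurable borel"
  shows "(\<integral>\<^sup>+y. h y \<partial>\<mu>) = (\<integral>\<^sup>+ z. (\<integral>\<^sup>+ w. h (w + z) * ennreal (\<rho> (w + z)) \<partial>\<nu>) \<partial>distr \<mu> borel (\<lambda>x. x - P x))"
proof -
  note [measurable] = P
  have [measurable_cong]: "sets \<mu> = sets borel" by (rule sets_mu)
  have [measurable_cong]: "sets \<nu> = sets borel" by (rule sets_lebesgue_measure_of[OF \<nu>])
  interpret nu: sigma_finite_measure \<nu> by (rule sigma_finite_lebesgue_measure_of[OF \<nu>])
  define Z where "Z = distr \<mu> borel (\<lambda>x. x - P x)"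
  have [measurable_cong]: "sets Z = sets borel" by (simp add: Z_def)
  define W where "W = density (Z \<Otimes>\<^sub>M \<nu>) (\<lambda>p. ennreal (\<rho> (snd p + fst p)))"
  have [measurable_cong]: "sets W = sets (borel \<Otimes>\<^sub>M borel)" 
    unfolding W_def using sets_pair_measure_cong[of Z borel \<nu> borel] \<open>sets Z = _\<close> \<open>sets \<nu> = _\<close> by simp
  have *: "(\<integral>\<^sup>+p. h (snd p + fst p) \<partial>W) = (\<integral>\<^sup>+ z. (\<integral>\<^sup>+ w. h (w + z) * ennreal (\<rho> (w + z)) \<partial>\<nu>) \<partial>Z)"
    if [measurable]: "h \<in> borel_measurable borel" for h
    unfolding W_def by (subst nn_integral_density) (auto simp: nu.nn_integral_fst[symmetric] mult.commute)
  have "\<mu> = distr W borel (\<lambda>p. snd p + fst p)"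
  proof (rule measure_eqI)
    fix A assume "A \<in> sets \<mu>"
    then have A[measurable]: "A \<in> sets borel" by (simp add: sets_mu)
    have "emeasure (distr W borel (\<lambda>p. snd p + fst p)) A = (\<integral>\<^sup>+y. indicator A y \<partial>distr W borel (\<lambda>p. snd p + fst p))"
      by simp
    also have "\<dots> = (\<integral>\<^sup>+p. indicator A (snd p + fst p) \<partial>W)" by (rule nn_integral_distr) measurable
    also have "\<dots> = emeasure \<mu> A" by (subst *) (simp_all add: disint Z_def)
    finally show "emeasure \<mu> A = emeasure (distr W borel (\<lambda>p. snd p + fst p)) A" by simp
  qed (simp add: sets_mu)
  then have "(\<integral>\<^sup>+y. h y \<partial>\<mu>) = (\<integral>\<^sup>+y. h y \<partial>distr W borel (\<lambda>p. snd p + fst p))"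
    by (rule arg_cong)
  also have "\<dots> = (\<integral>\<^sup>+p. h (snd p + fst p) \<partial>W)"
    by (rule nn_integral_distr) measurable
  finally show ?thesis using *[OF assms] by (simp add: Z_def)
qed

text \<open>In the inner integral over \<open>F\<close> a substitution moves the shift from
  \<open>G\<close> to the Lipschitz function \<theta> \<rho>. What remains is the change of this
  function under a translation by \<Phi>, integrated over a bounded part of
  \<open>F\<close>.\<close>

lemma
  fixes G :: "'e \<Rightarrow> ennreal"
  assumes \<theta>: "\<And>y. 0 \<le> \<theta> y" "\<And>y. \<theta> y \<le> 1" "\<And>y y'. \<bar>\<theta> y - \<theta> y'\<bar> \<le> L1 * norm (y - y')"
      "\<And>y. norm y > r \<Longrightarrow> \<theta> y = 0"
    and \<theta>_borel[measurable]: "\<theta> \<in> borel_measurable borel"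
    and G[measurable]: "G \<in> borel_measurable borel" and G1: "\<And>y. G y \<le> 1"
    and \<Phi>: "\<Phi> \<in> F" "norm \<Phi> \<le> 1" and L: "0 \<le> L1 * b + L2"
  defines "V \<equiv> ennreal ((L1 * b + L2) * norm \<Phi>) * emeasure \<nu> (cball 0 (r + 1 + R\<^sub>z))"
  shows nn_integral_shift_le: "(\<integral>\<^sup>+y. G (y + \<Phi>) * ennreal (\<theta> y) \<partial>\<mu>) \<le> (\<integral>\<^sup>+y. G y * ennreal (\<theta> y) \<partial>\<mu>) + V"
    and nn_integral_le_shift: "(\<integral>\<^sup>+y. G y * ennreal (\<theta> y) \<partial>\<mu>) \<le> (\<integral>\<^sup>+y. G (y + \<Phi>) * ennreal (\<theta> y) \<partial>\<mu>) + V"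
proof -
  note [measurable] = P
  have [measurable_cong]: "sets \<mu> = sets borel" by (rule sets_mu)
  have nuc[measurable_cong]: "sets \<nu> = sets borel" by (rule sets_lebesgue_measure_of[OF \<nu>])
  interpret mu: prob_space \<mu> by (rule prob)
  interpret nu: sigma_finite_measure \<nu> by (rule sigma_finite_lebesgue_measure_of[OF \<nu>])
  define Z where "Z = distr \<mu> borel (\<lambda>x. x - P x)"
  have [measurable_cong]: "sets Z = sets borel" by (simp add: Z_def)
  interpret Z: prob_space Z unfolding Z_def by (rule mu.prob_space_distr) measurable
  have Z_R: "AE z in Z. norm z \<le> R\<^sub>z" unfolding Z_def using Rz by (subst AE_distr_iff) auto
  define \<psi> where "\<psi> y = \<theta> y * \<rho> y" for y
  have [measurable]: "\<psi> \<in> borel_measurable borel" unfolding \<psi>_def by measurable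
  have \<psi>0: "0 \<le> \<psi> y" for y using \<theta> \<rho> by (simp add: \<psi>_def)
  let ?L = "(L1 * b + L2) * norm \<Phi>"
  let ?B = "cball (0::'e) (r + 1 + R\<^sub>z)"
  have L0: "0 \<le> ?L" using L by simp
  \<comment> \<open>Replaces the ball condition on y by one on the component \<open>w\<close> in
    \<open>F\<close> alone. The radius grows by 1 for the shift and by \<open>R\<^sub>z\<close> for
    the complementary component, so the error no longer depends on the latter.\<close>
  have comp: "\<psi> y \<le> \<psi> y' + ?L * indicator ?B w"
    if "norm (y - y') = norm \<Phi>" "norm (y - w) \<le> 1 + R\<^sub>z" for y y' w
  proof -
    have "\<psi> y \<le> \<psi> y' + ?L * indicator (cball 0 r) y"
      using lipschitz_mult_cutoff[OF \<theta> \<rho>, where y=y and y'=y'] that by (simp add: \<psi>_def)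
    moreover have "?L * indicator (cball 0 r) y \<le> ?L * indicator ?B w"
    proof (cases "norm y \<le> r")
      case True
      then have "norm w \<le> r + 1 + R\<^sub>z" using that(2) norm_triangle_ineq2[of w y] by (simp add: norm_minus_commute)
      then show ?thesis using True by simp
    next
      case False
      then show ?thesis using L0 by (simp add: indicator_def)
    qed
    ultimately show ?thesis by linarith
  qed
  have dis: "(\<integral>\<^sup>+y. g y * ennreal (\<theta> y) \<partial>\<mu>) = (\<integral>\<^sup>+z. (\<integral>\<^sup>+w. g (w + z) * ennreal (\<psi> (w + z)) \<partial>\<nu>) \<partial>Z)"
    if [measurable]: "g \<in> borel_measurable borel" for g
    unfolding Z_def by (subst nn_integral_disintegrate) (auto simp: \<psi>_def ennreal_mult \<theta> \<rho> mult.assoc)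
  have trans: "(\<integral>\<^sup>+w. G (w + z + \<Phi>) * ennreal (\<psi> (w + z)) \<partial>\<nu>) = (\<integral>\<^sup>+w. G (w + z) * ennreal (\<psi> (w + z - \<Phi>)) \<partial>\<nu>)" for z
  proof -
    have "(\<integral>\<^sup>+w. G (w + z) * ennreal (\<psi> (w + z - \<Phi>)) \<partial>\<nu>) =
      (\<integral>\<^sup>+w. G (w + z) * ennreal (\<psi> (w + z - \<Phi>)) \<partial>distr \<nu> borel (\<lambda>w. w + \<Phi>))"
      by (simp add: lebesgue_measure_of_translate[OF \<nu> \<Phi>(1)])
    also have "\<dots> = (\<integral>\<^sup>+w. G (w + \<Phi> + z) * ennreal (\<psi> (w + \<Phi> + z - \<Phi>)) \<partial>\<nu>)"
      by (rule nn_integral_distr) measurable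
    finally show ?thesis by (simp add: algebra_simps)
  qed
  \<comment> \<open>The pairs (\<Phi>, 0) and (0, \<Phi>) for \<open>(\<Phi>1, \<Phi>2)\<close>
    yield the two claims.\<close>
  have le: "(\<integral>\<^sup>+z. (\<integral>\<^sup>+w. G (w + z) * ennreal (\<psi> (w + z - \<Phi>1)) \<partial>\<nu>) \<partial>Z) \<le>
      (\<integral>\<^sup>+z. (\<integral>\<^sup>+w. G (w + z) * ennreal (\<psi> (w + z - \<Phi>2)) \<partial>\<nu>) \<partial>Z) + V"
    if "norm (\<Phi>1 - \<Phi>2) = norm \<Phi>" "norm \<Phi>1 \<le> 1" for \<Phi>1 \<Phi>2
  proof -
    have "(\<integral>\<^sup>+z. (\<integral>\<^sup>+w. G (w + z) * ennreal (\<psi> (w + z - \<Phi>1)) \<partial>\<nu>) \<partial>Z) \<le>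
      (\<integral>\<^sup>+z. (\<integral>\<^sup>+w. G (w + z) * ennreal (\<psi> (w + z - \<Phi>2)) \<partial>\<nu>) + V \<partial>Z)"
    proof (rule nn_integral_mono_AE, rule eventually_mono[OF Z_R])
      fix z :: 'e assume z: "norm z \<le> R\<^sub>z"
      have "G (w + z) * ennreal (\<psi> (w + z - \<Phi>1)) \<le> G (w + z) * ennreal (\<psi> (w + z - \<Phi>2)) + ennreal ?L * indicator ?B w" for w
      proof -
        have "norm (z - \<Phi>1) \<le> 1 + R\<^sub>z" using z that(2) norm_triangle_ineq4[of z \<Phi>1] by linarith
        then have "\<psi> (w + z - \<Phi>1) \<le> \<psi> (w + z - \<Phi>2) + ?L * indicator ?B w"
          using that by (intro comp) (simp_all add: norm_minus_commute algebra_simps)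
        then have "ennreal (\<psi> (w + z - \<Phi>1)) \<le> ennreal (\<psi> (w + z - \<Phi>2)) + ennreal ?L * indicator ?B w"
          using \<psi>0 L0 by (cases "w \<in> ?B") (auto simp: ennreal_plus[symmetric] simp del: ennreal_plus intro: ennreal_leI)
        then have "G (w + z) * ennreal (\<psi> (w + z - \<Phi>1)) \<le> G (w + z) * (ennreal (\<psi> (w + z - \<Phi>2)) + ennreal ?L * indicator ?B w)"
          by (rule mult_left_mono) simp
        also have "\<dots> = G (w + z) * ennreal (\<psi> (w + z - \<Phi>2)) + G (w + z) * (ennreal ?L * indicator ?B w)"
          by (simp add: distrib_left)
        also have "\<dots> \<le> G (w + z) * ennreal (\<psi> (w + z - \<Phi>2)) + 1 * (ennreal ?L * indicator ?B w)"
          by (intro add_left_mono mult_right_mono G1) simp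
        finally show ?thesis by simp
      qed
      then have "(\<integral>\<^sup>+w. G (w + z) * ennreal (\<psi> (w + z - \<Phi>1)) \<partial>\<nu>) \<le>
          (\<integral>\<^sup>+w. G (w + z) * ennreal (\<psi> (w + z - \<Phi>2)) + ennreal ?L * indicator ?B w \<partial>\<nu>)"
        by (intro nn_integral_mono)
      also have "\<dots> = (\<integral>\<^sup>+w. G (w + z) * ennreal (\<psi> (w + z - \<Phi>2)) \<partial>\<nu>) + V"
      proof -
        have cb: "?B \<in> sets \<nu>" by (simp add: nuc)
        then have [measurable]: "(\<lambda>w. ennreal ?L * indicator ?B w) \<in> borel_measurable \<nu>"
          by (intro borel_measurable_times_ennreal borel_measurable_indicator) auto
        have "(\<integral>\<^sup>+w. ennreal ?L * indicator ?B w \<partial>\<nu>) = V"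
          unfolding V_def using cb by (rule nn_integral_cmult_indicator)
        then show ?thesis by (subst nn_integral_add) auto
      qed
      finally show "(\<integral>\<^sup>+w. G (w + z) * ennreal (\<psi> (w + z - \<Phi>1)) \<partial>\<nu>) \<le>
          (\<integral>\<^sup>+w. G (w + z) * ennreal (\<psi> (w + z - \<Phi>2)) \<partial>\<nu>) + V" .
    qed
    also have "\<dots> = (\<integral>\<^sup>+z. (\<integral>\<^sup>+w. G (w + z) * ennreal (\<psi> (w + z - \<Phi>2)) \<partial>\<nu>) \<partial>Z) + V"
      by (subst nn_integral_add) (auto simp: Z.emeasure_space_1)
    finally show ?thesis .
  qed
  have A: "(\<integral>\<^sup>+y. G (y + \<Phi>) * ennreal (\<theta> y) \<partial>\<mu>) = (\<integral>\<^sup>+z. (\<integral>\<^sup>+w. G (w + z) * ennreal (\<psi> (w + z - \<Phi>)) \<partial>\<nu>) \<partial>Z)"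
    by (subst dis) (auto simp: trans)
  have B: "(\<integral>\<^sup>+y. G y * ennreal (\<theta> y) \<partial>\<mu>) = (\<integral>\<^sup>+z. (\<integral>\<^sup>+w. G (w + z) * ennreal (\<psi> (w + z - 0)) \<partial>\<nu>) \<partial>Z)"
    by (subst dis) auto
  show "(\<integral>\<^sup>+y. G (y + \<Phi>) * ennreal (\<theta> y) \<partial>\<mu>) \<le> (\<integral>\<^sup>+y. G y * ennreal (\<theta> y) \<partial>\<mu>) + V"
    unfolding A B by (rule le) (use \<Phi> in auto)
  show "(\<integral>\<^sup>+y. G y * ennreal (\<theta> y) \<partial>\<mu>) \<le> (\<integral>\<^sup>+y. G (y + \<Phi>) * ennreal (\<theta> y) \<partial>\<mu>) + V"
    unfolding A B by (rule le) auto
qed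

text \<open>A signed \<open>G\<close> is reduced to (1 + G) / 2, which has values in [0, 1]; the
  part \<theta> / 2 cancels in the difference, and the rescaling costs the factor 2.\<close>

lemma integral_shift:
  fixes G :: "'e \<Rightarrow> real"
  assumes \<theta>: "\<And>y. 0 \<le> \<theta> y" "\<And>y. \<theta> y \<le> 1" "\<And>y y'. \<bar>\<theta> y - \<theta> y'\<bar> \<le> L1 * norm (y - y')"
      "\<And>y. norm y > r \<Longrightarrow> \<theta> y = 0"
    and \<theta>_borel[measurable]: "\<theta> \<in> borel_measurable borel"
    and G[measurable]: "G \<in> borel_measurable borel" and G1: "\<And>y. \<bar>G y\<bar> \<le> 1"
    and \<Phi>: "\<Phi> \<in> F" "norm \<Phi> \<le> 1" and L: "0 \<le> L1 * b + L2"
  shows "\<bar>(\<integral>y. G (y + \<Phi>) * \<theta> y \<partial>\<mu>) - (\<integral>y. G y * \<theta> y \<partial>\<mu>)\<bar> \<le>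
    2 * ((L1 * b + L2) * measure \<nu> (cball 0 (r + 1 + R\<^sub>z))) * norm \<Phi>"
proof -
  have [measurable_cong]: "sets \<mu> = sets borel" by (rule sets_mu)
  interpret mu: prob_space \<mu> by (rule prob)
  let ?v = "(L1 * b + L2) * norm \<Phi> * measure \<nu> (cball 0 (r + 1 + R\<^sub>z))"
  have V: "ennreal ((L1 * b + L2) * norm \<Phi>) * emeasure \<nu> (cball 0 (r + 1 + R\<^sub>z)) = ennreal ?v"
    using lebesgue_measure_of_cball[OF \<nu>] L by (simp add: emeasure_eq_ennreal_measure less_top ennreal_mult)
  have v0: "0 \<le> ?v" using L by simp
  have int: "integrable \<mu> (\<lambda>y. H y * \<theta> y)" if [measurable]: "H \<in> borel_measurable borel" and "\<And>y. \<bar>H y\<bar> \<le> 1" for H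
    using that(2) \<theta> by (intro mu.integrable_const_bound[where B=1]) (auto simp: abs_mult mult_le_one)
  have unit: "\<bar>(\<integral>y. H (y + \<Phi>) * \<theta> y \<partial>\<mu>) - (\<integral>y. H y * \<theta> y \<partial>\<mu>)\<bar> \<le> ?v"
    if [measurable]: "H \<in> borel_measurable borel" and H: "\<And>y. 0 \<le> H y" "\<And>y. H y \<le> 1" for H :: "'e \<Rightarrow> real"
  proof -
    have nn: "(\<integral>\<^sup>+y. ennreal (h y) * ennreal (\<theta> y) \<partial>\<mu>) = ennreal (\<integral>y. h y * \<theta> y \<partial>\<mu>)"
      if [measurable]: "h \<in> borel_measurable borel" and "\<And>y. 0 \<le> h y" "\<And>y. h y \<le> 1" for h
    proof -
      have "(\<integral>\<^sup>+y. ennreal (h y) * ennreal (\<theta> y) \<partial>\<mu>) = (\<integral>\<^sup>+y. ennreal (h y * \<theta> y) \<partial>\<mu>)"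
        using that \<theta> by (simp add: ennreal_mult)
      also have "\<dots> = ennreal (\<integral>y. h y * \<theta> y \<partial>\<mu>)"
        using that \<theta> by (intro nn_integral_eq_integral int) auto
      finally show ?thesis .
    qed
    have i0: "0 \<le> (\<integral>y. H (y + \<Phi>) * \<theta> y \<partial>\<mu>)" "0 \<le> (\<integral>y. H y * \<theta> y \<partial>\<mu>)"
      using H \<theta> by (auto intro!: Bochner_Integration.integral_nonneg)
    have H1: "ennreal (H y) \<le> 1" for y using H(2) by simp
    have Hm: "(\<lambda>y. ennreal (H y)) \<in> borel_measurable borel" by measurable
    show ?thesis
      using nn_integral_shift_le[OF \<theta> \<theta>_borel Hm H1 \<Phi> L] nn_integral_le_shift[OF \<theta> \<theta>_borel Hm H1 \<Phi> L] i0 v0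
      by (simp add: V nn H ennreal_plus[symmetric] del: ennreal_plus)
  qed
  have pm: "0 \<le> 1 + G y" "1 + G y \<le> 2" "0 \<le> 1 - G y" "1 - G y \<le> 2" for y
    using G1[of y] by (simp_all add: abs_le_iff)
  have half: "(\<integral>y. (1 + G (y + \<Phi>')) / 2 * \<theta> y \<partial>\<mu>) = (\<integral>y. \<theta> y / 2 \<partial>\<mu>) + (\<integral>y. G (y + \<Phi>') * \<theta> y \<partial>\<mu>) / 2" for \<Phi>'
  proof -
    have "(\<integral>y. (1 + G (y + \<Phi>')) / 2 * \<theta> y \<partial>\<mu>) = (\<integral>y. \<theta> y / 2 + G (y + \<Phi>') * \<theta> y / 2 \<partial>\<mu>)"
      by (intro Bochner_Integration.integral_cong) (auto simp: field_simps)
    also have "\<dots> = (\<integral>y. \<theta> y / 2 \<partial>\<mu>) + (\<integral>y. G (y + \<Phi>') * \<theta> y / 2 \<partial>\<mu>)"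
      using int[of "\<lambda>_. 1"] int[of "\<lambda>y. G (y + \<Phi>')"] G1 by (intro Bochner_Integration.integral_add) auto
    finally show ?thesis by simp
  qed
  have "\<bar>(\<integral>y. (1 + G (y + \<Phi>)) / 2 * \<theta> y \<partial>\<mu>) - (\<integral>y. (1 + G y) / 2 * \<theta> y \<partial>\<mu>)\<bar> \<le> ?v"
    by (rule unit[of "\<lambda>y. (1 + G y) / 2"]) (use pm in auto)
  then show ?thesis using half[of \<Phi>] half[of 0] by (simp add: field_simps)
qed

end

section \<open>Local stabilisation by linear controls\<close>

text \<open>The weights \<open>t i * (\<Prod>j<i. 1 - t j)\<close> telescope: their sum is 1 minus
  the product of all \<open>1 - t j\<close>, hence 1 wherever some bump equals 1. No normalising
  division occurs, so they are Lipschitz on the whole space and not only near \<open>A\<close>; the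
  shift estimate evaluates them at arbitrary noise.\<close>

lemma lipschitz_partition:
  fixes A :: "'a::metric_space set"
  assumes A: "compact A" and r: "\<And>p. p \<in> A \<Longrightarrow> r p > 0"
  obtains N :: nat and c :: "nat \<Rightarrow> 'a" and \<theta> :: "nat \<Rightarrow> 'a \<Rightarrow> real" and L :: real
  where "\<And>i. i < N \<Longrightarrow> c i \<in> A" "0 \<le> L"
    "\<And>i p. 0 \<le> \<theta> i p" "\<And>i p. \<theta> i p \<le> 1"
    "\<And>i p q. i < N \<Longrightarrow> \<bar>\<theta> i p - \<theta> i q\<bar> \<le> L * dist p q"
    "\<And>i p. i < N \<Longrightarrow> \<theta> i p \<noteq> 0 \<Longrightarrow> dist p (c i) < r (c i)"
    "\<And>p. p \<in> A \<Longrightarrow> (\<Sum>i<N. \<theta> i p) = 1"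
proof -
  obtain D where D: "D \<subseteq> A" "finite D" "A \<subseteq> (\<Union>p\<in>D. ball p (r p / 2))"
    using compactE_image[OF A, of A "\<lambda>p. ball p (r p / 2)"] r by (metis (no_types, lifting) UN_I centre_in_ball half_gt_zero open_ball subsetI)
  obtain ps where ps: "set ps = D" using finite_list[OF D(2)] by blast
  define N where "N = length ps"
  define c where "c i = ps ! i" for i
  have cA: "c i \<in> A" if "i < N" for i using that ps D(1) by (auto simp: N_def c_def)
  \<comment> \<open>A bump that is 1 on the ball of radius \<open>r (c i) / 2\<close> and 0 outside
    that of radius \<open>r (c i)\<close>. The half balls cover \<open>A\<close>.\<close>
  define t where "t i p = max 0 (min 1 (2 - 2 / r (c i) * dist p (c i)))" for i p
  have t01: "0 \<le> t i p" "t i p \<le> 1" for i p by (auto simp: t_def)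
  define L1 where "L1 = (\<Sum>i<N. 2 / r (c i))"
  have L1i: "2 / r (c i) \<le> L1" if "i < N" for i
    unfolding L1_def using that r cA by (intro member_le_sum) (auto simp: less_imp_le)
  have L10: "0 \<le> L1" unfolding L1_def using r cA by (intro sum_nonneg) (auto simp: less_imp_le)
  have tL: "\<bar>t i p - t i q\<bar> \<le> L1 * dist p q" if i: "i < N" for i p q
  proof -
    have "\<bar>t i p - t i q\<bar> \<le> \<bar>2 / r (c i) * dist p (c i) - 2 / r (c i) * dist q (c i)\<bar>"
      by (auto simp: t_def max_def min_def abs_if)
    also have "\<dots> = 2 / r (c i) * \<bar>dist p (c i) - dist q (c i)\<bar>"
      using r[OF cA[OF i]] by (simp only: right_diff_distrib[symmetric] abs_mult) simp
    also have "\<dots> \<le> 2 / r (c i) * dist p q"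
      using r[OF cA[OF i]] abs_dist_diff_le[of p "c i" q] by (intro mult_left_mono) (auto simp: dist_commute)
    also have "\<dots> \<le> L1 * dist p q" using L1i[OF i] by (intro mult_right_mono) auto
    finally show ?thesis .
  qed
  define \<theta> where "\<theta> i p = t i p * (\<Prod>j<i. 1 - t j p)" for i p
  have pr: "0 \<le> (\<Prod>j<i. 1 - t j p)" "(\<Prod>j<i. 1 - t j p) \<le> 1" for i p
    using t01 by (auto intro!: prod_nonneg prod_le_1)
  have sum: "(\<Sum>i<m. \<theta> i p) = 1 - (\<Prod>j<m. 1 - t j p)" for m p
    by (induction m) (auto simp: \<theta>_def algebra_simps)
  show ?thesis
  proof
    show "c i \<in> A" if "i < N" for i by (rule cA[OF that])
    show "0 \<le> (1 + real N) * L1" using L10 by simp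
    show "0 \<le> \<theta> i p" "\<theta> i p \<le> 1" for i p
      using t01[of i p] pr[where i=i and p=p] by (auto simp: \<theta>_def mult_le_one)
    show "\<bar>\<theta> i p - \<theta> i q\<bar> \<le> (1 + real N) * L1 * dist p q" if i: "i < N" for i p q
    proof -
      have "\<bar>(\<Prod>j<i. 1 - t j p) - (\<Prod>j<i. 1 - t j q)\<bar> \<le> (\<Sum>j<i. \<bar>(1 - t j p) - (1 - t j q)\<bar>)"
      proof -
        have "norm (1 - t j p) \<le> 1" for j p using t01[of j p] by simp
        then show ?thesis
          using norm_prod_diff[where I = "{..<i}" and z = "\<lambda>j. 1 - t j p" and w = "\<lambda>j. 1 - t j q"] by simp
      qed
      also have "\<dots> \<le> (\<Sum>j<i. L1 * dist p q)"
        using tL i by (intro sum_mono) (force simp: abs_minus_commute)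
      also have "\<dots> \<le> real N * (L1 * dist p q)"
        using i L10 by (simp add: mult_right_mono)
      finally have 1: "\<bar>(\<Prod>j<i. 1 - t j p) - (\<Prod>j<i. 1 - t j q)\<bar> \<le> real N * (L1 * dist p q)" .
      have "\<bar>\<theta> i p - \<theta> i q\<bar> = \<bar>(t i p - t i q) * (\<Prod>j<i. 1 - t j p) + t i q * ((\<Prod>j<i. 1 - t j p) - (\<Prod>j<i. 1 - t j q))\<bar>"
        by (simp add: \<theta>_def algebra_simps)
      also have "\<dots> \<le> \<bar>t i p - t i q\<bar> * (\<Prod>j<i. 1 - t j p) + t i q * \<bar>(\<Prod>j<i. 1 - t j p) - (\<Prod>j<i. 1 - t j q)\<bar>"
        using pr[where i=i and p=p] t01[of i q] by (intro order_trans[OF abs_triangle_ineq]) (simp add: abs_mult)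
      also have "\<dots> \<le> (L1 * dist p q) * 1 + 1 * (real N * (L1 * dist p q))"
        using 1 tL[OF i] pr t01 L10 by (intro add_mono mult_mono) auto
      finally show ?thesis by (simp add: algebra_simps)
    qed
    show "dist p (c i) < r (c i)" if "i < N" "\<theta> i p \<noteq> 0" for i p
    proof (rule ccontr)
      assume "\<not> ?thesis"
      then have "2 - 2 / r (c i) * dist p (c i) \<le> 0" using r[OF cA[OF that(1)]] by (simp add: field_simps)
      then show False using that(2) by (simp add: \<theta>_def t_def)
    qed
    show "(\<Sum>i<N. \<theta> i p) = 1" if p: "p \<in> A" for p
    proof -
      obtain d where "d \<in> D" "p \<in> ball d (r d / 2)" using D(3) p by blast
      then obtain i where i: "i < N" "c i = d" using ps by (metis N_def c_def in_set_conv_nth)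
      have "t i p = 1" using \<open>p \<in> ball d _\<close> r[OF cA[OF i(1)]]
        by (simp add: t_def i dist_commute field_simps)
      then have "(\<Prod>j<N. 1 - t j p) = 0" using i by (intro prod_zero) auto
      then show ?thesis by (simp add: sum)
    qed
  qed
qed

text \<open>The explicit formula shows that the projection is bounded and linear, and its
  coefficients are those of the linear control constructed next.\<close>

lemma orth_proj_orthogonal_basis:
  fixes C :: "'h::real_inner set"
  assumes C: "finite C" "pairwise orthogonal C" "0 \<notin> C"
  shows "orth_proj (span C) x = (\<Sum>g\<in>C. (inner x g / inner g g) *\<^sub>R g)"
proof -
  define p where "p = (\<Sum>g\<in>C. (inner x g / inner g g) *\<^sub>R g)"
  have orthC: "inner (x - p) g = 0" if g: "g \<in> C" for g
  proof -
    have "inner p g = (\<Sum>g'\<in>C. (inner x g' / inner g' g') * inner g' g)"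
      by (simp add: p_def inner_sum_left)
    also have "\<dots> = (\<Sum>g'\<in>C. if g' = g then inner x g else 0)"
      using C g by (intro sum.cong) (auto simp: pairwise_def orthogonal_def)
    also have "\<dots> = inner x g" using C g by simp
    finally show ?thesis by (simp add: inner_diff_left)
  qed
  have orth: "inner (x - p) g = 0" if "g \<in> span C" for g
    using that by (induction rule: span_induct_alt) (auto simp: inner_add_right orthC)
  have "p \<in> span C" unfolding p_def by (intro span_sum span_scale span_base)
  moreover have "p' = p" if p': "p' \<in> span C" "\<forall>g\<in>span C. inner (x - p') g = 0" for p'
  proof -
    have d: "p' - p \<in> span C" using p' \<open>p \<in> span C\<close> by (simp add: span_diff)
    have "inner (p' - p) (p' - p) = inner (x - p) (p' - p) - inner (x - p') (p' - p)"
      by (simp add: inner_diff_left)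
    also have "\<dots> = 0" using orth[OF d] p'(2) d by simp
    finally show ?thesis by simp
  qed
  ultimately have "(THE p. p \<in> span C \<and> (\<forall>g\<in>span C. inner (x - p) g = 0)) = p"
    using orth by (intro the_equality) blast+
  then show ?thesis by (simp only: orth_proj_def p_def)
qed

text \<open>The control cancels the component of \<open>S' p0 (h, 0)\<close> in the span of
  \<open>C\<close>, where the state derivative need not contract. Each basis vector is approximately
  \<open>S' p0 (0, x)\<close> with x in some \<open>F n\<close>, since the union of the
  \<open>F n\<close> is dense. As \<open>C\<close> is finite and the \<open>F n\<close> increase, a
  single n serves all of them.\<close>

lemma pointwise_stabilisation:
  fixes S :: "'h::real_inner \<times> 'e::real_normed_vector \<Rightarrow> 'h" and S' :: "'h \<times> 'e \<Rightarrow> ('h \<times> 'e) \<Rightarrow>\<^sub>L 'h"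
  assumes S': "\<And>x. (S has_derivative blinfun_apply (S' x)) (at x)" "isCont S' p0"
    and C: "finite C" "0 \<notin> C"
    and \<kappa>: "\<And>h. norm (S' p0 (h, 0) - (\<Sum>g\<in>C. (inner (S' p0 (h, 0)) g / inner g g) *\<^sub>R g)) \<le> \<kappa> * norm h" "\<kappa> < 1"
    and dense: "\<And>g. g \<in> C \<Longrightarrow> g \<in> closure (range (\<lambda>e. S' p0 (0, e)))"
    and F: "\<And>n. n \<ge> 1 \<Longrightarrow> subspace (F n)" "\<And>n. n \<ge> 1 \<Longrightarrow> F n \<subseteq> F (Suc n)" "closure (\<Union>n\<in>{1..}. F n) = UNIV"
  shows "\<exists>n\<ge>1. \<exists>R c r. r > 0 \<and> c \<ge> 0 \<and> (\<forall>h. R h \<in> F n \<and> norm (R h) \<le> c * norm h) \<and>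
    (\<forall>u u' y. dist (u, y) p0 < r \<and> dist u' u < r \<longrightarrow>
       norm (S (u', y + R (u' - u)) - S (u, y)) \<le> (1 + \<kappa>) / 2 * norm (u' - u))"
proof -
  define A where "A = S' p0"
  have A_lin: "bounded_linear (blinfun_apply A)" by (rule blinfun.bounded_linear_right)
  \<comment> \<open>A quarter of the gap below 1: one \<epsilon> is spent on the approximation of
    the basis vectors and one on linearising \<open>S\<close>, and
    \<open>\<kappa> + 2 * \<epsilon> = (1 + \<kappa>) / 2\<close>.\<close>
  define \<epsilon> where "\<epsilon> = (1 - \<kappa>) / 4"
  have \<epsilon>: "\<epsilon> > 0" using \<kappa> by (simp add: \<epsilon>_def)
  \<comment> \<open>The coefficient at \<open>g\<close> is at most
    \<open>norm A * norm h / norm g\<close>, so with this tolerance the errors of all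
    \<open>card C\<close> terms add up to at most \<open>\<epsilon> * norm h\<close>. The two
    summands 1 keep the denominator positive.\<close>
  define \<delta> where "\<delta> g = \<epsilon> * norm g / ((norm A + 1) * (real (card C) + 1))" for g :: 'h
  have \<delta>: "\<delta> g > 0" if "g \<in> C" for g
  proof -
    have "norm g > 0" using that C by auto
    moreover have "norm A + 1 > 0" by (simp add: add_nonneg_pos)
    ultimately show ?thesis using \<epsilon> by (simp add: \<delta>_def)
  qed
  have "\<exists>x n. n \<ge> 1 \<and> x \<in> F n \<and> norm (g - A (0, x)) < \<delta> g" if g: "g \<in> C" for g
  proof -
    obtain e where e: "dist (A (0, e)) g < \<delta> g / 2"
      using dense[OF g] \<delta>[OF g] unfolding closure_approachable A_def by (metis half_gt_zero rangeE)
    have "isCont (\<lambda>e. A (0, e)) e" by (intro continuous_intros)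
    then obtain d where d: "d > 0" "\<And>e'. dist e' e < d \<Longrightarrow> dist (A (0, e')) (A (0, e)) < \<delta> g / 2"
      using \<delta>[OF g] unfolding continuous_at_eps_delta by (metis half_gt_zero)
    have "e \<in> closure (\<Union>n\<in>{1..}. F n)" using F(3) by simp
    then obtain x n where "n \<ge> 1" "x \<in> F n" "dist x e < d"
      using d(1) unfolding closure_approachable by (metis UN_E atLeast_iff)
    moreover have "dist (A (0, x)) g < \<delta> g" using d(2)[OF \<open>dist x e < d\<close>] e by (metis dist_triangle_half_r dist_commute)
    ultimately show ?thesis by (auto simp: dist_norm norm_minus_commute)
  qed
  then obtain x m where xm: "\<And>g. g \<in> C \<Longrightarrow> m g \<ge> 1 \<and> x g \<in> F (m g) \<and> norm (g - A (0, x g)) < \<delta> g" by metis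
  define n where "n = Max (insert 1 (m ` C))"
  have n1: "n \<ge> 1" unfolding n_def using C by (intro Max_ge) auto
  have Fmono: "F i \<subseteq> F j" if "1 \<le> i" "i \<le> j" for i j
    using that(2)
  proof (induction j rule: dec_induct)
    case (step j)
    then show ?case using F(2)[of j] that(1) by simp
  qed simp
  have xF: "x g \<in> F n" if g: "g \<in> C" for g
  proof -
    have "m g \<le> n" unfolding n_def using C g by (intro Max_ge) auto
    then show ?thesis using Fmono xm[OF g] by blast
  qed
  define k where "k h g = inner (A (h, 0)) g / inner g g" for h g
  have k: "\<bar>k h g\<bar> \<le> norm A * norm h / norm g" for h g
  proof -
    have "\<bar>inner (A (h, 0)) g\<bar> \<le> (norm A * norm h) * norm g"
      using Cauchy_Schwarz_ineq2[of "A (h, 0)" g] norm_blinfun[of A "(h, 0)"] mult_right_mono[of "norm (A (h, 0))" "norm A * norm h" "norm g"]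
      by (simp add: norm_Pair)
    then have "\<bar>k h g\<bar> \<le> (norm A * norm h) * norm g / (norm g)\<^sup>2"
      by (simp add: k_def abs_divide power2_norm_eq_inner divide_right_mono)
    then show ?thesis by (cases "g = 0") (simp_all add: power2_eq_square k_def)
  qed
  define R where "R h = - (\<Sum>g\<in>C. k h g *\<^sub>R x g)" for h
  define c where "c = (\<Sum>g\<in>C. norm A / norm g * norm (x g))"
  have c0: "c \<ge> 0" unfolding c_def by (intro sum_nonneg) auto
  have RF: "R h \<in> F n" for h
    unfolding R_def using F(1)[OF n1] xF by (intro subspace_neg subspace_sum subspace_scale) auto
  have Rc: "norm (R h) \<le> c * norm h" for h
  proof -
    have "norm (R h) \<le> (\<Sum>g\<in>C. norm (k h g *\<^sub>R x g))" unfolding R_def norm_minus_cancel by (rule norm_sum)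
    also have "\<dots> \<le> (\<Sum>g\<in>C. norm A / norm g * norm (x g) * norm h)"
    proof (rule sum_mono)
      fix g show "norm (k h g *\<^sub>R x g) \<le> norm A / norm g * norm (x g) * norm h"
        using mult_right_mono[OF k[of h g], of "norm (x g)"] by (simp add: ac_simps)
    qed
    finally show ?thesis by (simp add: c_def sum_distrib_right)
  qed
  have lin: "norm (A (h, R h)) \<le> (\<kappa> + \<epsilon>) * norm h" for h
  proof -
    have "A (h, R h) = A (h, 0) + A (0, R h)"
      using blinfun.add_right[of A "(h, 0)" "(0, R h)"] by simp
    moreover have "A (0, R h) = - (\<Sum>g\<in>C. k h g *\<^sub>R A (0, x g))"
    proof -
      have "bounded_linear (\<lambda>e. A (0, e))"
        by (rule bounded_linear_compose[OF A_lin]) (intro bounded_linear_intros bounded_linear_Pair bounded_linear_zero bounded_linear_ident)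
      then have l: "linear (\<lambda>e. A (0, e))" by (rule bounded_linear.linear)
      show ?thesis unfolding R_def by (simp add: linear_neg[OF l] linear_sum[OF l] linear_cmul[OF l])
    qed
    \<comment> \<open>The first bracket is the part left over by the projection, controlled by
      \<kappa>; the sum is the error of realising the projection by the noise.\<close>
    ultimately have eq: "A (h, R h) = (A (h, 0) - (\<Sum>g\<in>C. k h g *\<^sub>R g)) + (\<Sum>g\<in>C. k h g *\<^sub>R (g - A (0, x g)))"
      by (simp add: scaleR_right_diff_distrib sum_subtractf)
    have "norm (\<Sum>g\<in>C. k h g *\<^sub>R (g - A (0, x g))) \<le> (\<Sum>g\<in>C. \<epsilon> * norm h / (real (card C) + 1))"
    proof (rule sum_norm_le)
      fix g assume g: "g \<in> C"
      have ng: "norm g > 0" using g C by auto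
      have nA: "norm A + 1 > 0" by (simp add: add_nonneg_pos)
      have "norm (k h g *\<^sub>R (g - A (0, x g))) \<le> (norm A * norm h / norm g) * \<delta> g"
        unfolding norm_scaleR using k[of h g] xm[OF g] by (intro mult_mono) (auto intro: less_imp_le)
      also have "\<dots> = norm A / (norm A + 1) * (\<epsilon> * norm h / (real (card C) + 1))"
        using ng nA by (simp add: \<delta>_def field_simps)
      also have "\<dots> \<le> 1 * (\<epsilon> * norm h / (real (card C) + 1))"
        using \<epsilon> nA by (intro mult_right_mono) auto
      finally show "norm (k h g *\<^sub>R (g - A (0, x g))) \<le> \<epsilon> * norm h / (real (card C) + 1)" by simp
    qed
    also have "\<dots> \<le> \<epsilon> * norm h"
      using \<epsilon> by (simp add: field_simps)
    finally have "norm (\<Sum>g\<in>C. k h g *\<^sub>R (g - A (0, x g))) \<le> \<epsilon> * norm h" .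
    moreover have "norm (A (h, 0) - (\<Sum>g\<in>C. k h g *\<^sub>R g)) \<le> \<kappa> * norm h"
      using \<kappa>(1)[of h] by (simp add: A_def k_def)
    ultimately show ?thesis
      unfolding eq by (intro order_trans[OF norm_triangle_ineq]) (simp add: distrib_right)
  qed
  obtain r where r: "r > 0" "\<And>p. dist p p0 < r \<Longrightarrow> norm (S' p - A) < \<epsilon> / (1 + c)"
    using S'(2) \<epsilon> c0 unfolding continuous_at_eps_delta A_def dist_norm
    by (metis add_pos_nonneg divide_pos_pos zero_less_one)
  \<comment> \<open>The displacement \<open>(h, R h)\<close> has norm at most
    \<open>(1 + c) * norm h\<close>, so this radius keeps the whole segment inside the ball of
    radius \<open>r\<close>.\<close>
  define r' where "r' = r / 2 / (1 + c)"
  have r': "r' > 0" "r' \<le> r / 2" using r c0 by (auto simp: r'_def field_simps)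
  have "norm (S (u', y + R (u' - u)) - S (u, y)) \<le> (1 + \<kappa>) / 2 * norm (u' - u)"
    if uy: "dist (u, y) p0 < r'" "dist u' u < r'" for u u' y
  proof -
    define h where "h = u' - u"
    have nh: "norm (h, R h) \<le> (1 + c) * norm h"
      using norm_Pair_le[of h "R h"] Rc[of h] by (simp add: algebra_simps)
    have hr: "norm (h, R h) < r / 2"
    proof -
      have "(1 + c) * norm h < (1 + c) * r'"
        using uy(2) c0 by (intro mult_strict_left_mono) (auto simp: h_def dist_norm)
      also have "\<dots> = r / 2" using c0 unfolding r'_def by (simp add: field_simps add_nonneg_eq_0_iff)
      finally show ?thesis using nh by linarith
    qed
    \<comment> \<open>Linearised at the fixed point \<open>p0\<close> and not at
      \<open>(u, y)\<close>, so that one map \<open>R\<close> works for all nearby states and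
      noises.\<close>
    have "norm (S ((u, y) + (h, R h)) - S (u, y) - A ((u, y) + (h, R h) - (u, y))) \<le> norm ((u, y) + (h, R h) - (u, y)) * (\<epsilon> / (1 + c))"
      unfolding A_def
    proof (rule differentiable_bound_linearization[where S = "ball p0 r" and f' = "\<lambda>x. blinfun_apply (S' x)"])
      show "(u, y) + t *\<^sub>R ((u, y) + (h, R h) - (u, y)) \<in> ball p0 r" if t: "t \<in> {0..1}" for t :: real
      proof -
        have "norm (t *\<^sub>R (h, R h)) \<le> 1 * norm (h, R h)" unfolding norm_scaleR using t by (intro mult_right_mono) auto
        then have "dist ((u, y) + t *\<^sub>R (h, R h)) (u, y) < r / 2" using hr by (simp add: dist_norm)
        moreover have "dist (u, y) p0 < r / 2" using uy r' by simp
        ultimately have "dist ((u, y) + t *\<^sub>R (h, R h)) p0 < r" by (metis dist_triangle_half_r dist_commute)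
        then show ?thesis by (simp add: dist_commute)
      qed
      show "(S has_derivative blinfun_apply (S' x)) (at x within ball p0 r)" for x
        using S'(1) has_derivative_at_withinI by blast
      show "onorm (blinfun_apply (S' x) - blinfun_apply (S' p0)) \<le> \<epsilon> / (1 + c)" if "x \<in> ball p0 r" for x
        using r(2)[of x] that by (simp add: A_def norm_blinfun.rep_eq fun_diff_def minus_blinfun.rep_eq dist_commute less_imp_le)
      show "p0 \<in> ball p0 r" using r by simp
    qed
    then have "norm (S (u', y + R h) - S (u, y) - A (h, R h)) \<le> norm (h, R h) * (\<epsilon> / (1 + c))"
      by (simp add: h_def)
    also have "\<dots> \<le> ((1 + c) * norm h) * (\<epsilon> / (1 + c))"
      using nh \<epsilon> c0 by (intro mult_right_mono) auto
    also have "\<dots> = \<epsilon> * norm h" using c0 by simp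
    finally have "norm (S (u', y + R h) - S (u, y)) \<le> \<epsilon> * norm h + (\<kappa> + \<epsilon>) * norm h"
      using lin[of h] norm_triangle_sub[of "S (u', y + R h) - S (u, y)" "A (h, R h)"] by linarith
    also have "\<dots> = (1 + \<kappa>) / 2 * norm h" by (simp add: \<epsilon>_def field_simps)
    finally show ?thesis by (simp add: h_def)
  qed
  then show ?thesis using n1 r'(1) c0 RF Rc by blast
qed

section \<open>The one-step estimate\<close>

locale driven_system = noise_kernel K \<E> Q \<iota> C\<^sub>Q
  for K :: "'e::{banach, second_countable_topology} set" and \<E> Q \<iota> C\<^sub>Q +
  fixes S :: "'h::{real_inner, complete_space, second_countable_topology} \<times> 'e \<Rightarrow> 'h" and X :: "'h set"
  assumes S_C2: "C2_bounded_on_bounded S"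
    and compact_X: "compact X" and S_X: "S ` (X \<times> K) \<subseteq> X"
    and GD: "hyp_GD S" and ALC: "hyp_ALC S X K"
    and DLP: "hyp_DLP \<iota> \<E> Q" and SRZ: "hyp_SRZ \<E> Q"
begin

lemma S_continuous: "continuous_on UNIV S"
proof -
  obtain S' :: "'h \<times> 'e \<Rightarrow> ('h \<times> 'e) \<Rightarrow>\<^sub>L 'h" where "\<And>x. (S has_derivative blinfun_apply (S' x)) (at x)"
    using S_C2 unfolding C2_bounded_on_bounded_def by blast
  then show ?thesis using has_derivative_continuous by (intro continuous_at_imp_continuous_on) blast
qed

lemma S_measurable [measurable]: "S \<in> borel_measurable borel"
  by (rule borel_measurable_continuous_onI) (rule S_continuous)

lemma S_Pair_measurable [measurable (raw)]:
  assumes "f \<in> borel_measurable M" "g \<in> borel_measurable M"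
  shows "(\<lambda>x. S (f x, g x)) \<in> borel_measurable M"
  using measurable_compose[OF borel_measurable_Pair[OF assms] S_measurable] .

definition R\<^sub>K :: real where "R\<^sub>K = (SOME r. r \<ge> 0 \<and> (\<forall>y\<in>K. norm y \<le> r))"

lemma R\<^sub>K: "0 \<le> R\<^sub>K" "\<And>y. y \<in> K \<Longrightarrow> norm y \<le> R\<^sub>K"
proof -
  obtain r where "r > 0" "\<forall>y\<in>K. norm y \<le> r"
    using compact_imp_bounded[OF compact_K] bounded_pos by metis
  then have "\<exists>r. r \<ge> 0 \<and> (\<forall>y\<in>K. norm y \<le> r)" by (metis less_imp_le)
  from someI_ex[OF this] show "0 \<le> R\<^sub>K" "\<And>y. y \<in> K \<Longrightarrow> norm y \<le> R\<^sub>K"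
    unfolding R\<^sub>K_def by auto
qed

lemma \<E>_R: "\<xi> \<in> \<E> \<Longrightarrow> norm (\<xi> n) \<le> R\<^sub>K"
  using R\<^sub>K(2) \<E>_K by blast

lemma past_dist_nonneg_\<E>: "\<xi> \<in> \<E> \<Longrightarrow> \<xi>' \<in> \<E> \<Longrightarrow> 0 \<le> past_dist \<iota> \<xi> \<xi>'"
  by (rule past_dist_nonneg[OF \<iota> \<E>_R \<E>_R])

lemma past_dist_bounded:
  assumes "\<xi> \<in> \<E>" "\<xi>' \<in> \<E>"
  shows "past_dist \<iota> \<xi> \<xi>' \<le> 2 * R\<^sub>K * (\<iota> / (\<iota> - 1))"
  using past_dist_le[OF \<iota> \<E>_R[OF assms(1)] \<E>_R[OF assms(2)], where m=0 and \<delta>=0] by simp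

text \<open>Uniform in the past and in all weights with given Lipschitz constant and support radius:
  the weights used later depend on the state, while the constant must not.\<close>

definition shift_bound :: "'e set \<Rightarrow> real \<Rightarrow> real \<Rightarrow> real \<Rightarrow> bool" where
  "shift_bound F L r C \<longleftrightarrow> (\<forall>\<xi>\<in>\<E>. \<forall>\<theta> G \<Phi>. (\<forall>y. 0 \<le> \<theta> y) \<and> (\<forall>y. \<theta> y \<le> 1) \<and> (\<forall>y y'. \<bar>\<theta> y - \<theta> y'\<bar> \<le> L * norm (y - y')) \<and>
       (\<forall>y. norm y > r \<longrightarrow> \<theta> y = 0) \<and> \<theta> \<in> borel_measurable borel \<and> G \<in> borel_measurable borel \<and>
       (\<forall>y. \<bar>G y\<bar> \<le> 1) \<and> \<Phi> \<in> F \<and> norm \<Phi> \<le> 1 \<longrightarrow>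
       \<bar>(\<integral>y. G (y + \<Phi>) * \<theta> y \<partial>Q \<xi>) - (\<integral>y. G y * \<theta> y \<partial>Q \<xi>)\<bar> \<le> C * norm \<Phi>)"

text \<open>The density is Lipschitz jointly in the past and the noise, and the pasts in
  \<open>\<E>\<close> have bounded mutual distance. Hence one bound on a ball serves all pasts,
  which makes the shift constant uniform.\<close>

lemma noise_shift:
  obtains F :: "nat \<Rightarrow> 'e set" where
    "\<And>n. n \<ge> 1 \<Longrightarrow> subspace (F n)" "\<And>n. n \<ge> 1 \<Longrightarrow> F n \<subseteq> F (Suc n)" "closure (\<Union>n\<in>{1..}. F n) = UNIV"
    "\<And>n L1 r. n \<ge> 1 \<Longrightarrow> 0 \<le> L1 \<Longrightarrow> \<exists>C\<ge>0. shift_bound (F n) L1 r C"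
proof -
  obtain F F' P where FP: "\<forall>n\<ge>1. finite_dim_subspace (F n) \<and> F n \<subseteq> F (Suc n) \<and>
           subspace (F' n) \<and> F n \<inter> F' n = {0} \<and>
           bounded_linear (P n) \<and> (\<forall>x. P n x \<in> F n \<and> x - P n x \<in> F' n)"
    and dense: "closure (\<Union>n\<in>{1..}. F n) = UNIV"
    and dens: "\<forall>n\<ge>1. \<exists>(\<rho> :: (nat \<Rightarrow> 'e) \<Rightarrow> 'e \<Rightarrow> real) \<nu> L.
           lebesgue_measure_of (F n) \<nu> \<and>
           (\<forall>\<xi>\<in>\<E>. \<forall>y. 0 \<le> \<rho> \<xi> y) \<and>
           (\<forall>\<xi>\<in>\<E>. \<forall>\<xi>'\<in>\<E>. \<forall>y y'. \<bar>\<rho> \<xi> y - \<rho> \<xi>' y'\<bar> \<le> L * (past_dist \<iota> \<xi> \<xi>' + norm (y - y'))) \<and>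
           (\<forall>\<xi>\<in>\<E>. \<forall>A\<in>sets borel. emeasure (Q \<xi>) A =
              (\<integral>\<^sup>+ z. (\<integral>\<^sup>+ w. indicator A (w + z) * ennreal (\<rho> \<xi> (w + z)) \<partial>\<nu>)
                 \<partial>distr (Q \<xi>) borel (\<lambda>x. x - P n x)))"
    using DLP unfolding hyp_DLP_def by (elim exE conjE) (rule that; assumption)
  show ?thesis
  proof (rule that)
    show "subspace (F n)" "F n \<subseteq> F (Suc n)" if "n \<ge> 1" for n
      using FP that by (auto simp: finite_dim_subspace_def)
    show "closure (\<Union>n\<in>{1..}. F n) = UNIV" by (rule dense)
    fix n :: nat and L1 r :: real assume n: "n \<ge> 1" and L1: "0 \<le> L1"
    obtain \<rho> \<nu> L where \<nu>: "lebesgue_measure_of (F n) \<nu>"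
      and \<rho>': "\<forall>\<xi>\<in>\<E>. \<forall>y. 0 \<le> \<rho> \<xi> y"
      "\<forall>\<xi>\<in>\<E>. \<forall>\<xi>'\<in>\<E>. \<forall>y y'. \<bar>\<rho> \<xi> y - \<rho> \<xi>' y'\<bar> \<le> L * (past_dist \<iota> \<xi> \<xi>' + norm (y - y'))"
      "\<forall>\<xi>\<in>\<E>. \<forall>A\<in>sets borel. emeasure (Q \<xi>) A =
              (\<integral>\<^sup>+ z. (\<integral>\<^sup>+ w. indicator A (w + z) * ennreal (\<rho> \<xi> (w + z)) \<partial>\<nu>)
                 \<partial>distr (Q \<xi>) borel (\<lambda>x. x - P n x))"
      using dens[rule_format, OF n] by (elim exE conjE) (rule that; assumption)
    note \<rho>0 = \<rho>'(1)[rule_format] and \<rho>L = \<rho>'(2)[rule_format] and dis = \<rho>'(3)[rule_format]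
    have P: "bounded_linear (P n)" using FP n by blast
    have Pm: "P n \<in> borel_measurable borel"
      by (intro borel_measurable_continuous_onI linear_continuous_on P)
    define Rz where "Rz = R\<^sub>K + onorm (P n) * R\<^sub>K"
    have Rz: "AE x in Q \<xi>. norm (x - P n x) \<le> Rz" if "\<xi> \<in> \<E>" for \<xi>
      using Q_K[OF that]
    proof (rule eventually_mono)
      fix x assume "x \<in> K"
      then have x: "norm x \<le> R\<^sub>K" by (rule R\<^sub>K)
      have "norm (x - P n x) \<le> norm x + norm (P n x)" by (rule norm_triangle_ineq4)
      also have "norm (P n x) \<le> onorm (P n) * norm x" by (rule onorm[OF P])
      also have "\<dots> \<le> onorm (P n) * R\<^sub>K" using x onorm_pos_le[OF P] by (rule mult_left_mono)
      finally show "norm (x - P n x) \<le> Rz" using x by (simp add: Rz_def)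
    qed
    show "\<exists>C\<ge>0. shift_bound (F n) L1 r C"
    proof (cases "\<E> = {}")
      case False
      then obtain \<xi>0 where \<xi>0: "\<xi>0 \<in> \<E>" by blast
      \<comment> \<open>The value at a reference point plus the Lipschitz constant times the largest
        possible distance from it. No sign is prescribed for \<open>L\<close>, so its absolute value
        is taken.\<close>
      define b where "b = \<rho> \<xi>0 0 + \<bar>L\<bar> * (2 * R\<^sub>K * (\<iota> / (\<iota> - 1)) + \<bar>r\<bar>)"
      have b0: "0 \<le> b" using \<rho>0[OF \<xi>0] R\<^sub>K(1) \<iota> by (auto simp: b_def intro!: add_nonneg_nonneg mult_nonneg_nonneg)
      have b: "\<rho> \<xi> y \<le> b" if \<xi>: "\<xi> \<in> \<E>" and y: "norm y \<le> r" for \<xi> y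
      proof -
        have "\<rho> \<xi> y \<le> \<rho> \<xi>0 0 + L * (past_dist \<iota> \<xi> \<xi>0 + norm (y - 0))"
          using \<rho>L[OF \<xi> \<xi>0, of y 0] by linarith
        also have "L * (past_dist \<iota> \<xi> \<xi>0 + norm (y - 0)) \<le> \<bar>L\<bar> * (past_dist \<iota> \<xi> \<xi>0 + norm (y - 0))"
          using past_dist_nonneg_\<E>[OF \<xi> \<xi>0] by (intro mult_right_mono) auto
        also have "\<dots> \<le> \<bar>L\<bar> * (2 * R\<^sub>K * (\<iota> / (\<iota> - 1)) + \<bar>r\<bar>)"
          using past_dist_bounded[OF \<xi> \<xi>0] y by (intro mult_left_mono add_mono) auto
        finally show ?thesis by (simp add: b_def)
      qed
      have \<rho>L': "\<bar>\<rho> \<xi> y - \<rho> \<xi> y'\<bar> \<le> \<bar>L\<bar> * norm (y - y')" if "\<xi> \<in> \<E>" for \<xi> y y'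
      proof -
        have "past_dist \<iota> \<xi> \<xi> = 0" by (simp add: past_dist_def)
        moreover have "L * norm (y - y') \<le> \<bar>L\<bar> * norm (y - y')" by (intro mult_right_mono) auto
        ultimately show ?thesis using \<rho>L[OF that that, of y y'] by simp
      qed
      have Lb: "0 \<le> L1 * b + \<bar>L\<bar>" using L1 b0 by simp
      show ?thesis
        unfolding shift_bound_def
      proof (intro exI[of _ "2 * ((L1 * b + \<bar>L\<bar>) * measure \<nu> (cball 0 (r + 1 + Rz)))"] conjI ballI allI impI)
        show "0 \<le> 2 * ((L1 * b + \<bar>L\<bar>) * measure \<nu> (cball 0 (r + 1 + Rz)))" using Lb by simp
        fix \<xi> \<Phi> and \<theta> G :: "'e \<Rightarrow> real"
        assume \<xi>: "\<xi> \<in> \<E>" and "(\<forall>y. 0 \<le> \<theta> y) \<and> (\<forall>y. \<theta> y \<le> 1) \<and> (\<forall>y y'. \<bar>\<theta> y - \<theta> y'\<bar> \<le> L1 * norm (y - y')) \<and>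
           (\<forall>y. norm y > r \<longrightarrow> \<theta> y = 0) \<and> \<theta> \<in> borel_measurable borel \<and> G \<in> borel_measurable borel \<and>
           (\<forall>y. \<bar>G y\<bar> \<le> 1) \<and> \<Phi> \<in> F n \<and> norm \<Phi> \<le> 1"
        then show "\<bar>(\<integral>y. G (y + \<Phi>) * \<theta> y \<partial>Q \<xi>) - (\<integral>y. G y * \<theta> y \<partial>Q \<xi>)\<bar> \<le>
            2 * ((L1 * b + \<bar>L\<bar>) * measure \<nu> (cball 0 (r + 1 + Rz))) * norm \<Phi>"
          by (intro integral_shift[OF prob_Q sets_Q \<nu> Pm Rz[OF \<xi>] \<rho>0[OF \<xi>] b[OF \<xi>] \<rho>L'[OF \<xi>] dis[OF \<xi>]] Lb) auto
      qed
    next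
      case True
      then show ?thesis unfolding shift_bound_def by auto
    qed
  qed
qed

text \<open>Compactness of \<open>X \<times> K\<close> leaves finitely many controls, glued by a
  Lipschitz partition of unity. The weights stay separate instead of being averaged into one
  control, since only translations by fixed vectors have a law that can be compared.\<close>

lemma stabilisation:
  assumes F: "\<And>n. n \<ge> 1 \<Longrightarrow> subspace (F n)" "\<And>n. n \<ge> 1 \<Longrightarrow> F n \<subseteq> F (Suc n)" "closure (\<Union>n\<in>{1..}. F n) = (UNIV :: 'e set)"
  obtains n N :: nat and R :: "nat \<Rightarrow> 'h \<Rightarrow> 'e" and \<theta> :: "nat \<Rightarrow> 'h \<times> 'e \<Rightarrow> real" and q C L r \<delta> :: real
  where "n \<ge> 1" "0 < q" "q < 1" "0 \<le> C" "0 \<le> L" "\<delta> > 0"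
    "\<And>i h. i < N \<Longrightarrow> R i h \<in> F n" "\<And>i h. i < N \<Longrightarrow> norm (R i h) \<le> C * norm h"
    "\<And>i p. 0 \<le> \<theta> i p" "\<And>i p. \<theta> i p \<le> 1"
    "\<And>i u y y'. i < N \<Longrightarrow> \<bar>\<theta> i (u, y) - \<theta> i (u, y')\<bar> \<le> L * norm (y - y')"
    "\<And>i u y. i < N \<Longrightarrow> r < norm y \<Longrightarrow> \<theta> i (u, y) = 0"
    "\<And>u y. u \<in> X \<Longrightarrow> y \<in> K \<Longrightarrow> (\<Sum>i<N. \<theta> i (u, y)) = 1"
    "\<And>i u u' y. i < N \<Longrightarrow> \<theta> i (u, y) \<noteq> 0 \<Longrightarrow> norm (u' - u) < \<delta> \<Longrightarrow>
       norm (S (u', y + R i (u' - u)) - S (u, y)) \<le> q * norm (u' - u)"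
proof -
  obtain S' :: "'h \<times> 'e \<Rightarrow> ('h \<times> 'e) \<Rightarrow>\<^sub>L 'h" and S'' where S': "\<And>x. (S has_derivative blinfun_apply (S' x)) (at x)"
    and S'': "\<And>x. (S' has_derivative blinfun_apply (S'' x)) (at x)"
    using S_C2 unfolding C2_bounded_on_bounded_def by blast
  have contS': "isCont S' x" for x using S'' has_derivative_continuous by blast
  have Du: "D_u S u y = (\<lambda>h. S' (u, y) (h, 0))" for u y
  proof -
    have "((\<lambda>v. S (v, y)) has_derivative (\<lambda>h. S' (u, y) (h, 0))) (at u)"
      by (rule has_derivative_compose[of "\<lambda>v. (v, y)" "\<lambda>h. (h, 0)" u UNIV S, OF _ S']) (auto intro!: derivative_eq_intros)
    from frechet_derivative_at[OF this] show ?thesis by (simp add: D_u_def)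
  qed
  have De: "D_eta S u y = (\<lambda>e. S' (u, y) (0, e))" for u y
  proof -
    have "((\<lambda>e. S (u, e)) has_derivative (\<lambda>e. S' (u, y) (0, e))) (at y)"
      by (rule has_derivative_compose[of "\<lambda>e. (u, e)" "\<lambda>e. (0, e)" y UNIV S, OF _ S']) (auto intro!: derivative_eq_intros)
    from frechet_derivative_at[OF this] show ?thesis by (simp add: D_eta_def)
  qed
  obtain W G where WG: "X \<times> K \<subseteq> W" "finite_dim_subspace G" "determining S X K G"
      "\<And>u y. (u, y) \<in> W \<Longrightarrow> G \<subseteq> closure (range (D_eta S u y))"
    using ALC unfolding hyp_ALC_def by blast
  obtain B where B: "finite B" "G = span B" using WG(2) unfolding finite_dim_subspace_def by blast
  obtain C0 where C0: "finite C0" "span C0 = G" "pairwise orthogonal C0"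
    using basis_orthogonal[OF B(1)] B(2) by metis
  \<comment> \<open>The orthogonal spanning set may contain 0, where the coefficients of the
    projection would be divided by 0.\<close>
  define C where "C = C0 - {0}"
  have C: "finite C" "span C = G" "pairwise orthogonal C" "0 \<notin> C"
    using C0 pairwise_subset[OF C0(3)] by (auto simp: C_def)
  obtain \<kappa> where \<kappa>: "0 < \<kappa>" "\<kappa> < 1"
    "\<And>u y. u \<in> X \<Longrightarrow> y \<in> K \<Longrightarrow> onorm (\<lambda>h. D_u S u y h - orth_proj G (D_u S u y h)) \<le> \<kappa>"
    using WG(3) unfolding determining_def by blast
  have proj: "norm (S' (u, y) (h, 0) - (\<Sum>g\<in>C. (inner (S' (u, y) (h, 0)) g / inner g g) *\<^sub>R g)) \<le> \<kappa> * norm h"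
    if "u \<in> X" "y \<in> K" for u y h
  proof -
    have op: "orth_proj G = (\<lambda>x. \<Sum>g\<in>C. (inner x g / inner g g) *\<^sub>R g)"
      using orth_proj_orthogonal_basis[OF C(1,3,4)] C(2) by (simp add: fun_eq_iff)
    have bl: "bounded_linear (\<lambda>h. S' (u, y) (h, 0))"
      by (rule bounded_linear_compose[OF blinfun.bounded_linear_right])
        (intro bounded_linear_Pair bounded_linear_zero bounded_linear_ident)
    have "bounded_linear (\<lambda>h. S' (u, y) (h, 0) - (\<Sum>g\<in>C. (inner (S' (u, y) (h, 0)) g / inner g g) *\<^sub>R g))"
      by (intro bounded_linear_sub bl bounded_linear_sum bounded_linear_compose[OF bounded_linear_scaleR_left]
          bounded_linear_compose[OF bounded_linear_divide] bounded_linear_compose[OF bounded_linear_inner_left])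
    from onorm[OF this, of h] show ?thesis
      using \<kappa>(3)[OF that] mult_right_mono[OF _ norm_ge_zero[of h]] unfolding Du op by (metis (no_types, lifting) order_trans)
  qed
  have "\<forall>p\<in>X \<times> K. \<exists>n\<ge>1. \<exists>R c r. r > 0 \<and> c \<ge> 0 \<and> (\<forall>h. R h \<in> F n \<and> norm (R h) \<le> c * norm h) \<and>
    (\<forall>u u' y. dist (u, y) p < r \<and> dist u' u < r \<longrightarrow>
       norm (S (u', y + R (u' - u)) - S (u, y)) \<le> (1 + \<kappa>) / 2 * norm (u' - u))"
  proof (rule ballI)
    fix p assume "p \<in> X \<times> K"
    then obtain u y where p: "p = (u, y)" "u \<in> X" "y \<in> K" by auto
    show "\<exists>n\<ge>1. \<exists>R c r. r > 0 \<and> c \<ge> 0 \<and> (\<forall>h. R h \<in> F n \<and> norm (R h) \<le> c * norm h) \<and>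
    (\<forall>u u' y. dist (u, y) p < r \<and> dist u' u < r \<longrightarrow>
       norm (S (u', y + R (u' - u)) - S (u, y)) \<le> (1 + \<kappa>) / 2 * norm (u' - u))"
    proof (rule pointwise_stabilisation[OF S' contS' C(1,4) _ \<kappa>(2) _ F])
      show "norm (S' p (h, 0) - (\<Sum>g\<in>C. (inner (S' p (h, 0)) g / inner g g) *\<^sub>R g)) \<le> \<kappa> * norm h" for h
        using proj p by simp
      show "g \<in> closure (range (\<lambda>e. S' p (0, e)))" if "g \<in> C" for g
        using WG(4)[of u y] WG(1) p that C(2) span_base[of g C] De[of u y] by auto
    qed
  qed
  then obtain n R c r where st: "\<And>p. p \<in> X \<times> K \<Longrightarrow> n p \<ge> 1 \<and> r p > 0 \<and> c p \<ge> 0 \<and>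
      (\<forall>h. R p h \<in> F (n p) \<and> norm (R p h) \<le> c p * norm h) \<and>
    (\<forall>u u' y. dist (u, y) p < r p \<and> dist u' u < r p \<longrightarrow>
       norm (S (u', y + R p (u' - u)) - S (u, y)) \<le> (1 + \<kappa>) / 2 * norm (u' - u))"
    by (subst (asm) bchoice_iff) (metis (no_types))
  have rp: "r p > 0" if "p \<in> X \<times> K" for p using st[OF that] by blast
  obtain N :: nat and z :: "nat \<Rightarrow> 'h \<times> 'e" and \<theta> L where z: "\<And>i. i < N \<Longrightarrow> z i \<in> X \<times> K" "0 \<le> L"
    and \<theta>: "\<And>i p. 0 \<le> \<theta> i p" "\<And>i p. \<theta> i p \<le> (1::real)"
    "\<And>i p q. i < N \<Longrightarrow> \<bar>\<theta> i p - \<theta> i q\<bar> \<le> L * dist p q"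
    "\<And>i p. i < N \<Longrightarrow> \<theta> i p \<noteq> 0 \<Longrightarrow> dist p (z i) < r (z i)"
    "\<And>p. p \<in> X \<times> K \<Longrightarrow> (\<Sum>i<N. \<theta> i p) = 1"
    by (rule lipschitz_partition[OF compact_Times[OF compact_X compact_K], of r]) (blast intro: rp, (rule that; assumption))
  \<comment> \<open>The inserted 1 covers N = 0 and ensures \<open>m \<ge> 1\<close>, as the spaces
    are indexed from 1.\<close>
  define m where "m = Max (insert 1 ((\<lambda>i. n (z i)) ` {..<N}))"
  have m1: "m \<ge> 1" unfolding m_def by (intro Max_ge) auto
  have Fmono: "F i \<subseteq> F j" if "1 \<le> i" "i \<le> j" for i j
    using that(2)
  proof (induction j rule: dec_induct)
    case (step j)
    then show ?case using F(2)[of j] that(1) by simp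
  qed simp
  define Cm where "Cm = (\<Sum>i<N. c (z i))"
  \<comment> \<open>Dominates the norm of the noise on the support of every weight; a sum is used in
    place of a maximum.\<close>
  define rm where "rm = (\<Sum>i<N. norm (snd (z i)) + r (z i))"
  define \<delta> where "\<delta> = Min (insert 1 ((\<lambda>i. r (z i)) ` {..<N}))"
  have cz: "c (z i) \<le> Cm" if "i < N" for i
    unfolding Cm_def using that st[OF z(1)] by (intro member_le_sum) auto
  have Cm0: "0 \<le> Cm" unfolding Cm_def using st[OF z(1)] by (intro sum_nonneg) auto
  show ?thesis
  proof (rule that[of m "(1 + \<kappa>) / 2" Cm L \<delta> N "\<lambda>i. R (z i)" \<theta> rm])
    show "\<delta> > 0" unfolding \<delta>_def using st[OF z(1)] by (subst Min_gr_iff) auto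
    show "R (z i) h \<in> F m" if "i < N" for i h
    proof -
      have "n (z i) \<le> m" unfolding m_def using that by (intro Max_ge) auto
      then show ?thesis using Fmono[of "n (z i)" m] st[OF z(1)[OF that]] by blast
    qed
    show "norm (R (z i) h) \<le> Cm * norm h" if "i < N" for i h
      using st[OF z(1)[OF that]] mult_right_mono[OF cz[OF that] norm_ge_zero[of h]] order_trans by blast
    show "\<bar>\<theta> i (u, y) - \<theta> i (u, y')\<bar> \<le> L * norm (y - y')" if "i < N" for i u y y'
      using \<theta>(3)[OF that, of "(u, y)" "(u, y')"] by (simp add: dist_Pair_Pair dist_norm)
    show "\<theta> i (u, y) = 0" if "i < N" "rm < norm y" for i u y
    proof (rule ccontr)
      assume "\<theta> i (u, y) \<noteq> 0"
      then have "dist (u, y) (z i) < r (z i)" by (rule \<theta>(4)[OF that(1)])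
      then have "norm (y - snd (z i)) < r (z i)"
        using dist_snd_le[of "(u, y)" "z i"] by (simp add: dist_norm)
      then have "norm y < norm (snd (z i)) + r (z i)" using norm_triangle_sub[of y "snd (z i)"] by linarith
      also have "\<dots> \<le> rm" unfolding rm_def using that(1) less_imp_le[OF rp[OF z(1)]]
        by (intro member_le_sum add_nonneg_nonneg[OF norm_ge_zero]) auto
      finally show False using that by simp
    qed
    show "norm (S (u', y + R (z i) (u' - u)) - S (u, y)) \<le> (1 + \<kappa>) / 2 * norm (u' - u)"
      if "i < N" "\<theta> i (u, y) \<noteq> 0" "norm (u' - u) < \<delta>" for i u u' y
    proof -
      have "\<delta> \<le> r (z i)" unfolding \<delta>_def using that by (intro Min_le) auto
      then show ?thesis using st[OF z(1)[OF that(1)]] \<theta>(4)[OF that(1,2)] that(3) by (auto simp: dist_norm)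
    qed
  qed (use m1 \<kappa> Cm0 z \<theta> in auto)
qed

text \<open>Markov operator of the U-process, written as an integral over the next noise so that
  shifts and changes of the past act on it directly. \<open>integral_U_kernel\<close> links it to
  the kernel on states.\<close>

definition transition :: "('h \<times> (nat \<Rightarrow> 'e) \<Rightarrow> real) \<Rightarrow> 'h \<times> (nat \<Rightarrow> 'e) \<Rightarrow> real" where
  "transition g z = (\<integral>y. g (S (fst z, y), snoc (snd z) y) \<partial>Q (snd z))"

lemma bounded_integrable_Q:
  fixes f :: "'e \<Rightarrow> real"
  assumes "f \<in> borel_measurable borel" "\<And>y. \<bar>f y\<bar> \<le> b"
  shows "integrable (Q \<xi>) f"
proof -
  interpret Q: prob_space "Q \<xi>" by (rule prob_Q)
  show ?thesis using assms by (intro Q.integrable_const_bound[where B=b]) auto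
qed

lemma transition_integrand_measurable:
  "g \<in> borel_measurable borel \<Longrightarrow> (\<lambda>y. g (S (v, y), snoc x y)) \<in> borel_measurable borel"
  by (rule measurable_compose[OF borel_measurable_Pair]) measurable

lemma transition_bounded:
  assumes "g \<in> borel_measurable borel" "\<And>w. \<bar>g w\<bar> \<le> 1"
  shows "\<bar>transition g z\<bar> \<le> 1"
proof -
  interpret Q: prob_space "Q (snd z)" by (rule prob_Q)
  have "\<bar>transition g z\<bar> \<le> (\<integral>y. \<bar>g (S (fst z, y), snoc (snd z) y)\<bar> \<partial>Q (snd z))"
    unfolding transition_def by (rule integral_abs_bound)
  also have "\<dots> \<le> (\<integral>y. 1 \<partial>Q (snd z))"
    using transition_integrand_measurable[OF assms(1)] assms(2)
    by (intro integral_mono bounded_integrable_Q[where b=1]) auto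
  finally show ?thesis using Q.prob_space by simp
qed

text \<open>Equivalent to the sum of the two distances for positive \<open>A\<close>; the weight is
  what turns separate estimates of the two components into one contraction.\<close>

definition mixed_dist :: "real \<Rightarrow> 'h \<times> (nat \<Rightarrow> 'e) \<Rightarrow> 'h \<times> (nat \<Rightarrow> 'e) \<Rightarrow> real" where
  "mixed_dist A z z' = A * norm (fst z - fst z') + past_dist \<iota> (snd z) (snd z')"

lemma mixed_dist_nonneg: "0 \<le> A \<Longrightarrow> z \<in> X \<times> \<E> \<Longrightarrow> z' \<in> X \<times> \<E> \<Longrightarrow> 0 \<le> mixed_dist A z z'"
  by (auto simp: mixed_dist_def intro!: add_nonneg_nonneg past_dist_nonneg_\<E>)

end

text \<open>The pair g, g' and the constant c are needed for segments: when the last state is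
  integrated out along two different initial pieces, the integrands are two functions of that state,
  and c measures the distance of the pieces.\<close>

locale one_step_contraction = driven_system K \<E> Q \<iota> C\<^sub>Q S X
  for K :: "'e::{banach, second_countable_topology} set" and \<E> Q \<iota> C\<^sub>Q
    and S :: "'h::{real_inner, complete_space, second_countable_topology} \<times> 'e \<Rightarrow> 'h" and X +
  fixes A C q :: real
  assumes A: "A \<ge> 1" and C: "C \<ge> 0" and q: "0 \<le> q" "q < 1"
    and one_step: "\<And>g g' c a z z'. g \<in> borel_measurable borel \<Longrightarrow> g' \<in> borel_measurable borel \<Longrightarrow>
      (\<And>w. \<bar>g w\<bar> \<le> 1) \<Longrightarrow> (\<And>w. \<bar>g' w\<bar> \<le> 1) \<Longrightarrow> 0 \<le> c \<Longrightarrow> 0 \<le> a \<Longrightarrow>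
      (\<And>w w'. w \<in> X \<times> \<E> \<Longrightarrow> w' \<in> X \<times> \<E> \<Longrightarrow> \<bar>g w - g' w'\<bar> \<le> c + a * mixed_dist A w w') \<Longrightarrow>
      z \<in> X \<times> \<E> \<Longrightarrow> z' \<in> X \<times> \<E> \<Longrightarrow>
      \<bar>transition g z - transition g' z'\<bar> \<le> c + (a * q + C) * mixed_dist A z z'"

text \<open>The noise \<open>y\<close> driving the first trajectory is replaced, with probability \<open>\<theta> i (u, y)\<close>, by the
  shifted noise \<open>y + R i (u' - u)\<close> for the second one.  The shift makes the trajectories approach each
  other and, by the Lipschitz densities, changes the law of the noise by \<open>O(norm (u' - u))\<close> in total
  variation.  Since the weights are Lipschitz, only translations by fixed vectors are needed.\<close>

lemma (in driven_system) ex_one_step_contraction: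
  "\<exists>A C q. one_step_contraction K \<E> Q \<iota> C\<^sub>Q S X A C q"
proof -
  obtain F :: "nat \<Rightarrow> 'e set" where F: "\<And>n. n \<ge> 1 \<Longrightarrow> subspace (F n)" "\<And>n. n \<ge> 1 \<Longrightarrow> F n \<subseteq> F (Suc n)"
    "closure (\<Union>n\<in>{1..}. F n) = UNIV" and
    shift: "\<And>n L1 r. n \<ge> 1 \<Longrightarrow> 0 \<le> L1 \<Longrightarrow> \<exists>C\<ge>0. shift_bound (F n) L1 r C"
    by (rule noise_shift) (rule that; assumption)
  obtain n N :: nat and R :: "nat \<Rightarrow> 'h \<Rightarrow> 'e" and \<theta> :: "nat \<Rightarrow> 'h \<times> 'e \<Rightarrow> real" and q0 CR L r \<delta> :: real
    where n: "n \<ge> 1" and q0: "0 < q0" "q0 < 1" and CR: "0 \<le> CR" and L: "0 \<le> L" and \<delta>: "\<delta> > 0" and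
    R: "\<And>i h. i < N \<Longrightarrow> R i h \<in> F n" "\<And>i h. i < N \<Longrightarrow> norm (R i h) \<le> CR * norm h" and
    \<theta>: "\<And>i p. 0 \<le> \<theta> i p" "\<And>i p. \<theta> i p \<le> 1"
    "\<And>i u y y'. i < N \<Longrightarrow> \<bar>\<theta> i (u, y) - \<theta> i (u, y')\<bar> \<le> L * norm (y - y')"
    "\<And>i u y. i < N \<Longrightarrow> r < norm y \<Longrightarrow> \<theta> i (u, y) = 0"
    "\<And>u y. u \<in> X \<Longrightarrow> y \<in> K \<Longrightarrow> (\<Sum>i<N. \<theta> i (u, y)) = 1" and
    contr: "\<And>i u u' y. i < N \<Longrightarrow> \<theta> i (u, y) \<noteq> 0 \<Longrightarrow> norm (u' - u) < \<delta> \<Longrightarrow>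
       norm (S (u', y + R i (u' - u)) - S (u, y)) \<le> q0 * norm (u' - u)"
    by (rule stabilisation[OF F]) (assumption, assumption, (rule that; assumption))
  obtain C1 where C1: "C1 \<ge> 0" and shift1: "\<And>\<xi> \<theta> G \<Phi>. \<xi> \<in> \<E> \<Longrightarrow>
       (\<And>y. 0 \<le> \<theta> y) \<Longrightarrow> (\<And>y. \<theta> y \<le> 1) \<Longrightarrow> (\<And>y y'. \<bar>\<theta> y - \<theta> y'\<bar> \<le> L * norm (y - y')) \<Longrightarrow>
       (\<And>y. norm y > r \<Longrightarrow> \<theta> y = 0) \<Longrightarrow> \<theta> \<in> borel_measurable borel \<Longrightarrow> G \<in> borel_measurable borel \<Longrightarrow>
       (\<And>y. \<bar>G y\<bar> \<le> 1) \<Longrightarrow> \<Phi> \<in> F n \<Longrightarrow> norm \<Phi> \<le> 1 \<Longrightarrow>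
       \<bar>(\<integral>y. G (y + \<Phi>) * \<theta> y \<partial>Q \<xi>) - (\<integral>y. G y * \<theta> y \<partial>Q \<xi>)\<bar> \<le> C1 * norm \<Phi>"
    using shift[OF n L, of r] unfolding shift_bound_def by (elim exE conjE) (rule that; blast)
  \<comment> \<open>The second bound makes all shifts have norm at most 1, as
    \<open>shift_bound\<close> requires.\<close>
  define \<delta>' where "\<delta>' = min \<delta> (1 / (CR + 1))"
  have \<delta>': "\<delta>' > 0" using \<delta> CR by (simp add: \<delta>'_def)
  \<comment> \<open>Large enough that \<open>A * q0 + CR \<le> A * (1 + q0) / 2\<close>: half of the
    gained contraction absorbs the norm of the shift, which enters the distance of the new
    pasts.\<close>
  define A where "A = 1 + 2 * CR / (1 - q0)"
  \<comment> \<open>The worse of the rates of the two components; the pasts contract by 1 /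
    \<iota>.\<close>
  define q where "q = max ((1 + q0) / 2) (1 / \<iota>)"
  \<comment> \<open>The first term is the effect of the different pasts on the law of the noise, the
    second that of the \<open>N\<close> shifts.\<close>
  define CT where "CT = 2 * C\<^sub>Q + real N * (C1 * CR)"
  \<comment> \<open>\<open>CT\<close> occurs twice, for the test function and for the exit from
    \<open>\<E>\<close>. The last term covers states that are too far apart to be
    controlled.\<close>
  define C where "C = 2 * CT + 2 / \<delta>'"
  have A1: "A \<ge> 1" using CR q0 by (simp add: A_def)
  have q: "0 \<le> q" "q < 1" "(1 + q0) / 2 \<le> q" "1 / \<iota> \<le> q" using q0 \<iota> by (auto simp: q_def le_max_iff_disj)
  have Aq: "A * q0 + CR \<le> A * ((1 + q0) / 2)"
  proof -
    have "A * (1 - q0) = (1 - q0) + 2 * CR" using q0 by (simp add: A_def field_simps)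
    then have "2 * CR \<le> A * (1 - q0)" using q0 by simp
    then show ?thesis by (simp add: field_simps)
  qed
  have CT0: "0 \<le> CT" using C\<^sub>Q C1 CR by (simp add: CT_def)
  have C0: "0 \<le> C" using CT0 \<delta>' by (simp add: C_def)
  have "one_step_contraction K \<E> Q \<iota> C\<^sub>Q S X A C q"
  proof unfold_locales
    show "A \<ge> 1" "C \<ge> 0" "0 \<le> q" "q < 1" by (rule A1 C0 q(1) q(2))+
    fix g g' :: "'h \<times> (nat \<Rightarrow> 'e) \<Rightarrow> real" and c a :: real and z z'
    assume gm[measurable]: "g \<in> borel_measurable borel" "g' \<in> borel_measurable borel"
      and g1: "\<And>w. \<bar>g w\<bar> \<le> 1" "\<And>w. \<bar>g' w\<bar> \<le> 1" and c: "0 \<le> c" and a: "0 \<le> a"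
      and close: "\<And>w w'. w \<in> X \<times> \<E> \<Longrightarrow> w' \<in> X \<times> \<E> \<Longrightarrow> \<bar>g w - g' w'\<bar> \<le> c + a * mixed_dist A w w'"
      and "z \<in> X \<times> \<E>" "z' \<in> X \<times> \<E>"
    then obtain u \<xi> u' \<xi>' where z: "z = (u, \<xi>)" "z' = (u', \<xi>')" and u: "u \<in> X" "u' \<in> X" and \<xi>: "\<xi> \<in> \<E>" "\<xi>' \<in> \<E>"
      by auto
    interpret Q: prob_space "Q \<xi>" by (rule prob_Q)
    interpret Q': prob_space "Q \<xi>'" by (rule prob_Q)
    let ?D = "mixed_dist A z z'" and ?d = "past_dist \<iota> \<xi> \<xi>'" and ?h = "u' - u"
    have D: "?D = A * norm ?h + ?d" by (simp add: mixed_dist_def z norm_minus_commute)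
    have d0: "0 \<le> ?d" by (rule past_dist_nonneg_\<E>[OF \<xi>])
    have hD: "norm ?h \<le> ?D" unfolding D using d0 mult_right_mono[OF A1, of "norm ?h"] by simp
    have dD: "?d \<le> ?D" unfolding D using A1 by simp
    have D0: "0 \<le> ?D" using dD d0 by linarith
    note gS = transition_integrand_measurable
    show "\<bar>transition g z - transition g' z'\<bar> \<le> c + (a * q + C) * ?D"
    proof (cases "norm ?h < \<delta>'")
      case False
      have "\<bar>transition g z\<bar> \<le> 1" "\<bar>transition g' z'\<bar> \<le> 1"
        by (rule transition_bounded[OF gm(1) g1(1)], rule transition_bounded[OF gm(2) g1(2)])
      then have "\<bar>transition g z - transition g' z'\<bar> \<le> 2" by linarith
      also have "2 \<le> 2 / \<delta>' * norm ?h" using False \<delta>' by (simp add: field_simps)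
      also have "\<dots> \<le> 2 / \<delta>' * ?D" using hD \<delta>' by (intro mult_left_mono) auto
      also have "\<dots> \<le> (a * q + C) * ?D" using a q CT0 D0 by (intro mult_right_mono) (auto simp: C_def)
      finally show ?thesis using c by linarith
    next
      case True
      define \<Phi> where "\<Phi> i = R i ?h" for i
      have \<Phi>F: "\<Phi> i \<in> F n" and \<Phi>n: "norm (\<Phi> i) \<le> CR * norm ?h" if "i < N" for i
        using R[OF that] by (auto simp: \<Phi>_def)
      have \<Phi>1: "norm (\<Phi> i) \<le> 1" if "i < N" for i
      proof -
        have "CR * norm ?h \<le> CR * (1 / (CR + 1))" using True CR by (intro mult_left_mono) (auto simp: \<delta>'_def)
        also have "\<dots> \<le> 1" using CR by simp
        finally show ?thesis using \<Phi>n[OF that] by simp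
      qed
      define t where "t i y = \<theta> i (u, y)" for i y
      have tL: "\<bar>t i y - t i y'\<bar> \<le> L * norm (y - y')" if "i < N" for i y y'
        using \<theta>(3)[OF that] by (simp add: t_def)
      have t01: "0 \<le> t i y" "t i y \<le> 1" for i y using \<theta> by (auto simp: t_def)
      have tm: "t i \<in> borel_measurable borel" if "i < N" for i
      proof (rule borel_measurable_continuous_onI)
        have "L-lipschitz_on UNIV (t i)" using tL[OF that] L by (auto simp: lipschitz_on_def dist_norm)
        then show "continuous_on UNIV (t i)" by (rule lipschitz_on_continuous_on)
      qed
      have tr: "t i y = 0" if "i < N" "norm y > r" for i y using \<theta>(4)[OF that] by (simp add: t_def)
      have tsum: "(\<Sum>i<N. t i y) = 1" if "y \<in> K" for y using \<theta>(5)[OF u(1) that] by (simp add: t_def)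
      have plus: "(\<lambda>y. H (y + v)) \<in> borel_measurable borel" if "H \<in> borel_measurable borel" for H :: "'e \<Rightarrow> real" and v
        by (rule measurable_compose[OF _ that]) measurable
      have int: "integrable (Q \<xi>) (\<lambda>y. H y * t i y)"
        if [measurable]: "H \<in> borel_measurable borel" and "\<And>y. \<bar>H y\<bar> \<le> b" "i < N" for H b i
        using that(2) t01 tm[OF that(3)] by (intro bounded_integrable_Q[where b=b])
          (auto simp: abs_mult intro!: order_trans[OF mult_left_le])
      \<comment> \<open>The weights sum to 1 only on \<open>K\<close>, but \<open>K\<close> has full
        mass under \<open>Q \<xi>\<close>.\<close>
      have split: "(\<integral>y. H y \<partial>Q \<xi>) = (\<Sum>i<N. \<integral>y. H y * t i y \<partial>Q \<xi>)"
        if [measurable]: "H \<in> borel_measurable borel" and "\<And>y. \<bar>H y\<bar> \<le> b" for H b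
      proof -
        have "(\<integral>y. H y \<partial>Q \<xi>) = (\<integral>y. (\<Sum>i<N. H y * t i y) \<partial>Q \<xi>)"
        proof (rule integral_cong_AE)
          show "(\<lambda>y. \<Sum>i<N. H y * t i y) \<in> borel_measurable (Q \<xi>)" using tm by simp
          show "AE y in Q \<xi>. H y = (\<Sum>i<N. H y * t i y)"
            using Q_K[OF \<xi>(1)] by eventually_elim (simp add: sum_distrib_left[symmetric] tsum)
        qed simp
        also have "\<dots> = (\<Sum>i<N. \<integral>y. H y * t i y \<partial>Q \<xi>)"
          using int[OF that] by (intro Bochner_Integration.integral_sum) auto
        finally show ?thesis .
      qed
      have TV: "\<bar>(\<integral>y. H y \<partial>Q \<xi>') - (\<Sum>i<N. \<integral>y. H (y + \<Phi> i) * t i y \<partial>Q \<xi>)\<bar> \<le> CT * ?D"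
        if H[measurable]: "H \<in> borel_measurable borel" and H1: "\<And>y. \<bar>H y\<bar> \<le> 1" for H
      proof -
        have "\<bar>(\<integral>y. H y \<partial>Q \<xi>) - (\<integral>y. H y \<partial>Q \<xi>')\<bar> \<le> 2 * var_dist (Q \<xi>) (Q \<xi>')"
          by (rule integral_diff_le_var_dist[OF prob_Q prob_Q]) (use H1 in auto)
        also have "\<dots> \<le> 2 * (C\<^sub>Q * ?d)" using Q_var[OF \<xi>] by simp
        also have "\<dots> \<le> 2 * (C\<^sub>Q * ?D)" using dD C\<^sub>Q by simp
        finally have 1: "\<bar>(\<integral>y. H y \<partial>Q \<xi>) - (\<integral>y. H y \<partial>Q \<xi>')\<bar> \<le> 2 * (C\<^sub>Q * ?D)" .
        have "\<bar>(\<Sum>i<N. \<integral>y. H (y + \<Phi> i) * t i y \<partial>Q \<xi>) - (\<integral>y. H y \<partial>Q \<xi>)\<bar> \<le>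
           (\<Sum>i<N. \<bar>(\<integral>y. H (y + \<Phi> i) * t i y \<partial>Q \<xi>) - (\<integral>y. H y * t i y \<partial>Q \<xi>)\<bar>)"
          unfolding split[OF H H1] sum_subtractf[symmetric] by (rule sum_abs)
        also have "\<dots> \<le> (\<Sum>i<N. C1 * CR * ?D)"
        proof (rule sum_mono)
          fix i assume "i \<in> {..<N}"
          then have i: "i < N" by simp
          have "\<bar>(\<integral>y. H (y + \<Phi> i) * t i y \<partial>Q \<xi>) - (\<integral>y. H y * t i y \<partial>Q \<xi>)\<bar> \<le> C1 * norm (\<Phi> i)"
            by (rule shift1[OF \<xi>(1) t01 tL[OF i] tr[OF i] tm[OF i] H H1 \<Phi>F[OF i] \<Phi>1[OF i]])
          also have "\<dots> \<le> C1 * (CR * ?D)"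
            using \<Phi>n[OF i] mult_left_mono[OF hD CR] C1 by (intro mult_left_mono) auto
          finally show "\<bar>(\<integral>y. H (y + \<Phi> i) * t i y \<partial>Q \<xi>) - (\<integral>y. H y * t i y \<partial>Q \<xi>)\<bar> \<le> C1 * CR * ?D" by simp
        qed
        also have "\<dots> = real N * (C1 * CR) * ?D" by simp
        finally show ?thesis using 1 unfolding CT_def by (simp add: algebra_simps)
      qed
      define B where "B = {y. snoc \<xi>' y \<in> \<E>}"
      have B[measurable]: "B \<in> sets borel"
      proof -
        have "closed ((\<lambda>y. snoc \<xi>' y) -` \<E>)"
          by (rule closed_vimage[OF closed_\<E>]) (intro continuous_intros)
        then show ?thesis by (simp add: B_def vimage_def)
      qed
      \<comment> \<open>Set to 0 where the shifted noise would leave \<open>\<E>\<close>, since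
        \<open>close\<close> says nothing there. Under \<open>Q \<xi>'\<close> this changes
        nothing.\<close>
      define G' where "G' y = g' (S (u', y), snoc \<xi>' y) * indicator B y" for y
      have G'm[measurable]: "G' \<in> borel_measurable borel" unfolding G'_def using gS[OF gm(2)] by measurable
      have G'1: "\<bar>G' y\<bar> \<le> 1" for y using g1(2) by (auto simp: G'_def indicator_def)
      \<comment> \<open>The exit indicator has integral 0 under \<open>Q \<xi>'\<close>, so
        \<open>TV\<close> bounds the exit probability of the shifted noise by
        \<open>CT * ?D\<close>.\<close>
      define Gb where "Gb y = (indicator (- B) y :: real)" for y
      have Gbm[measurable]: "Gb \<in> borel_measurable borel" unfolding Gb_def by measurable
      have Gb1: "\<bar>Gb y\<bar> \<le> 1" for y by (auto simp: Gb_def indicator_def)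
      have T1: "transition g' z' = (\<integral>y. G' y \<partial>Q \<xi>')"
        unfolding transition_def z fst_conv snd_conv
      proof (rule integral_cong_AE)
        show "AE y in Q \<xi>'. g' (S (u', y), snoc \<xi>' y) = G' y"
          using Q_\<E>[OF \<xi>(2)] by eventually_elim (simp add: G'_def B_def)
      qed (use gS[OF gm(2)] in auto)
      have "(\<integral>y. Gb y \<partial>Q \<xi>') = (\<integral>y. 0 \<partial>Q \<xi>')"
      proof (rule integral_cong_AE)
        show "AE y in Q \<xi>'. Gb y = 0"
          using Q_\<E>[OF \<xi>(2)] by eventually_elim (simp add: Gb_def B_def)
      qed auto
      then have bad: "(\<Sum>i<N. \<integral>y. Gb (y + \<Phi> i) * t i y \<partial>Q \<xi>) \<le> CT * ?D"
        using TV[OF Gbm Gb1] by simp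
      have main: "\<bar>transition g z - (\<Sum>i<N. \<integral>y. G' (y + \<Phi> i) * t i y \<partial>Q \<xi>)\<bar> \<le>
        c + a * (q * ?D) + (\<Sum>i<N. \<integral>y. Gb (y + \<Phi> i) * t i y \<partial>Q \<xi>)"
      proof -
        let ?g = "\<lambda>y. g (S (u, y), snoc \<xi> y)"
        have ig: "integrable (Q \<xi>) (\<lambda>y. ?g y * t i y)" "integrable (Q \<xi>) (\<lambda>y. G' (y + \<Phi> i) * t i y)"
          "integrable (Q \<xi>) (\<lambda>y. Gb (y + \<Phi> i) * t i y)" "integrable (Q \<xi>) (\<lambda>y. (c + a * (q * ?D)) * t i y)" if "i < N" for i
        proof -
          show "integrable (Q \<xi>) (\<lambda>y. ?g y * t i y)" by (rule int[OF gS[OF gm(1)] g1(1) that])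
          show "integrable (Q \<xi>) (\<lambda>y. G' (y + \<Phi> i) * t i y)" by (rule int[OF plus[OF G'm] G'1 that])
          show "integrable (Q \<xi>) (\<lambda>y. Gb (y + \<Phi> i) * t i y)" by (rule int[OF plus[OF Gbm] Gb1 that])
          show "integrable (Q \<xi>) (\<lambda>y. (c + a * (q * ?D)) * t i y)"
            by (rule int[of "\<lambda>_. c + a * (q * ?D)", OF _ order_refl that]) simp
        qed
        have "transition g z - (\<Sum>i<N. \<integral>y. G' (y + \<Phi> i) * t i y \<partial>Q \<xi>) =
          (\<Sum>i<N. (\<integral>y. ?g y * t i y \<partial>Q \<xi>) - (\<integral>y. G' (y + \<Phi> i) * t i y \<partial>Q \<xi>))"
          unfolding transition_def z fst_conv snd_conv using g1(1) by (subst split[OF gS[OF gm(1)]]) (auto simp: sum_subtractf)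
        also have "\<bar>\<dots>\<bar> \<le> (\<Sum>i<N. \<bar>(\<integral>y. ?g y * t i y \<partial>Q \<xi>) - (\<integral>y. G' (y + \<Phi> i) * t i y \<partial>Q \<xi>)\<bar>)"
          by (rule sum_abs)
        also have "\<dots> \<le> (\<Sum>i<N. (\<integral>y. (c + a * (q * ?D)) * t i y \<partial>Q \<xi>) + (\<integral>y. Gb (y + \<Phi> i) * t i y \<partial>Q \<xi>))"
        proof (rule sum_mono)
          fix i assume "i \<in> {..<N}"
          then have i: "i < N" by simp
          have ae: "AE y in Q \<xi>. \<bar>?g y * t i y - G' (y + \<Phi> i) * t i y\<bar> \<le> (c + a * (q * ?D)) * t i y + Gb (y + \<Phi> i) * t i y"
            using Q_\<E>[OF \<xi>(1)]
          proof eventually_elim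
            fix y assume y: "snoc \<xi> y \<in> \<E>"
            have yK: "y \<in> K" using \<E>_K[OF y, of 0] by simp
            show "\<bar>?g y * t i y - G' (y + \<Phi> i) * t i y\<bar> \<le> (c + a * (q * ?D)) * t i y + Gb (y + \<Phi> i) * t i y"
            proof (cases "t i y = 0")
              case False
              have "\<bar>?g y - G' (y + \<Phi> i)\<bar> \<le> (c + a * (q * ?D)) + Gb (y + \<Phi> i)"
              proof (cases "y + \<Phi> i \<in> B")
                case inB: True
                have y'K: "y + \<Phi> i \<in> K" using \<E>_K[of "snoc \<xi>' (y + \<Phi> i)" 0] inB by (simp add: B_def)
                let ?w = "(S (u, y), snoc \<xi> y)" and ?w' = "(S (u', y + \<Phi> i), snoc \<xi>' (y + \<Phi> i))"
                have w: "?w \<in> X \<times> \<E>" "?w' \<in> X \<times> \<E>" using S_X u yK y'K y inB by (auto simp: B_def)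
                have "norm (S (u', y + \<Phi> i) - S (u, y)) \<le> q0 * norm ?h"
                  unfolding \<Phi>_def using False True by (intro contr[OF i]) (auto simp: t_def \<delta>'_def)
                then have "A * norm (S (u, y) - S (u', y + \<Phi> i)) \<le> A * (q0 * norm ?h)"
                  using A1 by (intro mult_left_mono) (auto simp: norm_minus_commute)
                moreover have "past_dist \<iota> (snoc \<xi> y) (snoc \<xi>' (y + \<Phi> i)) = norm (\<Phi> i) + ?d / \<iota>"
                  by (subst past_dist_snoc[OF \<iota> \<E>_R[OF \<xi>(1)] \<E>_R[OF \<xi>(2)]]) simp
                ultimately have "mixed_dist A ?w ?w' \<le> A * (q0 * norm ?h) + CR * norm ?h + ?d / \<iota>"
                  using \<Phi>n[OF i] by (simp add: mixed_dist_def)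
                also have "\<dots> = (A * q0 + CR) * norm ?h + 1 / \<iota> * ?d" by (simp add: algebra_simps)
                also have "\<dots> \<le> (A * q) * norm ?h + q * ?d"
                proof (intro add_mono mult_right_mono d0 q)
                  have "A * ((1 + q0) / 2) \<le> A * q" using q A1 by (intro mult_left_mono) auto
                  then show "A * q0 + CR \<le> A * q" using Aq by linarith
                qed simp
                also have "\<dots> = q * ?D" by (simp add: D algebra_simps)
                finally have "mixed_dist A ?w ?w' \<le> q * ?D" .
                then have "c + a * mixed_dist A ?w ?w' \<le> c + a * (q * ?D)" using a by (simp add: mult_left_mono)
                then show ?thesis using close[OF w] inB by (simp add: G'_def Gb_def)
              next
                case notB: False
                \<comment> \<open>After an exit \<open>G'\<close> vanishes, and the trivial bound 1
                  for g is charged to \<open>Gb\<close>.\<close>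
                have "0 \<le> a * (q * ?D)" using a q D0 by simp
                then show ?thesis using notB g1(1)[of "(S (u, y), snoc \<xi> y)"] c by (simp add: G'_def Gb_def)
              qed
              then have "\<bar>?g y - G' (y + \<Phi> i)\<bar> * t i y \<le> ((c + a * (q * ?D)) + Gb (y + \<Phi> i)) * t i y"
                using t01(1) by (rule mult_right_mono)
              moreover have "\<bar>?g y * t i y - G' (y + \<Phi> i) * t i y\<bar> = \<bar>?g y - G' (y + \<Phi> i)\<bar> * t i y"
                using t01[of i y] by (simp only: left_diff_distrib[symmetric] abs_mult abs_of_nonneg)
              ultimately show ?thesis by (simp add: distrib_right)
            qed simp
          qed
          have "\<bar>(\<integral>y. ?g y * t i y \<partial>Q \<xi>) - (\<integral>y. G' (y + \<Phi> i) * t i y \<partial>Q \<xi>)\<bar> =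
             \<bar>\<integral>y. ?g y * t i y - G' (y + \<Phi> i) * t i y \<partial>Q \<xi>\<bar>"
            using ig[OF i] by (simp add: Bochner_Integration.integral_diff)
          also have "\<dots> \<le> (\<integral>y. \<bar>?g y * t i y - G' (y + \<Phi> i) * t i y\<bar> \<partial>Q \<xi>)" by (rule integral_abs_bound)
          also have "\<dots> \<le> (\<integral>y. (c + a * (q * ?D)) * t i y + Gb (y + \<Phi> i) * t i y \<partial>Q \<xi>)"
            using ig[OF i] ae by (intro integral_mono_AE) auto
          also have "\<dots> = (\<integral>y. (c + a * (q * ?D)) * t i y \<partial>Q \<xi>) + (\<integral>y. Gb (y + \<Phi> i) * t i y \<partial>Q \<xi>)"
            using ig[OF i] by (intro Bochner_Integration.integral_add) auto
          finally show "\<bar>(\<integral>y. ?g y * t i y \<partial>Q \<xi>) - (\<integral>y. G' (y + \<Phi> i) * t i y \<partial>Q \<xi>)\<bar> \<le>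
            (\<integral>y. (c + a * (q * ?D)) * t i y \<partial>Q \<xi>) + (\<integral>y. Gb (y + \<Phi> i) * t i y \<partial>Q \<xi>)" .
        qed
        also have "\<dots> = (\<integral>y. c + a * (q * ?D) \<partial>Q \<xi>) + (\<Sum>i<N. \<integral>y. Gb (y + \<Phi> i) * t i y \<partial>Q \<xi>)"
          by (subst split[of "\<lambda>_. c + a * (q * ?D)", OF _ order_refl]) (auto simp: sum.distrib)
        finally show ?thesis using Q.prob_space by simp
      qed
      have "\<bar>transition g z - transition g' z'\<bar> \<le> c + a * (q * ?D) + CT * ?D + CT * ?D"
        using main bad TV[OF G'm G'1] unfolding T1 by linarith
      also have "\<dots> = c + (a * q + 2 * CT) * ?D" by (simp add: algebra_simps)
      also have "\<dots> \<le> c + (a * q + C) * ?D"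
        using \<delta>' D0 by (intro add_left_mono mult_right_mono) (auto simp: C_def)
      finally show ?thesis .
    qed
  qed
  then show ?thesis by blast
qed

section \<open>Irreducibility\<close>

text \<open>Only \<open>a\<close> is confined to the compact set. This is stronger than uniform
  continuity on \<open>A\<close> and is needed because perturbed points leave it.\<close>

lemma compact_uniform_continuity_at:
  fixes f :: "'a::metric_space \<Rightarrow> 'b::metric_space"
  assumes f: "continuous_on UNIV f" and A: "compact A" and \<epsilon>: "\<epsilon> > 0"
  obtains \<delta> where "\<delta> > 0" "\<And>a b. a \<in> A \<Longrightarrow> dist a b < \<delta> \<Longrightarrow> dist (f a) (f b) < \<epsilon>"
proof -
  define G where "G = (\<lambda>a. f -` ball (f a) (\<epsilon> / 2)) ` A"
  have "A \<subseteq> \<Union>G" using \<epsilon> by (auto simp: G_def)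
  moreover have "open U" if "U \<in> G" for U
    using that f by (auto simp: G_def intro!: open_vimage)
  ultimately obtain e where e: "e > 0" "\<And>x. x \<in> A \<Longrightarrow> \<exists>U\<in>G. ball x e \<subseteq> U"
    using Heine_Borel_lemma[OF A, of G] by metis
  have "dist (f a) (f b) < \<epsilon>" if a: "a \<in> A" and b: "dist a b < e" for a b
  proof -
    obtain c where c: "ball a e \<subseteq> f -` ball (f c) (\<epsilon> / 2)" using e(2)[OF a] by (auto simp: G_def)
    have "dist (f c) (f a) < \<epsilon> / 2" "dist (f c) (f b) < \<epsilon> / 2" using subsetD[OF c, of a] subsetD[OF c, of b] b e(1) by auto
    then show ?thesis by (metis dist_commute dist_triangle_half_l)
  qed
  then show ?thesis using that e(1) by blast
qed

lemma trajectory_cong: "(\<And>i. 1 \<le> i \<Longrightarrow> i \<le> k \<Longrightarrow> y i = y' i) \<Longrightarrow> trajectory S u y k = trajectory S u y' k"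
  by (induction k) auto

lemma concat_past_cong: "(\<And>i. 1 \<le> i \<Longrightarrow> i \<le> k \<Longrightarrow> y i = y' i) \<Longrightarrow> concat_past \<xi> y k = concat_past \<xi> y' k"
  by (induction k) auto

lemma trajectory_add: "trajectory S u y (k + j) = trajectory S (trajectory S u y k) (\<lambda>i. y (k + i)) j"
  by (induction j) auto

lemma concat_past_nth: "i < k \<Longrightarrow> concat_past \<xi> y k i = y (k - i)"
proof (induction k arbitrary: i)
  case (Suc k)
  then show ?case by (cases i) auto
qed simp

context driven_system
begin

lemma U_kernel_measurable [measurable]: "U_kernel S Q \<in> borel \<rightarrow>\<^sub>M prob_algebra borel"
proof -
  have "(\<lambda>z. distr (Q (snd z)) borel (\<lambda>\<zeta>. (S (fst z, \<zeta>), snoc (snd z) \<zeta>))) \<in> borel \<rightarrow>\<^sub>M prob_algebra (borel :: ('h \<times> (nat \<Rightarrow> 'e)) measure)"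
  proof (rule measurable_distr_prob_space2[where M=borel])
    show "(\<lambda>z::'h \<times> (nat \<Rightarrow> 'e). Q (snd z)) \<in> borel \<rightarrow>\<^sub>M prob_algebra borel"
      by (rule measurable_compose[OF _ Q_measurable]) (intro borel_measurable_continuous_onI continuous_intros)
    have [measurable]: "(\<lambda>p. fst (fst p)) \<in> borel_measurable ((borel :: ('h \<times> (nat \<Rightarrow> 'e)) measure) \<Otimes>\<^sub>M (borel :: 'e measure))"
      "(\<lambda>p. snd (fst p)) \<in> borel_measurable ((borel :: ('h \<times> (nat \<Rightarrow> 'e)) measure) \<Otimes>\<^sub>M (borel :: 'e measure))"
      by (rule measurable_compose[OF measurable_fst], intro borel_measurable_continuous_onI continuous_intros)+
    show "(\<lambda>(z, \<zeta>). (S (fst z, \<zeta>), snoc (snd z) \<zeta>)) \<in> borel_measurable ((borel :: ('h \<times> (nat \<Rightarrow> 'e)) measure) \<Otimes>\<^sub>M borel)"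
      unfolding split_beta by (rule borel_measurable_Pair) measurable
  qed
  then show ?thesis by (simp add: U_kernel_def split_beta')
qed

lemma integral_U_kernel:
  assumes "g \<in> borel_measurable borel"
  shows "(\<integral>w. g w \<partial>U_kernel S Q z) = transition g z"
proof -
  have "(\<lambda>\<zeta>. (S (v, \<zeta>), snoc x \<zeta>)) \<in> borel_measurable (Q (snd z))" for v x
    by (rule borel_measurable_Pair) measurable
  then show ?thesis using assms by (simp add: U_kernel_def split_beta transition_def integral_distr)
qed

lemma transition_measurable [measurable]:
  assumes "g \<in> borel_measurable borel"
  shows "transition g \<in> borel_measurable borel"
proof -
  have "(\<lambda>z. \<integral>w. g w \<partial>U_kernel S Q z) \<in> borel_measurable borel"
    by (rule measurable_compose[OF measurable_prob_algebraD[OF U_kernel_measurable] integral_measurable_subprob_algebra[OF assms]])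
  then show ?thesis using integral_U_kernel[OF assms] by simp
qed

lemma iterate_measurable [measurable]:
  "g \<in> borel_measurable borel \<Longrightarrow> (transition ^^ k) g \<in> borel_measurable borel"
  by (induction k) auto

lemma iterate_bounded:
  "g \<in> borel_measurable borel \<Longrightarrow> (\<And>w. \<bar>g w\<bar> \<le> 1) \<Longrightarrow> \<bar>(transition ^^ k) g z\<bar> \<le> 1"
  by (induction k arbitrary: z) (auto intro!: transition_bounded)

lemma bounded_integrable_transition:
  fixes g :: "'h \<times> (nat \<Rightarrow> 'e) \<Rightarrow> real"
  assumes "g \<in> borel_measurable borel" "\<And>w. \<bar>g w\<bar> \<le> b"
  shows "integrable (Q x) (\<lambda>y. g (S (v, y), snoc x' y))"
  by (intro bounded_integrable_Q[where b=b] transition_integrand_measurable assms)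

lemma transition_bounded':
  assumes "g \<in> borel_measurable borel" "\<And>w. \<bar>g w\<bar> \<le> b" "0 < b"
  shows "\<bar>transition g z\<bar> \<le> b"
proof -
  have "\<bar>transition (\<lambda>w. g w / b) z\<bar> \<le> 1" by (rule transition_bounded) (use assms in \<open>auto simp: abs_divide\<close>)
  then show ?thesis using assms(3) by (simp add: transition_def abs_divide)
qed

lemma iterate_bounded':
  "g \<in> borel_measurable borel \<Longrightarrow> (\<And>w. \<bar>g w\<bar> \<le> b) \<Longrightarrow> 0 < b \<Longrightarrow> \<bar>(transition ^^ k) g z\<bar> \<le> b"
  by (induction k arbitrary: z) (auto intro!: transition_bounded')

lemma AE_next_in:
  assumes "v \<in> X" "\<xi> \<in> \<E>"
  shows "AE y in Q \<xi>. (S (v, y), snoc \<xi> y) \<in> X \<times> \<E>"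
  using Q_\<E>[OF assms(2)] Q_K[OF assms(2)] by eventually_elim (use assms S_X in auto)

lemma transition_mono:
  assumes [measurable]: "f \<in> borel_measurable borel" "g \<in> borel_measurable borel"
    and b: "\<And>w. \<bar>f w\<bar> \<le> b" "\<And>w. \<bar>g w\<bar> \<le> b"
    and le: "\<And>w. w \<in> X \<times> \<E> \<Longrightarrow> f w \<le> g w" and z: "z \<in> X \<times> \<E>"
  shows "transition f z \<le> transition g z"
  unfolding transition_def
proof (rule integral_mono_AE)
  show "AE y in Q (snd z). f (S (fst z, y), snoc (snd z) y) \<le> g (S (fst z, y), snoc (snd z) y)"
  proof -
    have "AE y in Q (snd z). (S (fst z, y), snoc (snd z) y) \<in> X \<times> \<E>"
      by (rule AE_next_in) (use z in auto)
    then show ?thesis by eventually_elim (rule le)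
  qed
qed (use b in \<open>auto intro!: bounded_integrable_transition\<close>)

lemma iterate_mono:
  assumes "f \<in> borel_measurable borel" "g \<in> borel_measurable borel"
    and "\<And>w. \<bar>f w\<bar> \<le> b" "\<And>w. \<bar>g w\<bar> \<le> b" "0 < b"
    and "\<And>w. w \<in> X \<times> \<E> \<Longrightarrow> f w \<le> g w"
  shows "z \<in> X \<times> \<E> \<Longrightarrow> (transition ^^ k) f z \<le> (transition ^^ k) g z"
proof (induction k arbitrary: z)
  case (Suc k)
  then show ?case
    by (auto intro!: transition_mono[where b=b] iterate_measurable iterate_bounded' assms)
qed (use assms in auto)

lemma transition_affine:
  assumes [measurable]: "f \<in> borel_measurable borel" and b: "\<And>w. \<bar>f w\<bar> \<le> b"
  shows "transition (\<lambda>w. \<alpha> + \<beta> * f w) z = \<alpha> + \<beta> * transition f z"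
proof -
  interpret Q: prob_space "Q (snd z)" by (rule prob_Q)
  show ?thesis unfolding transition_def
    using bounded_integrable_transition[OF assms] Q.prob_space by (subst Bochner_Integration.integral_add) auto
qed

lemma iterate_affine:
  assumes "f \<in> borel_measurable borel" and "\<And>w. \<bar>f w\<bar> \<le> 1"
  shows "(transition ^^ k) (\<lambda>w. \<alpha> + \<beta> * f w) = (\<lambda>z. \<alpha> + \<beta> * (transition ^^ k) f z)"
proof (induction k)
  case (Suc k)
  then have "(transition ^^ Suc k) (\<lambda>w. \<alpha> + \<beta> * f w) = transition (\<lambda>z. \<alpha> + \<beta> * (transition ^^ k) f z)"
    by simp
  also have "\<dots> = (\<lambda>z. \<alpha> + \<beta> * transition ((transition ^^ k) f) z)"
    using transition_affine[OF iterate_measurable[OF assms(1)] iterate_bounded[OF assms]] by (rule ext)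
  finally show ?case by simp
qed simp

text \<open>At each time the unperturbed states form a compact set, a continuous image of
  \<open>X\<close>, and \<open>S\<close> is uniformly continuous around that set paired with noise
  0; this makes \<open>\<delta>\<close> independent of u.\<close>

lemma noise_small_trajectory:
  assumes "\<epsilon> > 0"
  shows "\<exists>\<delta>>0. \<forall>u\<in>X. \<forall>y. (\<forall>i\<in>{1..n}. norm (y i) < \<delta>) \<longrightarrow> dist (trajectory S u (\<lambda>_. 0) n) (trajectory S u y n) < \<epsilon>"
  using assms
proof (induction n arbitrary: \<epsilon>)
  case (Suc n)
  have cont: "continuous_on UNIV (\<lambda>u. trajectory S u (\<lambda>_. 0) n)"
  proof (induction n)
    case (Suc n)
    then show ?case
      using continuous_on_compose2[OF S_continuous continuous_on_Pair[OF Suc continuous_on_const]] by simp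
  qed (auto intro: continuous_intros)
  define A where "A = (\<lambda>u. trajectory S u (\<lambda>_. 0) n) ` X \<times> {0::'e}"
  have "compact A" unfolding A_def
    by (intro compact_Times compact_continuous_image compact_X continuous_on_subset[OF cont]) auto
  then obtain \<delta> where \<delta>: "\<delta> > 0" "\<And>a b. a \<in> A \<Longrightarrow> dist a b < \<delta> \<Longrightarrow> dist (S a) (S b) < \<epsilon>"
    using compact_uniform_continuity_at[OF S_continuous _ Suc.prems] by metis
  obtain \<delta>1 where \<delta>1: "\<delta>1 > 0" "\<forall>u\<in>X. \<forall>y. (\<forall>i\<in>{1..n}. norm (y i) < \<delta>1) \<longrightarrow>
      dist (trajectory S u (\<lambda>_. 0) n) (trajectory S u y n) < \<delta> / 2"
    using Suc.IH[of "\<delta> / 2"] \<delta>(1) by auto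
  show ?case
  proof (intro exI[of _ "min \<delta>1 (\<delta> / 2)"] conjI ballI allI impI)
    show "0 < min \<delta>1 (\<delta> / 2)" using \<delta> \<delta>1 by simp
    fix u and y :: "nat \<Rightarrow> 'e" assume u: "u \<in> X" and y: "\<forall>i\<in>{1..Suc n}. norm (y i) < min \<delta>1 (\<delta> / 2)"
    have "dist (trajectory S u (\<lambda>_. 0) n) (trajectory S u y n) < \<delta> / 2" using \<delta>1(2) u y by simp
    moreover have "norm (y (Suc n)) < \<delta> / 2" using y by simp
    ultimately have "dist (trajectory S u (\<lambda>_. 0) n, 0) (trajectory S u y n, y (Suc n)) < \<delta>"
      using norm_Pair_le[of "trajectory S u (\<lambda>_. 0) n - trajectory S u y n" "0 - y (Suc n)"]
      by (simp add: dist_norm)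
    then show "dist (trajectory S u (\<lambda>_. 0) (Suc n)) (trajectory S u y (Suc n)) < \<epsilon>"
      using \<delta>(2) u by (simp add: A_def)
  qed
qed (auto intro!: exI[of _ 1])

text \<open>The number of steps is a multiple of the period in (GD), large enough for the
  contraction. The lower bound \<open>m\<close> lets the small noise also fill the recent
  past.\<close>

lemma reach_zero:
  assumes \<epsilon>: "\<epsilon> > 0"
  obtains n \<delta> where "n \<ge> m" "n \<ge> 1" "\<delta> > 0"
    "\<And>u y. u \<in> X \<Longrightarrow> (\<And>i. i \<in> {1..n} \<Longrightarrow> norm (y i) < \<delta>) \<Longrightarrow> norm (trajectory S u y n) < \<epsilon>"
proof -
  obtain k a where k: "k \<ge> 1" "0 < a" "a < 1" "\<And>u. norm (trajectory S u (\<lambda>_. 0) k) \<le> a * norm u"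
    using GD unfolding hyp_GD_def by blast
  obtain RX where RX: "RX > 0" "\<And>u. u \<in> X \<Longrightarrow> norm u \<le> RX"
    using compact_imp_bounded[OF compact_X] bounded_pos by metis
  have it: "norm (trajectory S u (\<lambda>_. 0) (k * j)) \<le> a ^ j * norm u" for u j
  proof (induction j)
    case (Suc j)
    have "trajectory S u (\<lambda>_. 0) (k * Suc j) = trajectory S (trajectory S u (\<lambda>_. 0) (k * j)) (\<lambda>_. 0) k"
      using trajectory_add[of S u "\<lambda>_. 0" "k * j" k] by (simp add: add.commute)
    then have "norm (trajectory S u (\<lambda>_. 0) (k * Suc j)) \<le> a * norm (trajectory S u (\<lambda>_. 0) (k * j))"
      using k(4) by simp
    also have "\<dots> \<le> a * (a ^ j * norm u)" using Suc k by (intro mult_left_mono) auto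
    finally show ?case by simp
  qed simp
  have "(\<lambda>j. a ^ j * RX) \<longlonglongrightarrow> 0 * RX" using k by (intro tendsto_mult_right LIMSEQ_power_zero) auto
  then have "\<forall>\<^sub>F j in sequentially. a ^ j * RX < \<epsilon> / 2" using \<epsilon> by (intro order_tendstoD) auto
  moreover have "\<forall>\<^sub>F j in sequentially. j \<ge> max m 1" by (rule eventually_ge_at_top)
  ultimately have "\<forall>\<^sub>F j in sequentially. a ^ j * RX < \<epsilon> / 2 \<and> j \<ge> max m 1" by eventually_elim auto
  then obtain j where j: "a ^ j * RX < \<epsilon> / 2" "j \<ge> max m 1"
    using eventually_happens sequentially_bot by blast
  obtain \<delta> where \<delta>: "\<delta> > 0" "\<And>u y. u \<in> X \<Longrightarrow> (\<forall>i\<in>{1..k * j}. norm (y i) < \<delta>) \<Longrightarrow>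
      dist (trajectory S u (\<lambda>_. 0) (k * j)) (trajectory S u y (k * j)) < \<epsilon> / 2"
    using noise_small_trajectory[of "\<epsilon> / 2" "k * j"] \<epsilon> by auto
  have kj: "k * j \<ge> j" using k(1) by simp
  show ?thesis
  proof (rule that[of "k * j" \<delta>])
    fix u and y :: "nat \<Rightarrow> 'e" assume u: "u \<in> X" and y: "\<And>i. i \<in> {1..k * j} \<Longrightarrow> norm (y i) < \<delta>"
    have "norm (trajectory S u (\<lambda>_. 0) (k * j)) \<le> a ^ j * RX"
    proof (rule order_trans[OF it])
      show "a ^ j * norm u \<le> a ^ j * RX" using RX(2)[OF u] k(2) by (intro mult_left_mono) auto
    qed
    moreover have "dist (trajectory S u (\<lambda>_. 0) (k * j)) (trajectory S u y (k * j)) < \<epsilon> / 2"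
      using \<delta>(2)[OF u] y by blast
    ultimately show "norm (trajectory S u y (k * j)) < \<epsilon>"
      using j(1) norm_triangle_sub[of "trajectory S u y (k * j)" "trajectory S u (\<lambda>_. 0) (k * j)"]
      by (simp add: dist_norm norm_minus_commute)
  qed (use kj j(2) \<delta>(1) in \<open>linarith+\<close>)
qed

section \<open>Joint laws of successive noise values\<close>

abbreviation noise_space :: "nat \<Rightarrow> (nat \<Rightarrow> 'e) measure" where
  "noise_space k \<equiv> Pi\<^sub>M {1..k} (\<lambda>_. borel)"

abbreviation noise_step :: "(nat \<Rightarrow> 'e) \<Rightarrow> nat \<Rightarrow> (nat \<Rightarrow> 'e) \<Rightarrow> (nat \<Rightarrow> 'e) measure" where
  "noise_step \<xi> k \<equiv> \<lambda>y. distr (Q (concat_past \<xi> y k)) (noise_space (Suc k)) (\<lambda>z. y(Suc k := z))"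

lemma concat_past_measurable:
  "l \<le> k \<Longrightarrow> (\<lambda>y. concat_past \<xi> y l) \<in> borel_measurable (noise_space k)"
proof (induction l)
  case (Suc l)
  have "(\<lambda>y. y (Suc l)) \<in> borel_measurable (noise_space k)"
    using Suc.prems by (intro measurable_component_singleton) auto
  then show ?case using Suc by (auto intro!: snoc_measurable)
qed simp

lemma trajectory_measurable:
  "l \<le> k \<Longrightarrow> (\<lambda>y. trajectory S u y l) \<in> borel_measurable (noise_space k)"
proof (induction l)
  case (Suc l)
  have "(\<lambda>y. y (Suc l)) \<in> borel_measurable (noise_space k)"
    using Suc.prems by (intro measurable_component_singleton) auto
  then show ?case using Suc by (auto intro!: S_Pair_measurable)
qed simp

lemma extend_measurable:
  "(\<lambda>(y, z). y(Suc k := z)) \<in> noise_space k \<Otimes>\<^sub>M borel \<rightarrow>\<^sub>M noise_space (Suc k)"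
  using measurable_add_dim[of "Suc k" "{1..k}" "\<lambda>_. borel :: 'e measure"]
  by (simp add: atLeastAtMostSuc_conv)

lemma Q_joint_step_measurable:
  "noise_step \<xi> k \<in>
     noise_space k \<rightarrow>\<^sub>M prob_algebra (noise_space (Suc k))"
  by (rule measurable_distr_prob_space2[OF measurable_compose[OF concat_past_measurable[OF order_refl] Q_measurable] extend_measurable])

lemma Q_joint_in_prob_algebra: "Q_joint Q k \<xi> \<in> space (prob_algebra (noise_space k))"
proof (induction k)
  case 0
  show ?case by (auto simp: space_prob_algebra space_PiM intro!: prob_space_return)
next
  case (Suc k)
  then show ?case
    using sets_bind'[OF Suc Q_joint_step_measurable] prob_space_bind'[OF Suc Q_joint_step_measurable]
    by (simp add: space_prob_algebra)
qed

lemma sets_Q_joint: "sets (Q_joint Q k \<xi>) = sets (noise_space k)"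
  and prob_Q_joint: "prob_space (Q_joint Q k \<xi>)"
  using Q_joint_in_prob_algebra[of k \<xi>] by (auto simp: space_prob_algebra)

lemma Q_joint_step_measurable':
  "noise_step \<xi> k \<in>
     Q_joint Q k \<xi> \<rightarrow>\<^sub>M subprob_algebra (noise_space (Suc k))"
  using measurable_prob_algebraD[OF Q_joint_step_measurable] measurable_cong_sets[OF sets_Q_joint refl] by blast

lemma extend_measurable1:
  assumes "y \<in> space (noise_space k)"
  shows "(\<lambda>z. y(Suc k := z)) \<in> borel \<rightarrow>\<^sub>M noise_space (Suc k)"
  using measurable_compose[OF measurable_Pair1'[OF assms] extend_measurable] by simp

lemma extend_measurable_Q:
  assumes "y \<in> space (Q_joint Q k \<xi>)"
  shows "(\<lambda>z. y(Suc k := z)) \<in> Q x \<rightarrow>\<^sub>M noise_space (Suc k)"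
proof -
  have "y \<in> space (noise_space k)" using assms sets_eq_imp_space_eq[OF sets_Q_joint] by blast
  then show ?thesis using extend_measurable1 measurable_cong_sets[OF sets_Q refl] by blast
qed

lemma AE_Q_joint:
  assumes \<xi>: "\<xi> \<in> \<E>"
  shows "AE y in Q_joint Q k \<xi>. \<forall>j\<le>k. concat_past \<xi> y j \<in> \<E>"
proof (induction k)
  case 0
  show ?case using \<xi> by simp
next
  case (Suc k)
  have m: "Measurable.pred (noise_space (Suc k)) (\<lambda>y. \<forall>j\<le>Suc k. concat_past \<xi> y j \<in> \<E>)"
  proof -
    have "Measurable.pred (noise_space (Suc k)) (\<lambda>y. \<forall>j\<in>{..Suc k}. concat_past \<xi> y j \<in> \<E>)"
    proof (rule pred_intros_finite(3))
      fix j assume "j \<in> {..Suc k}"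
      then have "(\<lambda>y. concat_past \<xi> y j) \<in> borel_measurable (noise_space (Suc k))"
        by (intro concat_past_measurable) simp
      then show "Measurable.pred (noise_space (Suc k)) (\<lambda>y. concat_past \<xi> y j \<in> \<E>)"
        by (rule pred_sets2[rotated]) (use closed_\<E> in auto)
    qed simp
    then show ?thesis by (simp only: Ball_def atMost_iff)
  qed
  show ?case
    unfolding Q_joint.simps
  proof (subst AE_bind[OF Q_joint_step_measurable' m], use AE_space Suc in eventually_elim)
    fix y assume ysp: "y \<in> space (Q_joint Q k \<xi>)" and y: "\<forall>j\<le>k. concat_past \<xi> y j \<in> \<E>"
    have ae: "AE z in Q (concat_past \<xi> y k). \<forall>j\<le>Suc k. concat_past \<xi> (y(Suc k := z)) j \<in> \<E>"
      using Q_\<E>[OF y[rule_format, OF order_refl]]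
    proof eventually_elim
      fix z assume z: "snoc (concat_past \<xi> y k) z \<in> \<E>"
      have "concat_past \<xi> (y(Suc k := z)) j = concat_past \<xi> y j" if "j \<le> k" for j
        using that by (intro concat_past_cong) auto
      then show "\<forall>j\<le>Suc k. concat_past \<xi> (y(Suc k := z)) j \<in> \<E>"
        using y z by (auto simp: le_Suc_eq)
    qed
    show "AE y in noise_step \<xi> k y. \<forall>j\<le>Suc k. concat_past \<xi> y j \<in> \<E>"
      by (subst AE_distr_iff[OF extend_measurable_Q[OF ysp] m[unfolded pred_def]]) (rule ae)
  qed
qed

text \<open>Links (SRZ), which concerns joint laws of the noise, with the iterates of the Markov
  operator. The induction splits off the last step, as the recursion of \<open>Q_joint\<close>
  does.\<close>

lemma iterate_eq_Q_joint:
  assumes "f \<in> borel_measurable borel" "\<And>w. \<bar>f w\<bar> \<le> 1"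
  shows "(transition ^^ k) f (u, \<xi>) = (\<integral>y. f (trajectory S u y k, concat_past \<xi> y k) \<partial>Q_joint Q k \<xi>)"
  using assms
proof (induction k arbitrary: f)
  case 0
  interpret J: prob_space "Q_joint Q 0 \<xi>" by (rule prob_Q_joint)
  show ?case using J.prob_space by (simp del: Q_joint.simps)
next
  case (Suc k)
  interpret J: prob_space "Q_joint Q k \<xi>" by (rule prob_Q_joint)
  have fm: "(\<lambda>y. f (trajectory S u y (Suc k), concat_past \<xi> y (Suc k))) \<in> borel_measurable (noise_space (Suc k))"
    by (rule measurable_compose[OF borel_measurable_Pair[OF trajectory_measurable[OF order_refl]
            concat_past_measurable[OF order_refl]] Suc.prems(1)])
  have "(transition ^^ Suc k) f (u, \<xi>) = (transition ^^ k) (transition f) (u, \<xi>)"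
    by (simp only: funpow_Suc_right comp_def)
  also have "\<dots> = (\<integral>y. transition f (trajectory S u y k, concat_past \<xi> y k) \<partial>Q_joint Q k \<xi>)"
    by (rule Suc.IH[OF transition_measurable[OF Suc.prems(1)] transition_bounded[OF Suc.prems]])
  also have "\<dots> = (\<integral>y. (\<integral>y'. f (trajectory S u y' (Suc k), concat_past \<xi> y' (Suc k))
       \<partial>noise_step \<xi> k y) \<partial>Q_joint Q k \<xi>)"
  proof (rule Bochner_Integration.integral_cong[OF refl])
    fix y assume ysp: "y \<in> space (Q_joint Q k \<xi>)"
    have e: "trajectory S u (y(Suc k := z)) k = trajectory S u y k" "concat_past \<xi> (y(Suc k := z)) k = concat_past \<xi> y k" for z
      by (auto intro!: trajectory_cong concat_past_cong)
    show "transition f (trajectory S u y k, concat_past \<xi> y k) = (\<integral>y'. f (trajectory S u y' (Suc k), concat_past \<xi> y' (Suc k))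
       \<partial>noise_step \<xi> k y)"
      by (subst integral_distr[OF extend_measurable_Q[OF ysp] fm]) (simp add: transition_def e)
  qed
  also have "\<dots> = (\<integral>y. f (trajectory S u y (Suc k), concat_past \<xi> y (Suc k)) \<partial>Q_joint Q (Suc k) \<xi>)"
    unfolding Q_joint.simps
  proof (rule integral_bind[symmetric, where K = "noise_space (Suc k)" and B = 1 and B' = 1])
    show "AE y in Q_joint Q k \<xi>. emeasure (noise_step \<xi> k y)
        (space (noise_step \<xi> k y)) \<le> ennreal 1"
    proof (rule AE_I2)
      fix y assume "y \<in> space (Q_joint Q k \<xi>)"
      from prob_space.prob_space_distr[OF prob_Q extend_measurable_Q[OF this]]
      interpret D: prob_space "noise_step \<xi> k y" .
      show "emeasure (noise_step \<xi> k y)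
        (space (noise_step \<xi> k y)) \<le> ennreal 1"
        using D.emeasure_space_1 by simp
    qed
    show "finite_measure (Q_joint Q k \<xi>)" by (rule J.finite_measure_axioms)
  qed (rule fm Suc.prems(2) Q_joint_step_measurable')+
  finally show ?case .
qed

text \<open>(SRZ) grants small noise only after a delay \<open>s\<close>. Since \<open>X\<close> is
  invariant, whatever happens during the delay leaves the state in \<open>X\<close>, from where n
  small steps lead close to 0. The target is described by its diameter, so that no centre in
  \<open>X \<times> \<E>\<close> has to be exhibited.\<close>

lemma irreducible:
  assumes \<epsilon>: "\<epsilon> > 0" and A: "A \<ge> 1"
  obtains T p B where "p > 0" "B \<in> sets borel" "B \<subseteq> X \<times> \<E>"
    "\<And>w w'. w \<in> B \<Longrightarrow> w' \<in> B \<Longrightarrow> mixed_dist A w w' \<le> \<epsilon>"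
    "\<And>z. z \<in> X \<times> \<E> \<Longrightarrow> p \<le> (transition ^^ T) (indicator B) z"
proof -
  define c where "c = \<iota> / (\<iota> - 1)"
  have c: "c > 0" using \<iota> by (simp add: c_def)
  \<comment> \<open>States and recent noise of norm below \<open>\<eta>\<close> contribute at most
    \<open>2 * \<eta> * (A + c) = 2 * \<epsilon> / 3\<close>; the remaining third is for the tail of
    the pasts.\<close>
  define \<eta> where "\<eta> = \<epsilon> / (3 * (A + c))"
  have \<eta>: "\<eta> > 0" using \<epsilon> A c by (simp add: \<eta>_def)
  have "(\<lambda>m. 2 * R\<^sub>K * c * (1 / \<iota>) ^ m) \<longlonglongrightarrow> 2 * R\<^sub>K * c * 0"
    using \<iota> by (intro tendsto_mult_left LIMSEQ_power_zero) auto
  then have "\<forall>\<^sub>F m in sequentially. 2 * R\<^sub>K * c * (1 / \<iota>) ^ m < \<epsilon> / 3"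
    using \<epsilon> by (intro order_tendstoD) auto
  then obtain m where m: "\<And>n. n \<ge> m \<Longrightarrow> 2 * R\<^sub>K * c * (1 / \<iota>) ^ n < \<epsilon> / 3"
    unfolding eventually_sequentially by blast
  obtain n \<delta> where n: "n \<ge> m" "n \<ge> 1" "\<delta> > 0" and
    reach: "\<And>u y. u \<in> X \<Longrightarrow> (\<And>i. i \<in> {1..n} \<Longrightarrow> norm (y i) < \<delta>) \<Longrightarrow> norm (trajectory S u y n) < \<eta>"
    using reach_zero[OF \<eta>, of m] by metis
  \<comment> \<open>The noise has to be small twice: below \<open>\<delta>\<close> to steer the
    trajectory, below \<open>\<eta>\<close> as an entry of the new past.\<close>
  define \<delta>' where "\<delta>' = min \<delta> \<eta>"
  have \<delta>': "\<delta>' > 0" using n \<eta> by (simp add: \<delta>'_def)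
  obtain s where s: "(INF \<xi>\<in>\<E>. measure (Q_last Q s n \<xi>) (Pi\<^sub>E {1..n} (\<lambda>_. ball 0 \<delta>'))) > 0"
    using SRZ n(2) \<delta>' unfolding hyp_SRZ_def by blast
  define p where "p = (INF \<xi>\<in>\<E>. measure (Q_last Q s n \<xi>) (Pi\<^sub>E {1..n} (\<lambda>_. ball 0 \<delta>')))"
  have p: "p \<le> measure (Q_last Q s n \<xi>) (Pi\<^sub>E {1..n} (\<lambda>_. ball 0 \<delta>'))" if "\<xi> \<in> \<E>" for \<xi>
    unfolding p_def by (rule cINF_lower[OF bdd_belowI2[where m=0] that]) auto
  define B where "B = (X \<inter> ball 0 \<eta>) \<times> (\<E> \<inter> (\<Inter>i<n. (\<lambda>\<xi>. \<xi> i) -` ball 0 \<eta>))"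
  have Bm: "B \<in> sets borel"
  proof -
    have "X \<inter> ball 0 \<eta> \<in> sets borel" using compact_imp_closed[OF compact_X] by auto
    moreover have "\<E> \<inter> (\<Inter>i<n. (\<lambda>\<xi>. \<xi> i) -` ball 0 \<eta>) \<in> sets borel"
    proof -
      have "open (\<Inter>i<n. (\<lambda>\<xi>::nat \<Rightarrow> 'e. \<xi> i) -` ball 0 \<eta>)"
        by (intro open_INT ballI open_vimage continuous_on_product_coordinates) auto
      then show ?thesis using closed_\<E> by auto
    qed
    ultimately show ?thesis unfolding B_def borel_prod[symmetric] by (rule pair_measureI)
  qed
  show ?thesis
  proof (rule that[of p B "s + n"])
    show "p > 0" using s by (simp add: p_def)
    show "B \<in> sets borel" by (rule Bm)
    show "B \<subseteq> X \<times> \<E>" by (auto simp: B_def)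
    show "mixed_dist A w w' \<le> \<epsilon>" if w: "w \<in> B" "w' \<in> B" for w w'
    proof -
      obtain v \<xi> v' \<xi>' where [simp]: "w = (v, \<xi>)" "w' = (v', \<xi>')" by fastforce
      have v: "norm v < \<eta>" "norm v' < \<eta>" and E: "\<xi> \<in> \<E>" "\<xi>' \<in> \<E>"
        using w by (auto simp: B_def)
      have small: "norm (\<xi> i) < \<eta>" "norm (\<xi>' i) < \<eta>" if "i < n" for i
        using w that by (auto simp: B_def)
      have "norm (v - v') \<le> 2 * \<eta>" using v norm_triangle_ineq4[of v v'] by linarith
      then have "A * norm (v - v') \<le> A * (2 * \<eta>)" using A by (intro mult_left_mono) auto
      moreover have "past_dist \<iota> \<xi> \<xi>' \<le> (2 * \<eta> + 2 * R\<^sub>K / \<iota> ^ n) * c"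
        unfolding c_def
      proof (rule past_dist_le[OF \<iota> \<E>_R[OF E(1)] \<E>_R[OF E(2)]])
        show "norm (\<xi> i - \<xi>' i) \<le> 2 * \<eta>" if "i < n" for i
          using small[OF that] norm_triangle_ineq4[of "\<xi> i" "\<xi>' i"] by linarith
      qed (use \<eta> in simp)
      moreover have "2 * R\<^sub>K / \<iota> ^ n * c < \<epsilon> / 3" using m[OF n(1)] by (simp add: power_divide mult.commute mult.left_commute)
      moreover have "A * (2 * \<eta>) + 2 * \<eta> * c = 2 * \<epsilon> / 3"
      proof -
        have "A * (2 * \<eta>) + 2 * \<eta> * c = 2 * (\<eta> * (A + c))" by (simp add: algebra_simps)
        also have "\<eta> * (A + c) = \<epsilon> / 3" using A c by (simp add: \<eta>_def field_simps)
        finally show ?thesis by simp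
      qed
      ultimately show ?thesis by (simp add: mixed_dist_def distrib_right)
    qed
    show "p \<le> (transition ^^ (s + n)) (indicator B) z" if zXE: "z \<in> X \<times> \<E>" for z
    proof -
      obtain u \<xi> where z: "z = (u, \<xi>)" "u \<in> X" "\<xi> \<in> \<E>" using zXE by auto
      let ?J = "Q_joint Q (s + n) \<xi>"
      interpret J: prob_space ?J by (rule prob_Q_joint)
      have spJ: "space ?J = space (noise_space (s + n))" using sets_eq_imp_space_eq[OF sets_Q_joint] by blast
      have lastm: "(\<lambda>y. \<lambda>i\<in>{1..n}. y (s + i)) \<in> noise_space (s + n) \<rightarrow>\<^sub>M noise_space n"
        by (intro measurable_restrict measurable_component_singleton) auto
      define D where "D = (\<lambda>y. \<lambda>i\<in>{1..n}. y (s + i)) -` (Pi\<^sub>E {1..n} (\<lambda>_. ball 0 \<delta>')) \<inter> space ?J"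
      have ballm: "Pi\<^sub>E {1..n} (\<lambda>_. ball (0::'e) \<delta>') \<in> sets (noise_space n)"
        by (intro sets_PiM_I_finite) auto
      have lastm': "(\<lambda>y. \<lambda>i\<in>{1..n}. y (s + i)) \<in> ?J \<rightarrow>\<^sub>M noise_space n"
        using lastm measurable_cong_sets[OF sets_Q_joint refl] by blast
      have Dm: "D \<in> sets ?J" unfolding D_def by (rule measurable_sets[OF lastm' ballm])
      have "p \<le> measure ?J D"
        using p[OF z(3)] unfolding Q_last_def measure_distr[OF lastm' ballm] D_def .
      also have "measure ?J D = (\<integral>y. indicator D y \<partial>?J)" using sets.sets_into_space[OF Dm] by (simp add: Int_absorb2)
      also have "\<dots> \<le> (\<integral>y. indicator B (trajectory S u y (s + n), concat_past \<xi> y (s + n)) \<partial>?J)"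
      proof (rule integral_mono_AE)
        show "integrable ?J (indicator D :: _ \<Rightarrow> real)" using Dm by (auto simp: less_top[symmetric])
        have "(\<lambda>y. indicator B (trajectory S u y (s + n), concat_past \<xi> y (s + n)) :: real) \<in> borel_measurable (noise_space (s + n))"
          by (rule measurable_compose[OF borel_measurable_Pair[OF trajectory_measurable concat_past_measurable]]) (use Bm in auto)
        then have "(\<lambda>y. indicator B (trajectory S u y (s + n), concat_past \<xi> y (s + n)) :: real) \<in> borel_measurable ?J"
          using measurable_cong_sets[OF sets_Q_joint refl] by blast
        then show "integrable ?J (\<lambda>y. indicator B (trajectory S u y (s + n), concat_past \<xi> y (s + n)) :: real)"
          by (rule J.integrable_const_bound[where B=1, rotated]) (auto simp: indicator_def)
        show "AE y in ?J. indicator D y \<le> (indicator B (trajectory S u y (s + n), concat_past \<xi> y (s + n)) :: real)"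
          using AE_Q_joint[OF z(3), of "s + n"]
        proof eventually_elim
          fix y assume y: "\<forall>j\<le>s + n. concat_past \<xi> y j \<in> \<E>"
          have yK: "y (Suc j) \<in> K" if "j < s + n" for j
            using y[rule_format, of "Suc j"] \<E>_K[of "concat_past \<xi> y (Suc j)" 0] that by simp
          have trX: "trajectory S u y j \<in> X" if "j \<le> s + n" for j
            using that
          proof (induction j)
            case (Suc j)
            then show ?case using yK[of j] S_X by auto
          qed (use z in simp)
          have "(trajectory S u y (s + n), concat_past \<xi> y (s + n)) \<in> B" if "y \<in> D"
          proof -
            have small: "norm (y (s + i)) < \<delta>'" if "i \<in> {1..n}" for i
              using \<open>y \<in> D\<close> that by (auto simp: D_def PiE_iff)
            \<comment> \<open>The trajectory is restarted at time s from a state of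
              \<open>X\<close>; \<open>reach\<close> is uniform over \<open>X\<close>.\<close>
            have "norm (trajectory S (trajectory S u y s) (\<lambda>i. y (s + i)) n) < \<eta>"
              using small by (intro reach trX) (auto simp: \<delta>'_def)
            moreover have "norm (concat_past \<xi> y (s + n) i) < \<eta>" if "i < n" for i
              using small[of "n - i"] that by (simp add: concat_past_nth \<delta>'_def)
            ultimately show ?thesis using trX[of "s + n"] y by (simp add: B_def trajectory_add)
          qed
          then show "indicator D y \<le> (indicator B (trajectory S u y (s + n), concat_past \<xi> y (s + n)) :: real)"
            by (simp add: indicator_def)
        qed
      qed
      also have "\<dots> = (transition ^^ (s + n)) (indicator B) z"
        unfolding z(1) using Bm by (intro iterate_eq_Q_joint[symmetric]) (auto simp: indicator_def)
      finally show ?thesis .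
    qed
  qed
qed

end

section \<open>Mixing\<close>

context driven_system
begin

text \<open>A Doeblin argument by comparison functions. On \<open>B\<close> the function h differs
  from \<open>h w0\<close> by at most e, elsewhere it lies between m and M; the corresponding affine
  functions of the indicator of \<open>B\<close> enclose h, and both starting states put at least
  mass p on \<open>B\<close>.\<close>

lemma oscillation_step:
  assumes h: "h \<in> borel_measurable borel" "\<And>w. \<bar>h w\<bar> \<le> 1"
    and B: "B \<in> sets borel" "w0 \<in> B" "B \<subseteq> X \<times> \<E>"
    and p: "0 \<le> p" "p \<le> 1" "p \<le> (transition ^^ T) (indicator B) z" "p \<le> (transition ^^ T) (indicator B) z'"
    and z: "z \<in> X \<times> \<E>" "z' \<in> X \<times> \<E>"
    and \<Delta>: "\<And>w w'. w \<in> X \<times> \<E> \<Longrightarrow> w' \<in> X \<times> \<E> \<Longrightarrow> \<bar>h w - h w'\<bar> \<le> \<Delta>"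
    and e: "\<And>w w'. w \<in> B \<Longrightarrow> w' \<in> B \<Longrightarrow> \<bar>h w - h w'\<bar> \<le> e"
  shows "(transition ^^ T) h z - (transition ^^ T) h z' \<le> (1 - p) * \<Delta> + 2 * p * e"
proof -
  let ?I = "indicator B :: 'h \<times> (nat \<Rightarrow> 'e) \<Rightarrow> real"
  have I: "?I \<in> borel_measurable borel" "\<And>w. \<bar>?I w\<bar> \<le> 1" using B(1) by (auto simp: indicator_def)
  have h1: "-1 \<le> h w" "h w \<le> 1" for w using h(2)[of w] by (simp_all add: abs_le_iff)
  define M where "M = (SUP w\<in>X \<times> \<E>. h w)"
  define m where "m = (INF w\<in>X \<times> \<E>. h w)"
  have hM: "h w \<le> M" if "w \<in> X \<times> \<E>" for w
    unfolding M_def by (rule cSUP_upper[OF that bdd_aboveI2[of _ _ 1]]) (rule h1)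
  have hm: "m \<le> h w" if "w \<in> X \<times> \<E>" for w
    unfolding m_def by (rule cINF_lower[OF bdd_belowI2[of _ "-1"] that]) (rule h1)
  have ne: "X \<times> \<E> \<noteq> {}" using z by auto
  have "M \<le> \<Delta> + h w" if "w \<in> X \<times> \<E>" for w
    unfolding M_def by (rule cSUP_least[OF ne]) (use \<Delta>[OF _ that] in \<open>fastforce simp: abs_le_iff\<close>)
  then have "M - \<Delta> \<le> m"
    unfolding m_def by (intro cINF_greatest[OF ne]) (simp add: algebra_simps)
  then have Mm: "M - m \<le> \<Delta>" by simp
  have iter: "(transition ^^ T) (\<lambda>w. \<alpha> + \<beta> * ?I w) v = \<alpha> + \<beta> * (transition ^^ T) ?I v" for \<alpha> \<beta> v
    using iterate_affine[OF I] by metis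
  have bound: "\<bar>\<alpha> + \<beta> * ?I w\<bar> \<le> 1 + \<bar>\<alpha>\<bar> + \<bar>\<beta>\<bar>" for \<alpha> \<beta> w by (auto simp: indicator_def)
  have hb: "\<bar>h w\<bar> \<le> 1 + \<bar>\<alpha>\<bar> + \<bar>\<beta>\<bar>" for w and \<alpha> \<beta> :: real using h(2)[of w] by linarith
  have aff_m: "(\<lambda>w. \<alpha> + \<beta> * ?I w) \<in> borel_measurable borel" for \<alpha> \<beta> :: real using I(1) by measurable
  \<comment> \<open>The minimum with 0 makes the slope nonpositive, so that the lower bound p for
    the mass of \<open>B\<close> gives an upper bound. \<open>\<gamma>\<close> below is the mirror
    image.\<close>
  define \<beta> where "\<beta> = min 0 (h w0 + e - M)"
  have "(transition ^^ T) h z \<le> (transition ^^ T) (\<lambda>w. M + \<beta> * ?I w) z"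
  proof (rule iterate_mono[OF h(1) aff_m hb bound])
    show "h w \<le> M + \<beta> * ?I w" if "w \<in> X \<times> \<E>" for w
      using hM[OF that] e[of w w0] B(2) by (auto simp: indicator_def \<beta>_def abs_le_iff)
  qed (use z in auto)
  also have "\<dots> = M + \<beta> * (transition ^^ T) ?I z" by (rule iter)
  also have "\<dots> \<le> M + \<beta> * p" using p(3) by (intro add_left_mono mult_left_mono_neg) (auto simp: \<beta>_def)
  also have "\<dots> \<le> M + (h w0 + e - M) * p" using p(1) by (intro add_left_mono mult_right_mono) (auto simp: \<beta>_def)
  finally have up: "(transition ^^ T) h z \<le> M + (h w0 + e - M) * p" .
  define \<gamma> where "\<gamma> = max 0 (h w0 - e - m)"
  have "m + (h w0 - e - m) * p \<le> m + \<gamma> * p" using p(1) by (intro add_left_mono mult_right_mono) (auto simp: \<gamma>_def)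
  also have "\<dots> \<le> m + \<gamma> * (transition ^^ T) ?I z'" using p(4) by (intro add_left_mono mult_left_mono) (auto simp: \<gamma>_def)
  also have "\<dots> = (transition ^^ T) (\<lambda>w. m + \<gamma> * ?I w) z'" by (rule iter[symmetric])
  also have "\<dots> \<le> (transition ^^ T) h z'"
  proof (rule iterate_mono[OF aff_m h(1) bound hb])
    show "m + \<gamma> * ?I w \<le> h w" if "w \<in> X \<times> \<E>" for w
      using hm[OF that] e[of w0 w] B(2) by (auto simp: indicator_def \<gamma>_def abs_le_iff)
  qed (use z in auto)
  finally have low: "m + (h w0 - e - m) * p \<le> (transition ^^ T) h z'" .
  have "(transition ^^ T) h z - (transition ^^ T) h z' \<le> (1 - p) * (M - m) + 2 * p * e"
    using up low by (simp add: algebra_simps)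
  also have "\<dots> \<le> (1 - p) * \<Delta> + 2 * p * e" using Mm p by (intro add_right_mono mult_left_mono) auto
  finally show ?thesis .
qed

end

section \<open>Iterates of bounded Lipschitz functions\<close>

context one_step_contraction
begin

text \<open>The fixed point of a \<mapsto> 1 + a q + C. For single states a q + C would have to be
  dominated; the 1 is the weight of one further state of a segment.\<close>

definition "lip_const = (1 + C) / (1 - q)"

lemma lip_const: "1 \<le> lip_const" "1 + lip_const * q + C \<le> lip_const"
proof -
  show "1 \<le> lip_const" using C q by (simp add: lip_const_def field_simps)
  have "lip_const * (1 - q) = 1 + C" using q by (simp add: lip_const_def)
  then show "1 + lip_const * q + C \<le> lip_const" by (simp add: algebra_simps)
qed

definition lip_class :: "('h \<times> (nat \<Rightarrow> 'e) \<Rightarrow> real) set" where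
  "lip_class = {g \<in> borel_measurable borel. (\<forall>w. \<bar>g w\<bar> \<le> 1) \<and>
     (\<forall>w\<in>X \<times> \<E>. \<forall>w'\<in>X \<times> \<E>. \<bar>g w - g w'\<bar> \<le> lip_const * mixed_dist A w w')}"

lemma transition_lip_class: "transition g \<in> lip_class" if g: "g \<in> lip_class"
proof -
  have g': "g \<in> borel_measurable borel" "\<And>w. \<bar>g w\<bar> \<le> 1"
    "\<And>w w'. w \<in> X \<times> \<E> \<Longrightarrow> w' \<in> X \<times> \<E> \<Longrightarrow> \<bar>g w - g w'\<bar> \<le> 0 + lip_const * mixed_dist A w w'"
    using g unfolding lip_class_def by auto
  have "\<bar>transition g w - transition g w'\<bar> \<le> lip_const * mixed_dist A w w'" if w: "w \<in> X \<times> \<E>" "w' \<in> X \<times> \<E>" for w w'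
  proof -
    have "\<bar>transition g w - transition g w'\<bar> \<le> 0 + (lip_const * q + C) * mixed_dist A w w'"
      using lip_const(1) by (intro one_step g' w) auto
    also have "\<dots> \<le> lip_const * mixed_dist A w w'"
      using lip_const(2) mixed_dist_nonneg[OF _ w, of A] A by (simp add: mult_right_mono)
    finally show ?thesis .
  qed
  then show ?thesis unfolding lip_class_def using g'(1) transition_bounded[OF g'(1,2)] by auto
qed

lemma iterate_lip_class: "g \<in> lip_class \<Longrightarrow> (transition ^^ k) g \<in> lip_class"
  by (induction k) (auto intro: transition_lip_class)

text \<open>All iterates share the Lipschitz constant \<open>lip_const\<close>, so one set
  \<open>B\<close> serves for every block of \<open>T\<close> steps. A block turns an oscillation
  bound \<Delta> into \<open>(1 - p) * \<Delta> + p * \<epsilon> / 2\<close>, whose fixed point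
  \<epsilon> / 2 is approached geometrically.\<close>

lemma mixing:
  assumes \<epsilon>: "\<epsilon> > 0"
  obtains k0 where "\<And>k g z z'. k \<ge> k0 \<Longrightarrow> g \<in> lip_class \<Longrightarrow> z \<in> X \<times> \<E> \<Longrightarrow> z' \<in> X \<times> \<E> \<Longrightarrow>
    \<bar>(transition ^^ k) g z - (transition ^^ k) g z'\<bar> \<le> \<epsilon>"
proof (cases "X \<times> \<E> = {}")
  case False
  have \<epsilon>': "\<epsilon> / (4 * lip_const) > 0" using \<epsilon> lip_const by simp
  obtain T p B where B: "p > 0" "B \<in> sets borel" "B \<subseteq> X \<times> \<E>"
    "\<And>w w'. w \<in> B \<Longrightarrow> w' \<in> B \<Longrightarrow> mixed_dist A w w' \<le> \<epsilon> / (4 * lip_const)"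
    "\<And>z. z \<in> X \<times> \<E> \<Longrightarrow> p \<le> (transition ^^ T) (indicator B) z"
    by (rule irreducible[OF \<epsilon>' A]) (rule that; assumption)
  have p1: "p \<le> 1"
  proof -
    obtain z where z: "z \<in> X \<times> \<E>" using False by blast
    have "\<bar>(transition ^^ T) (indicator B) z\<bar> \<le> 1"
      using B(2) by (intro iterate_bounded) (auto simp: indicator_def)
    then show ?thesis using B(5)[OF z] by linarith
  qed
  \<comment> \<open>An empty \<open>B\<close> would be reached with probability 0, against p >
    0.\<close>
  obtain w0 where w0: "w0 \<in> B"
  proof (cases "B = {}")
    case True
    obtain z where z: "z \<in> X \<times> \<E>" using False by blast
    have "(transition ^^ T) (\<lambda>_. 0) = (\<lambda>_. 0)"
    proof (induction T)
      case (Suc T)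
      have "transition (\<lambda>_. 0) = (\<lambda>_. 0)" by (rule ext) (simp add: transition_def)
      then show ?case by (simp only: funpow.simps comp_apply Suc)
    qed simp
    moreover have "(indicator B :: 'h \<times> (nat \<Rightarrow> 'e) \<Rightarrow> real) = (\<lambda>_. 0)" using True by (simp add: fun_eq_iff)
    ultimately show ?thesis using B(5)[OF z] B(1) by simp
  qed (use that in blast)
  \<comment> \<open>The free remainder \<open>i\<close> makes the estimate cover every time after
    \<open>j * T\<close>, not only multiples of \<open>T\<close>.\<close>
  have osc: "\<bar>(transition ^^ (j * T + i)) g z - (transition ^^ (j * T + i)) g z'\<bar> \<le> \<epsilon> / 2 + (1 - p) ^ j * 2"
    if g: "g \<in> lip_class" and "z \<in> X \<times> \<E>" "z' \<in> X \<times> \<E>" for j i g z z'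
    using that(2,3)
  proof (induction j arbitrary: z z')
    case 0
    have "g \<in> borel_measurable borel" "\<And>w. \<bar>g w\<bar> \<le> 1" using g by (auto simp: lip_class_def)
    then have "\<bar>(transition ^^ i) g z\<bar> \<le> 1" "\<bar>(transition ^^ i) g z'\<bar> \<le> 1" by (auto intro!: iterate_bounded)
    then show ?case using \<epsilon> by simp
  next
    case (Suc j)
    define h where "h = (transition ^^ (j * T + i)) g"
    have h: "h \<in> lip_class" unfolding h_def by (rule iterate_lip_class[OF g])
    then have hm: "h \<in> borel_measurable borel" "\<And>w. \<bar>h w\<bar> \<le> 1" by (auto simp: lip_class_def)
    have hB: "\<bar>h w - h w'\<bar> \<le> \<epsilon> / 4" if w: "w \<in> B" "w' \<in> B" for w w'
    proof -
      have "\<bar>h w - h w'\<bar> \<le> lip_const * mixed_dist A w w'" 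
      proof -
        have "w \<in> X \<times> \<E>" "w' \<in> X \<times> \<E>" using w B(3) by auto
        then show ?thesis using h unfolding lip_class_def by blast
      qed
      also have "\<dots> \<le> lip_const * (\<epsilon> / (4 * lip_const))" using B(4)[OF w] lip_const by (intro mult_left_mono) auto
      finally show ?thesis using lip_const by simp
    qed
    have hT: "(transition ^^ (Suc j * T + i)) g = (transition ^^ T) h"
    proof -
      have "Suc j * T + i = T + (j * T + i)" by simp
      then show ?thesis by (simp only: h_def funpow_add comp_apply)
    qed
    have one: "(transition ^^ T) h z1 - (transition ^^ T) h z2 \<le> (1 - p) * (\<epsilon> / 2 + (1 - p) ^ j * 2) + 2 * p * (\<epsilon> / 4)"
      if z12: "z1 \<in> X \<times> \<E>" "z2 \<in> X \<times> \<E>" for z1 z2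
    proof (rule oscillation_step[OF hm B(2) w0 B(3) less_imp_le[OF B(1)] p1 B(5)[OF z12(1)] B(5)[OF z12(2)] z12])
      show "\<bar>h w - h w'\<bar> \<le> \<epsilon> / 2 + (1 - p) ^ j * 2" if "w \<in> X \<times> \<E>" "w' \<in> X \<times> \<E>" for w w'
        unfolding h_def by (rule Suc.IH[OF that])
    qed (rule hB)
    have "(1 - p) * (\<epsilon> / 2 + (1 - p) ^ j * 2) + 2 * p * (\<epsilon> / 4) = \<epsilon> / 2 + (1 - p) ^ Suc j * 2"
      by (simp add: field_simps)
    then show ?case unfolding hT using one[OF Suc.prems] one[OF Suc.prems(2,1)] by (simp add: abs_le_iff)
  qed
  have "(\<lambda>j. (1 - p) ^ j * 2) \<longlonglongrightarrow> 0 * 2" using B(1) p1 by (intro tendsto_mult_right LIMSEQ_power_zero) auto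
  from order_tendstoD(2)[OF this, of "\<epsilon> / 2"] have "\<forall>\<^sub>F j in sequentially. (1 - p) ^ j * 2 < \<epsilon> / 2"
    using \<epsilon> by simp
  then obtain j where j: "(1 - p) ^ j * 2 < \<epsilon> / 2" using eventually_happens sequentially_bot by blast
  show ?thesis
  proof (rule that[of "j * T"])
    fix k g z z' assume k: "k \<ge> j * T" and gz: "g \<in> lip_class" "z \<in> X \<times> \<E>" "z' \<in> X \<times> \<E>"
    then obtain i where "k = j * T + i" using le_Suc_ex by blast
    then show "\<bar>(transition ^^ k) g z - (transition ^^ k) g z'\<bar> \<le> \<epsilon>" using osc[OF gz, of j i] j by simp
  qed
qed (use that in blast)

text \<open>For the \<open>U\<close>-process, \<open>integrate_step n F p\<close> is the conditional expectation of \<open>F\<close> at the path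
  stopped at time \<open>n + 1\<close>, given that the path is \<open>p\<close> up to time \<open>n\<close>.\<close>

definition integrate_step ::
    "nat \<Rightarrow> ((nat \<Rightarrow> 'h \<times> (nat \<Rightarrow> 'e)) \<Rightarrow> real) \<Rightarrow> (nat \<Rightarrow> 'h \<times> (nat \<Rightarrow> 'e)) \<Rightarrow> real" where
  "integrate_step n F p = transition (\<lambda>w. F (\<lambda>i. if i \<le> n then p i else w)) (p n)"

text \<open>Functions of segments of any length are all functions of infinite sequences, with the
  last state repeated forever. So the integrated function has the same type as \<open>F\<close>, and
  the recursion can generalise over it.\<close>

primrec collapse :: "nat \<Rightarrow> ((nat \<Rightarrow> 'h \<times> (nat \<Rightarrow> 'e)) \<Rightarrow> real) \<Rightarrow> (nat \<Rightarrow> 'h \<times> (nat \<Rightarrow> 'e)) \<Rightarrow> real" where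
  "collapse 0 F = F"
| "collapse (Suc n) F = collapse n (integrate_step n F)"

lemma splice_measurable:
  "(\<lambda>(p, w). (\<lambda>i. if i \<le> n then p i else w)) \<in> borel \<Otimes>\<^sub>M borel \<rightarrow>\<^sub>M (borel :: (nat \<Rightarrow> 'h \<times> (nat \<Rightarrow> 'e)) measure)"
  unfolding split_beta
proof (rule measurable_coordinatewise_then_product)
  fix i show "(\<lambda>x. if i \<le> n then fst x i else snd x) \<in> borel \<Otimes>\<^sub>M borel \<rightarrow>\<^sub>M (borel :: ('h \<times> (nat \<Rightarrow> 'e)) measure)"
    using measurable_compose[OF measurable_fst coordinate_measurable[of i]] by (cases "i \<le> n") simp_all
qed

lemma integrate_step_measurable:
  assumes F: "F \<in> borel_measurable borel"
  shows "integrate_step n F \<in> borel_measurable borel"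
proof -
  have k: "(\<lambda>p. distr (U_kernel S Q (p n)) borel (\<lambda>w i. if i \<le> n then p i else w)) \<in>
      (borel :: (nat \<Rightarrow> 'h \<times> (nat \<Rightarrow> 'e)) measure) \<rightarrow>\<^sub>M prob_algebra borel"
    by (rule measurable_distr_prob_space2[OF measurable_compose[OF coordinate_measurable U_kernel_measurable] splice_measurable])
  have m: "(\<lambda>w i. if i \<le> n then p i else w) \<in> borel \<rightarrow>\<^sub>M borel" for p :: "nat \<Rightarrow> 'h \<times> (nat \<Rightarrow> 'e)"
    using measurable_compose[OF measurable_Pair1' splice_measurable[of n]] by simp
  have s: "sets (U_kernel S Q z) = sets borel" for z
    using measurable_space[OF U_kernel_measurable, of z] by (simp add: space_prob_algebra)
  have "integrate_step n F p = (\<integral>p'. F p' \<partial>distr (U_kernel S Q (p n)) borel (\<lambda>w i. if i \<le> n then p i else w))" for p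
  proof -
    have "(\<lambda>w i. if i \<le> n then p i else w) \<in> U_kernel S Q (p n) \<rightarrow>\<^sub>M borel"
      using m[of p] measurable_cong_sets[OF s refl] by blast
    then show ?thesis
      unfolding integrate_step_def
      using integral_U_kernel[OF measurable_compose[OF m[of p] F], of "p n"] F by (subst integral_distr) auto
  qed
  then show ?thesis
    using measurable_compose[OF measurable_prob_algebraD[OF k] integral_measurable_subprob_algebra[OF F]] by presburger
qed

lemma integrate_step_bounded:
  assumes F: "F \<in> borel_measurable borel" and b: "\<And>p. \<bar>F p\<bar> \<le> 1"
  shows "\<bar>integrate_step n F p\<bar> \<le> 1"
  unfolding integrate_step_def
proof (rule transition_bounded)
  show "(\<lambda>w. F (\<lambda>i. if i \<le> n then p i else w)) \<in> borel_measurable borel"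
    using measurable_compose[OF measurable_compose[OF measurable_Pair1' splice_measurable[of n]] F] by simp
qed (rule b)

text \<open>The weight b of state n + 1 becomes b q + C at state n, in addition to the weight 1
  already there; \<open>lip_const\<close> dominates the sum.\<close>

lemma integrate_step_lipschitz:
  assumes F: "F \<in> borel_measurable borel" "\<And>p. \<bar>F p\<bar> \<le> 1"
    and b: "0 \<le> b" "b \<le> lip_const"
    and lip: "\<And>p p'. (\<And>i. p i \<in> X \<times> \<E>) \<Longrightarrow> (\<And>i. p' i \<in> X \<times> \<E>) \<Longrightarrow>
      \<bar>F p - F p'\<bar> \<le> (\<Sum>i<Suc n. mixed_dist A (p i) (p' i)) + b * mixed_dist A (p (Suc n)) (p' (Suc n))"
    and p: "\<And>i. p i \<in> X \<times> \<E>" "\<And>i. p' i \<in> X \<times> \<E>"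
  shows "\<bar>integrate_step n F p - integrate_step n F p'\<bar> \<le>
    (\<Sum>i<n. mixed_dist A (p i) (p' i)) + lip_const * mixed_dist A (p n) (p' n)"
proof -
  have D0: "0 \<le> mixed_dist A (p i) (p' i)" for i using A by (intro mixed_dist_nonneg p) simp
  have m: "(\<lambda>w. F (\<lambda>i. if i \<le> n then p i else w)) \<in> borel_measurable borel" for p :: "nat \<Rightarrow> 'h \<times> (nat \<Rightarrow> 'e)"
    using measurable_compose[OF measurable_compose[OF measurable_Pair1' splice_measurable[of n]] F(1)] by simp
  have "\<bar>integrate_step n F p - integrate_step n F p'\<bar> \<le>
    (\<Sum>i<Suc n. mixed_dist A (p i) (p' i)) + (b * q + C) * mixed_dist A (p n) (p' n)"
    unfolding integrate_step_def
  proof (rule one_step[OF m m F(2) F(2) sum_nonneg[OF D0] b(1) _ p(1) p(2)])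
    fix w w' assume w: "w \<in> X \<times> \<E>" "w' \<in> X \<times> \<E>"
    let ?p = "\<lambda>i. if i \<le> n then p i else w" and ?p' = "\<lambda>i. if i \<le> n then p' i else w'"
    have "\<bar>F ?p - F ?p'\<bar> \<le> (\<Sum>i<Suc n. mixed_dist A (?p i) (?p' i)) + b * mixed_dist A (?p (Suc n)) (?p' (Suc n))"
      by (rule lip) (use p w in auto)
    also have "(\<Sum>i<Suc n. mixed_dist A (?p i) (?p' i)) = (\<Sum>i<Suc n. mixed_dist A (p i) (p' i))"
      by (intro sum.cong) auto
    finally show "\<bar>F ?p - F ?p'\<bar> \<le> (\<Sum>i<Suc n. mixed_dist A (p i) (p' i)) + b * mixed_dist A w w'" by simp
  qed
  also have "\<dots> = (\<Sum>i<n. mixed_dist A (p i) (p' i)) + (1 + b * q + C) * mixed_dist A (p n) (p' n)"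
    by (simp add: algebra_simps)
  also have "\<dots> \<le> (\<Sum>i<n. mixed_dist A (p i) (p' i)) + lip_const * mixed_dist A (p n) (p' n)"
    using lip_const(2) mult_right_mono[OF b(2) q(1)] D0 by (intro add_left_mono mult_right_mono) auto
  finally show ?thesis .
qed

lemma collapse_measurable:
  "F \<in> borel_measurable borel \<Longrightarrow> collapse n F \<in> borel_measurable borel"
  by (induction n arbitrary: F) (auto intro: integrate_step_measurable)

lemma collapse_bounded:
  "F \<in> borel_measurable borel \<Longrightarrow> (\<And>p. \<bar>F p\<bar> \<le> 1) \<Longrightarrow> \<bar>collapse n F p\<bar> \<le> 1"
proof (induction n arbitrary: F)
  case (Suc n)
  show ?case
    unfolding collapse.simps
    by (rule Suc.IH[OF integrate_step_measurable[OF Suc.prems(1)] integrate_step_bounded[OF Suc.prems]])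
qed simp

lemma collapse_lipschitz:
  assumes "F \<in> borel_measurable borel" "\<And>p. \<bar>F p\<bar> \<le> 1"
    and "\<And>p p'. (\<And>i. p i \<in> X \<times> \<E>) \<Longrightarrow> (\<And>i. p' i \<in> X \<times> \<E>) \<Longrightarrow>
      \<bar>F p - F p'\<bar> \<le> (\<Sum>i<n. mixed_dist A (p i) (p' i)) + lip_const * mixed_dist A (p n) (p' n)"
    and "\<And>i. p i \<in> X \<times> \<E>" "\<And>i. p' i \<in> X \<times> \<E>"
  shows "\<bar>collapse n F p - collapse n F p'\<bar> \<le> lip_const * mixed_dist A (p 0) (p' 0)"
  using assms
proof (induction n arbitrary: F)
  case (Suc n)
  show ?case
    unfolding collapse.simps
  proof (rule Suc.IH[OF integrate_step_measurable[OF Suc.prems(1)] integrate_step_bounded[OF Suc.prems(1,2)] _ Suc.prems(4,5)])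
    show "\<bar>integrate_step n F p - integrate_step n F p'\<bar> \<le> (\<Sum>i<n. mixed_dist A (p i) (p' i)) + lip_const * mixed_dist A (p n) (p' n)"
      if "\<And>i. p i \<in> X \<times> \<E>" "\<And>i. p' i \<in> X \<times> \<E>" for p p'
      by (rule integrate_step_lipschitz[OF Suc.prems(1,2) _ order_refl Suc.prems(3) that]) (use lip_const(1) in auto)
  qed
qed simp

lemma collapse_lip_class:
  assumes F: "F \<in> borel_measurable borel" "\<And>p. \<bar>F p\<bar> \<le> 1"
    and lip: "\<And>p p'. (\<And>i. p i \<in> X \<times> \<E>) \<Longrightarrow> (\<And>i. p' i \<in> X \<times> \<E>) \<Longrightarrow>
      \<bar>F p - F p'\<bar> \<le> (\<Sum>i\<le>n. mixed_dist A (p i) (p' i))"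
  shows "(\<lambda>z. collapse n F (\<lambda>_. z)) \<in> lip_class"
proof -
  have lip': "\<bar>F p - F p'\<bar> \<le> (\<Sum>i<n. mixed_dist A (p i) (p' i)) + lip_const * mixed_dist A (p n) (p' n)"
    if p: "\<And>i. p i \<in> X \<times> \<E>" "\<And>i. p' i \<in> X \<times> \<E>" for p p'
  proof -
    have "mixed_dist A (p n) (p' n) \<le> lip_const * mixed_dist A (p n) (p' n)"
      using mult_right_mono[OF lip_const(1) mixed_dist_nonneg[OF _ p(1) p(2), of A n n]] A by simp
    then show ?thesis using lip[of p p', OF p] by (simp add: lessThan_Suc_atMost[symmetric])
  qed
  have const: "(\<lambda>z _. z) \<in> borel \<rightarrow>\<^sub>M (borel :: (nat \<Rightarrow> 'h \<times> (nat \<Rightarrow> 'e)) measure)"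
    by (rule measurable_coordinatewise_then_product) simp
  show ?thesis
    unfolding lip_class_def
  proof (intro CollectI conjI ballI allI)
    show "(\<lambda>z. collapse n F (\<lambda>_. z)) \<in> borel_measurable borel"
      by (rule measurable_compose[OF const collapse_measurable[OF F(1)]])
    show "\<bar>collapse n F (\<lambda>_. w)\<bar> \<le> 1" for w by (rule collapse_bounded[OF F])
    show "\<bar>collapse n F (\<lambda>_. w) - collapse n F (\<lambda>_. w')\<bar> \<le> lip_const * mixed_dist A w w'"
      if "w \<in> X \<times> \<E>" "w' \<in> X \<times> \<E>" for w w'
      by (rule collapse_lipschitz[where p = "\<lambda>_. w" and p' = "\<lambda>_. w'", OF F lip']) (assumption | rule that)+
  qed
qed

section \<open>Expectations along trajectories of the U-process\<close>

lemma markov_integrate_step: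
  assumes V: "markov_trajectory (U_kernel S Q) N V"
    and F: "F \<in> borel_measurable borel" "\<And>p. \<bar>F p\<bar> \<le> 1"
  shows "(\<integral>\<omega>. F (\<lambda>i. V (min i (Suc n)) \<omega>) \<partial>N) = (\<integral>\<omega>. integrate_step n F (\<lambda>i. V (min i n) \<omega>) \<partial>N)"
proof -
  have N: "prob_space N" and Vm: "V k \<in> borel_measurable N" for k
    using V by (auto simp: markov_trajectory_def)
  have Xm: "(\<lambda>\<omega>. \<lambda>i\<in>{..n}. V i \<omega>) \<in> N \<rightarrow>\<^sub>M Pi\<^sub>M {..n} (\<lambda>_. borel)"
    by (intro measurable_restrict Vm)
  have km: "(\<lambda>x. U_kernel S Q (x n)) \<in> Pi\<^sub>M {..n} (\<lambda>_. borel) \<rightarrow>\<^sub>M prob_algebra borel"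
    by (rule measurable_compose[OF measurable_component_singleton[of n "{..n}" "\<lambda>_. borel"] U_kernel_measurable]) simp
  \<comment> \<open>Filling all places after n with \<open>w\<close> reproduces the path frozen at
    time n + 1 by \<open>min\<close>.\<close>
  define f where "f = (\<lambda>(x, w). F (\<lambda>i. if i \<le> n then x i else w))"
  have fm: "f \<in> borel_measurable (Pi\<^sub>M {..n} (\<lambda>_. borel) \<Otimes>\<^sub>M borel)"
    unfolding f_def split_beta
  proof (rule measurable_compose[OF measurable_coordinatewise_then_product F(1)])
    fix i show "(\<lambda>x. if i \<le> n then fst x i else snd x) \<in> Pi\<^sub>M {..n} (\<lambda>_. borel) \<Otimes>\<^sub>M borel \<rightarrow>\<^sub>M (borel :: ('h \<times> (nat \<Rightarrow> 'e)) measure)"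
      using measurable_compose[OF measurable_fst measurable_component_singleton[of i "{..n}"]] by (cases "i \<le> n") simp_all
  qed
  have "(\<integral>\<omega>. f (\<lambda>i\<in>{..n}. V i \<omega>, V (Suc n) \<omega>) \<partial>N) =
    (\<integral>\<omega>. (\<integral>w. f (\<lambda>i\<in>{..n}. V i \<omega>, w) \<partial>U_kernel S Q ((\<lambda>i\<in>{..n}. V i \<omega>) n)) \<partial>N)"
  proof (rule integral_conditional_kernel[OF N Xm Vm km _ fm])
    show "measure N {\<omega> \<in> space N. (\<lambda>i\<in>{..n}. V i \<omega>) \<in> a \<and> V (Suc n) \<omega> \<in> b} =
        (\<integral>\<omega>. indicator a (\<lambda>i\<in>{..n}. V i \<omega>) * measure (U_kernel S Q ((\<lambda>i\<in>{..n}. V i \<omega>) n)) b \<partial>N)"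
      if "a \<in> sets (Pi\<^sub>M {..n} (\<lambda>_. borel))" "b \<in> sets borel" for a b
      using V that by (simp add: markov_trajectory_def)
    show "\<bar>f x\<bar> \<le> 1" for x unfolding f_def split_beta by (rule F(2))
  qed
  moreover have "f (\<lambda>i\<in>{..n}. V i \<omega>, V (Suc n) \<omega>) = F (\<lambda>i. V (min i (Suc n)) \<omega>)" for \<omega>
    unfolding f_def by (auto intro!: arg_cong[where f=F] simp: min_def fun_eq_iff le_Suc_eq)
  moreover have "(\<integral>w. f (\<lambda>i\<in>{..n}. V i \<omega>, w) \<partial>U_kernel S Q ((\<lambda>i\<in>{..n}. V i \<omega>) n)) = integrate_step n F (\<lambda>i. V (min i n) \<omega>)" for \<omega>
  proof -
    have eq: "(\<lambda>i. if i \<le> n then (\<lambda>i\<in>{..n}. V i \<omega>) i else w) = (\<lambda>i. if i \<le> n then V (min i n) \<omega> else w)" for w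
      by (auto simp: fun_eq_iff)
    have m: "(\<lambda>w. F (\<lambda>i. if i \<le> n then V (min i n) \<omega> else w)) \<in> borel_measurable borel"
      using measurable_compose[OF measurable_compose[OF measurable_Pair1' splice_measurable[of n]] F(1), of "\<lambda>i. V (min i n) \<omega>"] by simp
    show ?thesis
      unfolding f_def split_conv eq integrate_step_def using integral_U_kernel[OF m] by simp
  qed
  ultimately show ?thesis by simp
qed

lemma markov_collapse:
  assumes V: "markov_trajectory (U_kernel S Q) N V"
    and F: "F \<in> borel_measurable borel" "\<And>p. \<bar>F p\<bar> \<le> 1"
  shows "(\<integral>\<omega>. F (\<lambda>i. V (min i n) \<omega>) \<partial>N) = (\<integral>\<omega>. collapse n F (\<lambda>_. V 0 \<omega>) \<partial>N)"
  using F
proof (induction n arbitrary: F)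
  case (Suc n)
  show ?case
    unfolding collapse.simps markov_integrate_step[OF V Suc.prems]
    by (rule Suc.IH[OF integrate_step_measurable[OF Suc.prems(1)] integrate_step_bounded[OF Suc.prems]])
qed simp

lemma markov_trajectory_shift:
  assumes V: "markov_trajectory (U_kernel S Q) N V"
  shows "markov_trajectory (U_kernel S Q) N (\<lambda>i. V (k + i))"
  unfolding markov_trajectory_def
proof (intro conjI allI ballI)
  show "prob_space N" "V (k + i) \<in> borel_measurable N" for i
    using V by (auto simp: markov_trajectory_def)
  fix j :: nat and A :: "(nat \<Rightarrow> 'h \<times> (nat \<Rightarrow> 'e)) set" and B assume A: "A \<in> sets (Pi\<^sub>M {..j} (\<lambda>_. borel))" and B: "B \<in> sets (borel :: ('h \<times> (nat \<Rightarrow> 'e)) measure)"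
  define r where "r x = (\<lambda>i\<in>{..j}. x (k + i))" for x :: "nat \<Rightarrow> 'h \<times> (nat \<Rightarrow> 'e)"
  have rm: "r \<in> Pi\<^sub>M {..k + j} (\<lambda>_. borel) \<rightarrow>\<^sub>M Pi\<^sub>M {..j} (\<lambda>_. borel)"
    unfolding r_def by (intro measurable_restrict measurable_component_singleton) auto
  \<comment> \<open>The event about the shifted path is read as an event about the whole history
    from time 0, for which the Markov property is given.\<close>
  define A' where "A' = r -` A \<inter> space (Pi\<^sub>M {..k + j} (\<lambda>_. borel :: ('h \<times> (nat \<Rightarrow> 'e)) measure))"
  have A': "A' \<in> sets (Pi\<^sub>M {..k + j} (\<lambda>_. borel))" unfolding A'_def by (rule measurable_sets[OF rm A])
  have r: "r (\<lambda>i\<in>{..k + j}. V i \<omega>) = (\<lambda>i\<in>{..j}. V (k + i) \<omega>)" for \<omega> by (auto simp: r_def fun_eq_iff)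
  have mem: "(\<lambda>i\<in>{..k + j}. V i \<omega>) \<in> A' \<longleftrightarrow> (\<lambda>i\<in>{..j}. V (k + i) \<omega>) \<in> A" for \<omega>
    unfolding A'_def using r[of \<omega>] by (simp add: space_PiM)
  have "measure N {\<omega> \<in> space N. (\<lambda>i\<in>{..k + j}. V i \<omega>) \<in> A' \<and> V (Suc (k + j)) \<omega> \<in> B} =
        (\<integral>\<omega>. indicator A' (\<lambda>i\<in>{..k + j}. V i \<omega>) * measure (U_kernel S Q (V (k + j) \<omega>)) B \<partial>N)"
    using V A' B unfolding markov_trajectory_def by blast
  then show "measure N {\<omega> \<in> space N. (\<lambda>i\<in>{..j}. V (k + i) \<omega>) \<in> A \<and> V (k + Suc j) \<omega> \<in> B} =
        (\<integral>\<omega>. indicator A (\<lambda>i\<in>{..j}. V (k + i) \<omega>) * measure (U_kernel S Q (V (k + j) \<omega>)) B \<partial>N)"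
    by (simp add: mem indicator_def)
qed

lemma markov_iterate:
  assumes V: "markov_trajectory (U_kernel S Q) N V" and g: "g \<in> lip_class"
  shows "(\<integral>\<omega>. g (V k \<omega>) \<partial>N) = (\<integral>\<omega>. (transition ^^ k) g (V 0 \<omega>) \<partial>N)"
  using g
proof (induction k arbitrary: g)
  case (Suc k)
  then have g: "g \<in> borel_measurable borel" "\<And>w. \<bar>g w\<bar> \<le> 1" by (auto simp: lip_class_def)
  have m: "(\<lambda>p :: nat \<Rightarrow> 'h \<times> (nat \<Rightarrow> 'e). g (p 1)) \<in> borel_measurable borel"
    by (rule measurable_compose[OF coordinate_measurable g(1)])
  have "(\<integral>\<omega>. g (V (Suc k) \<omega>) \<partial>N) = (\<integral>\<omega>. transition g (V k \<omega>) \<partial>N)"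
    using markov_collapse[OF markov_trajectory_shift[OF V, of k] m g(2), of 1] by (simp add: integrate_step_def)
  also have "\<dots> = (\<integral>\<omega>. (transition ^^ k) (transition g) (V 0 \<omega>) \<partial>N)"
    by (rule Suc.IH[OF transition_lip_class[OF Suc.prems]])
  finally show ?case by (simp only: funpow_Suc_right comp_apply)
qed simp

lemma markov_segment:
  assumes V: "markov_trajectory (U_kernel S Q) N V"
    and F: "F \<in> borel_measurable borel" "\<And>p. \<bar>F p\<bar> \<le> 1"
    and lip: "\<And>p p'. (\<And>i. p i \<in> X \<times> \<E>) \<Longrightarrow> (\<And>i. p' i \<in> X \<times> \<E>) \<Longrightarrow>
      \<bar>F p - F p'\<bar> \<le> (\<Sum>i\<le>n. mixed_dist A (p i) (p' i))"
  shows "(\<integral>\<omega>. F (\<lambda>i. V (k + min i n) \<omega>) \<partial>N) =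
    (\<integral>\<omega>. (transition ^^ k) (\<lambda>z. collapse n F (\<lambda>_. z)) (V 0 \<omega>) \<partial>N)"
  using markov_collapse[OF markov_trajectory_shift[OF V, of k] F, of n]
    markov_iterate[OF V collapse_lip_class[OF F lip], of k] by simp

end

section \<open>Convergence of the trajectories\<close>

context stationary_noise
begin

text \<open>Independence of u and the whole noise path makes their joint law a product, so that u
  can be frozen before the noise is integrated.\<close>

lemma integral_admissible_initial:
  fixes f :: "'h::second_countable_topology \<times> (int \<Rightarrow> 'e) \<Rightarrow> real"
  assumes u: "admissible_initial M \<eta> X u"
    and f: "f \<in> borel_measurable (borel \<Otimes>\<^sub>M borel)" "\<And>x. \<bar>f x\<bar> \<le> c"
  shows "(\<integral>\<omega>. f (u \<omega>, \<lambda>k. \<eta> k \<omega>) \<partial>M) = (\<integral>\<omega>. (\<integral>\<omega>'. f (u \<omega>, \<lambda>k. \<eta> k \<omega>') \<partial>M) \<partial>M)"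
proof -
  have um: "u \<in> borel_measurable M" using u by (simp add: admissible_initial_def)
  let ?h = "\<lambda>\<omega> k. \<eta> k \<omega>"
  note hm = eta_path_measurable
  interpret U: prob_space "distr M borel u" by (rule prob_space_distr[OF um])
  interpret Y: prob_space "distr M borel ?h" by (rule prob_space_distr[OF hm])
  interpret P: pair_prob_space "distr M borel u" "distr M borel ?h" ..
  have um_h: "(\<lambda>\<omega>. (u \<omega>, ?h \<omega>)) \<in> M \<rightarrow>\<^sub>M borel \<Otimes>\<^sub>M borel" by (rule measurable_Pair[OF um hm])
  have D: "distr M borel u \<Otimes>\<^sub>M distr M borel ?h = distr M (borel \<Otimes>\<^sub>M borel) (\<lambda>\<omega>. (u \<omega>, ?h \<omega>))"
  proof (rule measure_eqI_rectangles[OF P.prob_space_axioms prob_space_distr[OF um_h]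
        sets_pair_measure_cong[OF sets_distr sets_distr] sets_distr])
    fix a and b :: "(int \<Rightarrow> 'e) set" assume a: "a \<in> sets (borel :: 'h measure)" and b: "b \<in> sets borel"
    have "u -` a \<inter> space M \<in> sets (vimage_algebra (space M) u borel)" "?h -` b \<inter> space M \<in> sets (vimage_algebra (space M) ?h borel)"
      using a b by (auto simp: sets_vimage_algebra)
    moreover have "indep_set (sets (vimage_algebra (space M) u borel)) (sets (vimage_algebra (space M) ?h borel))"
      using u by (simp add: admissible_initial_def)
    ultimately have ind: "prob ((u -` a \<inter> space M) \<inter> (?h -` b \<inter> space M)) = prob (u -` a \<inter> space M) * prob (?h -` b \<inter> space M)"
      by (intro indep_setD)
    have "measure (distr M borel u \<Otimes>\<^sub>M distr M borel ?h) (a \<times> b) = measure (distr M borel u) a * measure (distr M borel ?h) b"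
      using a b by (simp add: measure_def Y.emeasure_pair_measure_Times enn2real_mult)
    also have "\<dots> = prob ((u -` a \<inter> space M) \<inter> (?h -` b \<inter> space M))"
      unfolding ind measure_distr[OF um a] measure_distr[OF hm b] ..
    also have "(u -` a \<inter> space M) \<inter> (?h -` b \<inter> space M) = (\<lambda>\<omega>. (u \<omega>, ?h \<omega>)) -` (a \<times> b) \<inter> space M" by auto
    also have "prob \<dots> = measure (distr M (borel \<Otimes>\<^sub>M borel) (\<lambda>\<omega>. (u \<omega>, ?h \<omega>))) (a \<times> b)"
      by (rule measure_distr[symmetric, OF um_h pair_measureI[OF a b]])
    finally show "measure (distr M borel u \<Otimes>\<^sub>M distr M borel ?h) (a \<times> b) =
        measure (distr M (borel \<Otimes>\<^sub>M borel) (\<lambda>\<omega>. (u \<omega>, ?h \<omega>))) (a \<times> b)" .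
  qed
  have fm: "f \<in> borel_measurable (distr M borel u \<Otimes>\<^sub>M distr M borel ?h)"
    using f(1) measurable_cong_sets[OF sets_pair_measure_cong[OF sets_distr sets_distr] refl] by blast
  have "(\<integral>\<omega>. f (u \<omega>, ?h \<omega>) \<partial>M) = (\<integral>x. f x \<partial>distr M (borel \<Otimes>\<^sub>M borel) (\<lambda>\<omega>. (u \<omega>, ?h \<omega>)))"
    by (rule integral_distr[symmetric, OF measurable_Pair[OF um hm] f(1)])
  also have "\<dots> = (\<integral>x. f x \<partial>(distr M borel u \<Otimes>\<^sub>M distr M borel ?h))" by (simp only: D)
  also have "\<dots> = (\<integral>x. (\<integral>y. f (x, y) \<partial>distr M borel ?h) \<partial>distr M borel u)"
    by (rule P.integral_fst'[symmetric]) (rule P.P.integrable_const_bound[where B=c, OF _ fm], simp add: f)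
  also have "\<dots> = (\<integral>\<omega>. (\<integral>y. f (u \<omega>, y) \<partial>distr M borel ?h) \<partial>M)"
  proof (rule integral_distr[OF um])
    show "(\<lambda>x. \<integral>y. f (x, y) \<partial>distr M borel ?h) \<in> borel_measurable borel"
      using Y.borel_measurable_lebesgue_integral[of "\<lambda>x y. f (x, y)" borel] f(1)
        measurable_cong_sets[OF sets_pair_measure_cong[OF refl sets_distr[of M borel ?h]] refl] by auto
  qed
  also have "\<dots> = (\<integral>\<omega>. (\<integral>\<omega>'. f (u \<omega>, ?h \<omega>') \<partial>M) \<partial>M)"
    by (intro Bochner_Integration.integral_cong refl integral_distr hm measurable_compose[OF measurable_Pair1' f(1)]) simp
  finally show ?thesis .
qed

text \<open>Knowing the initial state does not change the conditional law of the next noise: with u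
  frozen, the event about \<open>(u, past_at k)\<close> is its section, an event about the past
  alone.\<close>

lemma prob_initial_past_next:
  fixes u :: "'w \<Rightarrow> 'h::second_countable_topology"
  assumes u: "admissible_initial M \<eta> X u"
    and A: "A \<in> sets (borel \<Otimes>\<^sub>M borel)" and B: "B \<in> sets borel"
  shows "prob {\<omega> \<in> space M. (u \<omega>, past_at k \<omega>) \<in> A \<and> \<eta> (int (Suc k)) \<omega> \<in> B} =
    (\<integral>\<omega>. indicator A (u \<omega>, past_at k \<omega>) * measure (Q (past_at k \<omega>)) B \<partial>M)"
proof -
  define \<pi> where "\<pi> p = (\<lambda>n. p (int k - int n))" for p :: "int \<Rightarrow> 'e"
  have \<pi>: "\<pi> \<in> borel \<rightarrow>\<^sub>M borel" unfolding \<pi>_def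
    by (rule measurable_coordinatewise_then_product) (rule coordinate_measurable)
  have past: "past_at k \<omega> = \<pi> (\<lambda>k. \<eta> k \<omega>)" for \<omega> by (simp add: past_at_def \<pi>_def)
  have um: "u \<in> borel_measurable M" using u by (simp add: admissible_initial_def)
  have QB: "(\<lambda>\<xi>. measure (Q \<xi>) B) \<in> borel_measurable borel"
    using B by measurable
  have pm: "(\<lambda>x. (fst x, \<pi> (snd x))) \<in> borel \<Otimes>\<^sub>M borel \<rightarrow>\<^sub>M (borel \<Otimes>\<^sub>M borel :: ('h \<times> (nat \<Rightarrow> 'e)) measure)"
    by (intro measurable_Pair measurable_fst measurable_compose[OF measurable_snd \<pi>])
  define f1 where "f1 x = (indicator A (fst x, \<pi> (snd x)) * indicator B (snd x (int (Suc k))) :: real)" for x :: "'h \<times> (int \<Rightarrow> 'e)"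
  define f2 where "f2 x = (indicator A (fst x, \<pi> (snd x)) * measure (Q (\<pi> (snd x))) B :: real)" for x :: "'h \<times> (int \<Rightarrow> 'e)"
  have iA: "(\<lambda>x. indicator A (fst x, \<pi> (snd x)) :: real) \<in> borel_measurable (borel \<Otimes>\<^sub>M borel)"
    by (rule measurable_compose[OF pm borel_measurable_indicator[OF A]])
  have f1m: "f1 \<in> borel_measurable (borel \<Otimes>\<^sub>M borel)"
    unfolding f1_def
    by (intro borel_measurable_times iA measurable_compose[OF measurable_compose[OF measurable_snd coordinate_measurable] borel_measurable_indicator[OF B]])
  have f2m: "f2 \<in> borel_measurable (borel \<Otimes>\<^sub>M borel)"
    unfolding f2_def by (intro borel_measurable_times iA measurable_compose[OF measurable_compose[OF measurable_snd \<pi>] QB])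
  have f1b: "\<bar>f1 x\<bar> \<le> 1" and f2b: "\<bar>f2 x\<bar> \<le> 1" for x
    using prob_space.prob_le_1[OF prob_Q', of "\<pi> (snd x)" B] by (auto simp: f1_def f2_def indicator_def)
  have upm: "(\<lambda>\<omega>. (u \<omega>, past_at k \<omega>)) \<in> M \<rightarrow>\<^sub>M borel \<Otimes>\<^sub>M borel"
    by (intro measurable_Pair um past_at_measurable)
  have "prob {\<omega> \<in> space M. (u \<omega>, past_at k \<omega>) \<in> A \<and> \<eta> (int (Suc k)) \<omega> \<in> B} = (\<integral>\<omega>. f1 (u \<omega>, \<lambda>k. \<eta> k \<omega>) \<partial>M)"
  proof -
    have "(\<integral>\<omega>. f1 (u \<omega>, \<lambda>k. \<eta> k \<omega>) \<partial>M) =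
        (\<integral>\<omega>. indicator {\<omega>. (u \<omega>, past_at k \<omega>) \<in> A \<and> \<eta> (int (Suc k)) \<omega> \<in> B} \<omega> \<partial>M)"
      by (intro Bochner_Integration.integral_cong refl) (simp add: f1_def past indicator_def)
    then show ?thesis by (simp add: Int_def conj_commute)
  qed
  also have "\<dots> = (\<integral>\<omega>. (\<integral>\<omega>'. f1 (u \<omega>, \<lambda>k. \<eta> k \<omega>') \<partial>M) \<partial>M)"
    by (rule integral_admissible_initial[OF u f1m f1b])
  also have "\<dots> = (\<integral>\<omega>. (\<integral>\<omega>'. f2 (u \<omega>, \<lambda>k. \<eta> k \<omega>') \<partial>M) \<partial>M)"
  proof (rule Bochner_Integration.integral_cong[OF refl])
    fix \<omega>
    have Av: "Pair (u \<omega>) -` A \<in> sets borel" by (rule sets_Pair1[OF A])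
    have "(\<integral>\<omega>'. f1 (u \<omega>, \<lambda>k. \<eta> k \<omega>') \<partial>M) = prob {\<omega>' \<in> space M. past_at k \<omega>' \<in> Pair (u \<omega>) -` A \<and> \<eta> (int (Suc k)) \<omega>' \<in> B}"
    proof -
      have "(\<integral>\<omega>'. f1 (u \<omega>, \<lambda>k. \<eta> k \<omega>') \<partial>M) =
          (\<integral>\<omega>'. indicator {\<omega>'. past_at k \<omega>' \<in> Pair (u \<omega>) -` A \<and> \<eta> (int (Suc k)) \<omega>' \<in> B} \<omega>' \<partial>M)"
        by (intro Bochner_Integration.integral_cong refl) (simp add: f1_def past indicator_def)
      then show ?thesis by (simp add: Int_def conj_commute)
    qed
    also have "\<dots> = (\<integral>\<omega>'. indicator (Pair (u \<omega>) -` A) (past_at k \<omega>') * measure (Q (past_at k \<omega>')) B \<partial>M)"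
      by (rule prob_past_next[OF Av B])
    also have "\<dots> = (\<integral>\<omega>'. f2 (u \<omega>, \<lambda>k. \<eta> k \<omega>') \<partial>M)"
      by (simp add: f2_def past indicator_def)
    finally show "(\<integral>\<omega>'. f1 (u \<omega>, \<lambda>k. \<eta> k \<omega>') \<partial>M) = (\<integral>\<omega>'. f2 (u \<omega>, \<lambda>k. \<eta> k \<omega>') \<partial>M)" .
  qed
  also have "\<dots> = (\<integral>\<omega>. f2 (u \<omega>, \<lambda>k. \<eta> k \<omega>) \<partial>M)"
    by (rule integral_admissible_initial[OF u f2m f2b, symmetric])
  also have "\<dots> = (\<integral>\<omega>. indicator A (u \<omega>, past_at k \<omega>) * measure (Q (past_at k \<omega>)) B \<partial>M)"
    by (simp add: f2_def past)
  finally show ?thesis .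
qed

text \<open>The whole path up to time k is a measurable function of the initial state and the past
  at time k. Conditioning on the path thus reduces to conditioning on this pair.\<close>

lemma markov_trajectory_admissible:
  fixes u :: "'w \<Rightarrow> 'h::{real_inner, complete_space, second_countable_topology}"
  assumes u: "admissible_initial M \<eta> X u" and S: "continuous_on UNIV S"
    and kernel: "U_kernel S Q \<in> borel \<rightarrow>\<^sub>M prob_algebra borel"
  shows "markov_trajectory (U_kernel S Q) M
    (\<lambda>k \<omega>. (trajectory S (u \<omega>) (\<lambda>j. \<eta> (int j) \<omega>) k, past_at k \<omega>))"
  unfolding markov_trajectory_def
proof (intro conjI allI ballI)
  have Sm: "(\<lambda>x. S (f x, g x)) \<in> borel_measurable N" if "f \<in> borel_measurable N" "g \<in> borel_measurable N"
    for N :: "'n measure" and f g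
    using measurable_compose[OF borel_measurable_Pair[OF that] borel_measurable_continuous_onI[OF S]] .
  have um: "u \<in> borel_measurable M" using u by (simp add: admissible_initial_def)
  show "prob_space M" by (rule prob_space_axioms)
  have tm: "(\<lambda>\<omega>. trajectory S (u \<omega>) (\<lambda>j. \<eta> (int j) \<omega>) k) \<in> borel_measurable M" for k
    by (induction k) (simp_all add: um Sm del: of_nat_Suc)
  show "(\<lambda>\<omega>. (trajectory S (u \<omega>) (\<lambda>j. \<eta> (int j) \<omega>) k, past_at k \<omega>)) \<in> borel_measurable M" for k
    by (intro borel_measurable_Pair tm past_at_measurable)
  fix k :: nat and A :: "(nat \<Rightarrow> 'h \<times> (nat \<Rightarrow> 'e)) set" and B :: "('h \<times> (nat \<Rightarrow> 'e)) set"
  assume A: "A \<in> sets (Pi\<^sub>M {..k} (\<lambda>_. borel))" and B: "B \<in> sets borel"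
  let ?V = "\<lambda>k \<omega>. (trajectory S (u \<omega>) (\<lambda>j. \<eta> (int j) \<omega>) k, past_at k \<omega>)"
  let ?W = "\<lambda>\<omega>. (u \<omega>, past_at k \<omega>)"
  \<comment> \<open>In the past at time k the noise of time j is entry k - j, and the past at time i
    is obtained by dropping the first k - i entries. The formula is meant for
    \<open>i \<le> k\<close>.\<close>
  define H where "H x i = (trajectory S (fst x) (\<lambda>j. snd x (k - j)) i, \<lambda>n. snd x (k - i + n))"
    for x :: "'h \<times> (nat \<Rightarrow> 'e)" and i :: nat
  have HW: "H (?W \<omega>) i = ?V i \<omega>" if "i \<le> k" for i \<omega>
    using that by (auto simp: H_def past_at_def of_nat_diff intro!: trajectory_cong)
  have coord: "(\<lambda>x. snd x n) \<in> borel_measurable (borel \<Otimes>\<^sub>M borel :: ('h \<times> (nat \<Rightarrow> 'e)) measure)" for n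
    by (rule measurable_compose[OF measurable_snd coordinate_measurable])
  have Hm: "(\<lambda>x. H x i) \<in> borel_measurable (borel \<Otimes>\<^sub>M borel)" for i
  proof -
    have "(\<lambda>x :: 'h \<times> (nat \<Rightarrow> 'e). trajectory S (fst x) (\<lambda>j. snd x (k - j)) i) \<in> borel_measurable (borel \<Otimes>\<^sub>M borel)"
      by (induction i) (simp_all add: Sm coord)
    then show ?thesis unfolding H_def
      by (intro borel_measurable_Pair measurable_coordinatewise_then_product coord)
  qed
  define R where "R x = (\<lambda>i\<in>{..k}. H x i)" for x
  have Rm: "R \<in> borel \<Otimes>\<^sub>M borel \<rightarrow>\<^sub>M Pi\<^sub>M {..k} (\<lambda>_. borel)"
    unfolding R_def by (intro measurable_restrict Hm)
  have RW: "R (?W \<omega>) = (\<lambda>i\<in>{..k}. ?V i \<omega>)" for \<omega> by (auto simp: R_def HW fun_eq_iff)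
  define next_state where "next_state x y = (S (fst (H x k), y), snoc (snd (H x k)) y)" for x y
  have nm: "(\<lambda>p. next_state (fst p) (snd p)) \<in> borel_measurable ((borel \<Otimes>\<^sub>M borel) \<Otimes>\<^sub>M borel)"
  proof -
    have Hk: "(\<lambda>p. H (fst p) k) \<in> borel_measurable ((borel \<Otimes>\<^sub>M borel) \<Otimes>\<^sub>M (borel :: 'e measure))"
      by (rule measurable_compose[OF measurable_fst Hm])
    have "(\<lambda>p. fst (H (fst p) k)) \<in> borel_measurable ((borel \<Otimes>\<^sub>M borel) \<Otimes>\<^sub>M (borel :: 'e measure))"
      "(\<lambda>p. snd (H (fst p) k)) \<in> borel_measurable ((borel \<Otimes>\<^sub>M borel) \<Otimes>\<^sub>M (borel :: 'e measure))"
      by (rule measurable_compose[OF Hk], intro borel_measurable_continuous_onI continuous_intros)+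
    then show ?thesis unfolding next_state_def
      by (intro borel_measurable_Pair Sm snoc_measurable measurable_snd)
  qed
  have next_W: "next_state (?W \<omega>) (\<eta> (int (Suc k)) \<omega>) = ?V (Suc k) \<omega>" for \<omega>
    unfolding next_state_def HW[OF order_refl] by (simp add: past_at_Suc del: of_nat_Suc)
  define f where "f p = (indicator A (R (fst p)) * indicator B (next_state (fst p) (snd p)) :: real)"
    for p :: "('h \<times> (nat \<Rightarrow> 'e)) \<times> 'e"
  have fm: "f \<in> borel_measurable ((borel \<Otimes>\<^sub>M borel) \<Otimes>\<^sub>M borel)"
    unfolding f_def
    by (intro borel_measurable_times measurable_compose[OF measurable_compose[OF measurable_fst Rm] borel_measurable_indicator[OF A]]
        measurable_compose[OF nm borel_measurable_indicator[OF B]])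
  have km: "(\<lambda>x. Q (snd x)) \<in> borel \<Otimes>\<^sub>M borel \<rightarrow>\<^sub>M prob_algebra borel"
    by (rule measurable_compose[OF measurable_snd Q_kernel])
  have "prob {\<omega> \<in> space M. (\<lambda>i\<in>{..k}. ?V i \<omega>) \<in> A \<and> ?V (Suc k) \<omega> \<in> B} = (\<integral>\<omega>. f (?W \<omega>, \<eta> (int (Suc k)) \<omega>) \<partial>M)"
  proof -
    have "(\<integral>\<omega>. f (?W \<omega>, \<eta> (int (Suc k)) \<omega>) \<partial>M) =
        (\<integral>\<omega>. indicator {\<omega>. (\<lambda>i\<in>{..k}. ?V i \<omega>) \<in> A \<and> ?V (Suc k) \<omega> \<in> B} \<omega> \<partial>M)"
      unfolding f_def fst_conv snd_conv RW next_W by (intro Bochner_Integration.integral_cong refl) (simp add: indicator_def)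
    then show ?thesis by (simp only: Bochner_Integration.integral_indicator Int_def mem_Collect_eq conj_commute)
  qed
  also have "\<dots> = (\<integral>\<omega>. (\<integral>y. f (?W \<omega>, y) \<partial>Q (snd (?W \<omega>))) \<partial>M)"
  proof (rule integral_conditional_kernel[OF prob_space_axioms _ eta_measurable km _ fm])
    show "?W \<in> M \<rightarrow>\<^sub>M borel \<Otimes>\<^sub>M borel" by (intro measurable_Pair um past_at_measurable)
    show "prob {\<omega> \<in> space M. ?W \<omega> \<in> a \<and> \<eta> (int (Suc k)) \<omega> \<in> b} =
        (\<integral>\<omega>. indicator a (?W \<omega>) * measure (Q (snd (?W \<omega>))) b \<partial>M)"
      if "a \<in> sets (borel \<Otimes>\<^sub>M borel)" "b \<in> sets borel" for a b
      using prob_initial_past_next[OF u that, of k] by (simp only: snd_conv)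
    show "\<bar>f x\<bar> \<le> 1" for x by (simp add: f_def indicator_def)
  qed
  also have "\<dots> = (\<integral>\<omega>. indicator A (\<lambda>i\<in>{..k}. ?V i \<omega>) * measure (U_kernel S Q (?V k \<omega>)) B \<partial>M)"
  proof (rule Bochner_Integration.integral_cong[OF refl])
    fix \<omega>
    have nW: "next_state (?W \<omega>) \<in> borel \<rightarrow>\<^sub>M borel"
      using measurable_compose[OF measurable_Pair1' nm, of "?W \<omega>"] by (simp add: space_pair_measure)
    then have nQ: "next_state (?W \<omega>) \<in> Q (past_at k \<omega>) \<rightarrow>\<^sub>M borel"
      using measurable_cong_sets[OF sets_Q' refl] by blast
    have spQ: "space (Q \<xi>) = UNIV" for \<xi> using sets_eq_imp_space_eq[OF sets_Q'] by simp
    have "U_kernel S Q (?V k \<omega>) = distr (Q (past_at k \<omega>)) borel (next_state (?W \<omega>))"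
      unfolding next_state_def HW[OF order_refl] by (simp add: U_kernel_def)
    then have "measure (U_kernel S Q (?V k \<omega>)) B = measure (Q (past_at k \<omega>)) (next_state (?W \<omega>) -` B)"
      by (simp add: measure_distr[OF nQ B] spQ)
    also have "\<dots> = (\<integral>y. indicator B (next_state (?W \<omega>) y) \<partial>Q (past_at k \<omega>))"
    proof -
      have "(\<integral>y. (indicator B (next_state (?W \<omega>) y) :: real) \<partial>Q (past_at k \<omega>)) =
          (\<integral>y. indicator (next_state (?W \<omega>) -` B) y \<partial>Q (past_at k \<omega>))"
        by (intro Bochner_Integration.integral_cong refl) (simp add: indicator_def)
      then show ?thesis by (simp add: spQ)
    qed
    finally show "(\<integral>y. f (?W \<omega>, y) \<partial>Q (snd (?W \<omega>))) =
        indicator A (\<lambda>i\<in>{..k}. ?V i \<omega>) * measure (U_kernel S Q (?V k \<omega>)) B"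
      by (simp add: f_def RW)
  qed
  finally show "prob {\<omega> \<in> space M. (\<lambda>i\<in>{..k}. ?V i \<omega>) \<in> A \<and> ?V (Suc k) \<omega> \<in> B} =
    (\<integral>\<omega>. indicator A (\<lambda>i\<in>{..k}. ?V i \<omega>) * measure (U_kernel S Q (?V k \<omega>)) B \<partial>M)" .
qed

end

section \<open>Test functions on segments\<close>

lemma space_segment_law: "space (segment_law M X s x k) = Pi\<^sub>E {..s} (\<lambda>_. X)"
  by (auto simp: segment_law_def space_restrict_space space_PiM)

text \<open>A test function in \<open>dual_lip\<close> is constrained only on the product of the
  copies of \<open>X\<close>. Extending by 0 removes its arbitrary values elsewhere and makes it a
  function of full sequences.\<close>

definition segment_extension :: "nat \<Rightarrow> 'h set \<Rightarrow> ((nat \<Rightarrow> 'h) \<Rightarrow> real) \<Rightarrow> (nat \<Rightarrow> 'h) \<Rightarrow> real" where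
  "segment_extension s X f p = indicator {p. \<forall>i\<le>s. p i \<in> X} p * f (restrict p {..s})"

context
  fixes X :: "'h::{metric_space, second_countable_topology} set" and s :: nat and f :: "(nat \<Rightarrow> 'h) \<Rightarrow> real"
  assumes X: "closed X"
    and f1: "\<forall>x\<in>Pi\<^sub>E {..s} (\<lambda>_. X). \<bar>f x\<bar> \<le> 1"
    and fL: "\<forall>x\<in>Pi\<^sub>E {..s} (\<lambda>_. X). \<forall>y\<in>Pi\<^sub>E {..s} (\<lambda>_. X). \<bar>f x - f y\<bar> \<le> sum_dist s x y"
begin

lemma segment_extension_bounded: "\<bar>segment_extension s X f p\<bar> \<le> 1"
  using f1 by (auto simp: segment_extension_def indicator_def)

lemma segment_extension_lipschitz:
  assumes "\<And>i. i \<le> s \<Longrightarrow> p i \<in> X" "\<And>i. i \<le> s \<Longrightarrow> p' i \<in> X"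
  shows "\<bar>segment_extension s X f p - segment_extension s X f p'\<bar> \<le> (\<Sum>i\<le>s. dist (p i) (p' i))"
proof -
  have "restrict p {..s} \<in> Pi\<^sub>E {..s} (\<lambda>_. X)" "restrict p' {..s} \<in> Pi\<^sub>E {..s} (\<lambda>_. X)"
    using assms by auto
  then have "\<bar>f (restrict p {..s}) - f (restrict p' {..s})\<bar> \<le> sum_dist s (restrict p {..s}) (restrict p' {..s})"
    using fL by blast
  then show ?thesis using assms by (simp add: segment_extension_def sum_dist_def)
qed

text \<open>Measurability is not part of the definition of \<open>dual_lip\<close>. It follows from
  the Lipschitz condition: the extension is continuous on a closed set and 0 off it.\<close>

lemma segment_extension_measurable: "segment_extension s X f \<in> borel_measurable borel"
proof -
  let ?A = "{p :: nat \<Rightarrow> 'h. \<forall>i\<le>s. p i \<in> X}"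
  have "?A = (\<Inter>i\<in>{..s}. (\<lambda>p. p i) -` X)" by auto
  moreover have "closed (\<Inter>i\<in>{..s}. (\<lambda>p :: nat \<Rightarrow> 'h. p i) -` X)"
    by (intro closed_INT ballI closed_vimage X continuous_on_product_coordinates)
  ultimately have A: "?A \<in> sets borel" by simp
  have "continuous_on ?A (segment_extension s X f)"
    unfolding continuous_on_def
  proof
    fix p assume p: "p \<in> ?A"
    have co: "((\<lambda>p' :: nat \<Rightarrow> 'h. p' i) \<longlongrightarrow> p i) (at p within ?A)" for i
    proof -
      have "continuous_on ?A (\<lambda>p'. p' i)"
        by (rule continuous_on_subset[OF continuous_on_product_coordinates subset_UNIV])
      then show ?thesis using p unfolding continuous_on_def by blast
    qed
    have "((\<lambda>p'. \<Sum>i\<le>s. dist (p' i) (p i)) \<longlongrightarrow> (\<Sum>i\<le>s. dist (p i) (p i))) (at p within ?A)"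
      by (intro tendsto_sum tendsto_dist co tendsto_const)
    then have t0: "((\<lambda>p'. \<Sum>i\<le>s. dist (p' i) (p i)) \<longlongrightarrow> 0) (at p within ?A)" by simp
    have ev: "\<forall>\<^sub>F p' in at p within ?A. norm (segment_extension s X f p' - segment_extension s X f p) \<le> (\<Sum>i\<le>s. dist (p' i) (p i))"
      unfolding eventually_at_filter
      by (rule always_eventually) (use p segment_extension_lipschitz in auto)
    have "((\<lambda>p'. segment_extension s X f p' - segment_extension s X f p) \<longlongrightarrow> 0) (at p within ?A)"
      by (rule Lim_null_comparison[OF ev t0])
    then show "(segment_extension s X f \<longlongrightarrow> segment_extension s X f p) (at p within ?A)"
      by (rule LIM_zero_cancel)
  qed
  from borel_measurable_continuous_on_indicator[OF A this]
  have "(\<lambda>p. indicator ?A p *\<^sub>R segment_extension s X f p) \<in> borel_measurable borel" .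
  moreover have "(\<lambda>p. indicator ?A p *\<^sub>R segment_extension s X f p) = segment_extension s X f"
    by (auto simp: fun_eq_iff segment_extension_def indicator_def)
  ultimately show ?thesis by (rule back_subst[of "\<lambda>g. g \<in> borel_measurable borel"])
qed

text \<open>The indicator inside \<open>segment_extension\<close> takes the place of the restriction
  to \<open>X\<close>, and \<open>min\<close> turns a segment into a full sequence.\<close>

lemma integral_segment_law:
  assumes x: "\<And>i. x i \<in> borel_measurable M"
  shows "(\<integral>p. f p \<partial>segment_law M X s x k) = (\<integral>\<omega>. segment_extension s X f (\<lambda>i. x (k + min i s) \<omega>) \<partial>M)"
proof -
  let ?P = "Pi\<^sub>M {..s} (\<lambda>_. borel :: 'h measure)" and ?O = "Pi\<^sub>E {..s} (\<lambda>_. X)"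
  let ?x = "\<lambda>\<omega>. \<lambda>i\<in>{..s}. x (k + i) \<omega>"
  let ?e = "\<lambda>p :: nat \<Rightarrow> 'h. \<lambda>i. p (min i s)"
  have xm: "?x \<in> M \<rightarrow>\<^sub>M ?P" by (intro measurable_restrict x)
  have em: "?e \<in> ?P \<rightarrow>\<^sub>M borel"
    by (intro measurable_coordinatewise_then_product measurable_component_singleton) simp
  have O: "?O \<in> sets ?P" using X by (intro sets_PiM_I_finite) auto
  have eq: "indicator ?O p *\<^sub>R f p = segment_extension s X f (?e p)" if "p \<in> space ?P" for p
  proof -
    have "restrict (?e p) {..s} = p" using that by (auto simp: space_PiM fun_eq_iff PiE_iff extensional_def min_def)
    moreover have "p \<in> ?O \<longleftrightarrow> (\<forall>i\<le>s. ?e p i \<in> X)" using that by (auto simp: space_PiM PiE_iff min_def)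
    ultimately show ?thesis by (simp add: segment_extension_def indicator_def)
  qed
  have m: "(\<lambda>p. segment_extension s X f (?e p)) \<in> borel_measurable ?P"
    by (rule measurable_compose[OF em segment_extension_measurable])
  have "(\<integral>p. f p \<partial>segment_law M X s x k) = (\<integral>p. indicator ?O p *\<^sub>R f p \<partial>distr M ?P ?x)"
    unfolding segment_law_def using O by (intro integral_restrict_space) auto
  also have "\<dots> = (\<integral>p. segment_extension s X f (?e p) \<partial>distr M ?P ?x)"
    by (rule Bochner_Integration.integral_cong[OF refl], rule eq) simp
  also have "\<dots> = (\<integral>\<omega>. segment_extension s X f (?e (?x \<omega>)) \<partial>M)"
    by (rule integral_distr[OF xm m])
  finally show ?thesis by (simp add: restrict_def)
qed

end

theorem proposition3p7:
  fixes M :: "'w measure"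
    and \<eta> :: "int \<Rightarrow> 'w \<Rightarrow> 'e::{banach, second_countable_topology}"
    and S :: "'h::{real_inner, complete_space, second_countable_topology} \<times> 'e \<Rightarrow> 'h"
    and X :: "'h set" and K :: "'e set" and \<E> :: "(nat \<Rightarrow> 'e) set"
    and Q :: "(nat \<Rightarrow> 'e) \<Rightarrow> 'e measure"
    and \<iota> :: real
    and N :: "'v measure"
    and \<mu> :: "('h \<times> (nat \<Rightarrow> 'e)) measure"
    and V :: "nat \<Rightarrow> 'v \<Rightarrow> 'h \<times> (nat \<Rightarrow> 'e)"
    and s :: nat
  assumes "prob_space M" and "stationary_process M \<eta>"
    and "\<And>k. K = msupport (distr M borel (\<eta> k))" and "compact K"
    and "\<E> = msupport (past_law M \<eta>)"
    and "cond_law_next M \<eta> Q"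
    and "\<iota> > 1"
    and "C2_bounded_on_bounded S"
    and "compact X" and "S ` (X \<times> K) \<subseteq> X"
    and "hyp_SF \<iota> K \<E> Q" and "hyp_GD S" and "hyp_ALC S X K"
    and "hyp_DLP \<iota> \<E> Q" and "hyp_SRZ \<E> Q"
    and "stationary_measure (X \<times> \<E>) (U_kernel S Q) \<mu>"
    and "markov_trajectory (U_kernel S Q) N V"
    and "\<And>k. distr N borel (V k) = \<mu>"
    and "s \<ge> 1"
  defines "traj \<equiv> \<lambda>u k \<omega>. trajectory S (u \<omega>) (\<lambda>j. \<eta> (int j) \<omega>) k"
  defines "deviation \<equiv> \<lambda>k u.
    dual_lip (sum_dist s) (segment_law M X s (traj u) k) (segment_law N X s (\<lambda>k \<omega>. fst (V k \<omega>)) 0)"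
  shows "(\<forall>u. admissible_initial M \<eta> X u \<longrightarrow> (\<lambda>k. deviation k u) \<longlonglongrightarrow> 0) \<and>
         uniform_limit {u. admissible_initial M \<eta> X u} deviation (\<lambda>_. 0) sequentially"
proof -
  interpret M: prob_space M by fact
  interpret noise: stationary_noise M \<eta> K \<E> Q \<iota>
    by unfold_locales (fact assms)+
  obtain C\<^sub>Q where "noise_kernel K \<E> Q \<iota> C\<^sub>Q" using noise.ex_noise_kernel by blast
  then interpret noise_kernel K \<E> Q \<iota> C\<^sub>Q .
  interpret driven_system K \<E> Q \<iota> C\<^sub>Q S X
    by unfold_locales (fact assms)+
  obtain A C q where "one_step_contraction K \<E> Q \<iota> C\<^sub>Q S X A C q"
    using ex_one_step_contraction by blast
  then interpret one_step_contraction K \<E> Q \<iota> C\<^sub>Q S X A C q .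
  have N: "prob_space N" and Vm: "V k \<in> borel_measurable N" for k
    using assms(17) by (auto simp: markov_trajectory_def)
  interpret N: prob_space N by (rule N)
  have XE: "X \<times> \<E> \<in> sets borel"
    using closed_Times[OF compact_imp_closed[OF compact_X] closed_\<E>] by simp
  have V0: "AE \<omega> in N. V 0 \<omega> \<in> X \<times> \<E>"
  proof -
    have mu: "prob_space \<mu>" "sets \<mu> = sets borel" "emeasure \<mu> (X \<times> \<E>) = 1"
      using assms(16) by (auto simp: stationary_measure_def)
    have "AE z in \<mu>. z \<in> X \<times> \<E>"
      using prob_space.AE_in_set_eq_1[OF mu(1), of "X \<times> \<E>"] mu XE by (simp add: measure_def)
    then have "AE z in distr N borel (V 0). z \<in> X \<times> \<E>" by (simp only: assms(18))
    then show ?thesis using XE by (subst (asm) AE_distr_iff[OF Vm]) auto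
  qed
  \<comment> \<open>The index \<open>k0\<close> is provided by \<open>mixing\<close> and depends
    neither on the initial condition nor on the test function, which is the source of the
    uniformity. The lower bound 0 is part of the claim since \<open>deviation\<close> is a supremum
    of reals.\<close>
  have key: "\<exists>k0. \<forall>k\<ge>k0. \<forall>u. admissible_initial M \<eta> X u \<longrightarrow> 0 \<le> deviation k u \<and> deviation k u \<le> \<epsilon>" if \<epsilon>: "\<epsilon> > 0" for \<epsilon>
  proof -
    obtain k0 where k0: "\<And>k g z z'. k \<ge> k0 \<Longrightarrow> g \<in> lip_class \<Longrightarrow> z \<in> X \<times> \<E> \<Longrightarrow> z' \<in> X \<times> \<E> \<Longrightarrow>
      \<bar>(transition ^^ k) g z - (transition ^^ k) g z'\<bar> \<le> \<epsilon>"
      using mixing[OF \<epsilon>] by blast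
    have "0 \<le> deviation k u \<and> deviation k u \<le> \<epsilon>" if k: "k \<ge> k0" and u: "admissible_initial M \<eta> X u" for k u
    proof -
      define U where "U k \<omega> = (traj u k \<omega>, noise.past_at k \<omega>)" for k \<omega>
      have U: "markov_trajectory (U_kernel S Q) M U"
        unfolding U_def traj_def by (rule noise.markov_trajectory_admissible[OF u S_continuous U_kernel_measurable])
      have Um: "U k \<in> borel_measurable M" for k using U by (auto simp: markov_trajectory_def)
      have trm: "traj u k \<in> borel_measurable M" for k
        using measurable_compose[OF Um borel_measurable_continuous_onI[OF continuous_on_fst[OF continuous_on_id]], of k]
        by (simp add: U_def)
      have vm: "(\<lambda>\<omega>. fst (V k \<omega>)) \<in> borel_measurable N" for k
        by (rule measurable_compose[OF Vm borel_measurable_continuous_onI[OF continuous_on_fst[OF continuous_on_id]]])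
      have U0: "AE \<omega> in M. U 0 \<omega> \<in> X \<times> \<E>"
        using noise.AE_past_at[of 0] AE_space
        by eventually_elim (use u in \<open>auto simp: U_def traj_def admissible_initial_def\<close>)
      have bound: "\<bar>(\<integral>p. f p \<partial>segment_law M X s (traj u) k) - (\<integral>p. f p \<partial>segment_law N X s (\<lambda>k \<omega>. fst (V k \<omega>)) 0)\<bar> \<le> \<epsilon>"
        if f: "\<forall>x\<in>Pi\<^sub>E {..s} (\<lambda>_. X). \<bar>f x\<bar> \<le> 1"
          "\<forall>x\<in>Pi\<^sub>E {..s} (\<lambda>_. X). \<forall>y\<in>Pi\<^sub>E {..s} (\<lambda>_. X). \<bar>f x - f y\<bar> \<le> sum_dist s x y" for f
      proof -
        note Xc = compact_imp_closed[OF compact_X]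
        define F where "F p = segment_extension s X f (\<lambda>i. fst (p i))" for p :: "nat \<Rightarrow> 'h \<times> (nat \<Rightarrow> 'e)"
        have F1: "\<bar>F p\<bar> \<le> 1" for p
          unfolding F_def by (rule segment_extension_bounded[OF Xc f])
        have Fm: "F \<in> borel_measurable borel"
          unfolding F_def
        proof (rule measurable_compose[OF measurable_coordinatewise_then_product segment_extension_measurable[OF Xc f]])
          show "(\<lambda>p :: nat \<Rightarrow> 'h \<times> (nat \<Rightarrow> 'e). fst (p i)) \<in> borel_measurable borel" for i
            by (rule measurable_compose[OF coordinate_measurable borel_measurable_continuous_onI[OF continuous_on_fst[OF continuous_on_id]]])
        qed
        have FL: "\<bar>F p - F p'\<bar> \<le> (\<Sum>i\<le>s. mixed_dist A (p i) (p' i))"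
          if p: "\<And>i. p i \<in> X \<times> \<E>" "\<And>i. p' i \<in> X \<times> \<E>" for p p'
        proof -
          have "\<bar>F p - F p'\<bar> \<le> (\<Sum>i\<le>s. dist (fst (p i)) (fst (p' i)))"
            unfolding F_def by (rule segment_extension_lipschitz[OF Xc f]) (use p in \<open>auto simp: mem_Times_iff\<close>)
          also have "\<dots> \<le> (\<Sum>i\<le>s. mixed_dist A (p i) (p' i))"
          proof (rule sum_mono)
            fix i
            have "0 \<le> past_dist \<iota> (snd (p i)) (snd (p' i))"
              using p by (intro past_dist_nonneg_\<E>) (auto simp: mem_Times_iff)
            moreover have "1 * norm (fst (p i) - fst (p' i)) \<le> A * norm (fst (p i) - fst (p' i))"
              using A by (intro mult_right_mono) auto
            ultimately show "dist (fst (p i)) (fst (p' i)) \<le> mixed_dist A (p i) (p' i)"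
              by (simp add: mixed_dist_def dist_norm)
          qed
          finally show ?thesis .
        qed
        \<comment> \<open>The expected value of the test function of a segment, as a function of the
          state in which the segment starts.\<close>
        define g where "g = (\<lambda>z. collapse s F (\<lambda>_. z))"
        define h where "h = (transition ^^ k) g"
        have g: "g \<in> lip_class" unfolding g_def by (rule collapse_lip_class[OF Fm F1 FL])
        then have h: "h \<in> borel_measurable borel" "\<And>w. \<bar>h w\<bar> \<le> 1"
          using iterate_lip_class[OF g, of k] by (auto simp: h_def lip_class_def)
        have hU: "integrable M (\<lambda>\<omega>. h (U 0 \<omega>))" "integrable N (\<lambda>\<omega>. h (V 0 \<omega>))"
          by (rule M.integrable_const_bound[where B=1, OF _ measurable_compose[OF Um h(1)]], simp only: real_norm_def h(2) eventually_True)
            (rule N.integrable_const_bound[where B=1, OF _ measurable_compose[OF Vm h(1)]], simp only: real_norm_def h(2) eventually_True)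
        have FU: "F (\<lambda>i. U (j i) \<omega>) = segment_extension s X f (\<lambda>i. traj u (j i) \<omega>)" for j \<omega>
          by (simp add: F_def U_def)
        have FV: "F (\<lambda>i. V (j i) \<omega>) = segment_extension s X f (\<lambda>i. fst (V (j i) \<omega>))" for j \<omega>
          by (simp add: F_def)
        have 1: "(\<integral>p. f p \<partial>segment_law M X s (traj u) k) = (\<integral>\<omega>. h (U 0 \<omega>) \<partial>M)"
          using integral_segment_law[OF Xc f, where x = "traj u" and k = k, OF trm] markov_segment[OF U Fm F1 FL, of k]
          by (simp only: FU h_def g_def)
        have 2: "(\<integral>p. f p \<partial>segment_law N X s (\<lambda>k \<omega>. fst (V k \<omega>)) 0) = (\<integral>\<omega>. h (V 0 \<omega>) \<partial>N)"
        proof -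
          have gm: "g \<in> borel_measurable borel" using g by (simp add: lip_class_def)
          have "(\<integral>p. f p \<partial>segment_law N X s (\<lambda>k \<omega>. fst (V k \<omega>)) 0) = (\<integral>\<omega>. g (V 0 \<omega>) \<partial>N)"
            using integral_segment_law[OF Xc f, where x = "\<lambda>k \<omega>. fst (V k \<omega>)" and k = 0, OF vm] markov_segment[OF assms(17) Fm F1 FL, of 0]
            by (simp only: FV g_def funpow_0)
          also have "\<dots> = (\<integral>z. g z \<partial>distr N borel (V 0))" by (rule integral_distr[OF Vm gm, symmetric])
          \<comment> \<open>Stationarity moves the start from time 0 to time k, so that the same
            iterate \<open>h\<close> describes both segments.\<close>
          also have "\<dots> = (\<integral>z. g z \<partial>distr N borel (V k))" by (simp only: assms(18))
          also have "\<dots> = (\<integral>\<omega>. g (V k \<omega>) \<partial>N)" by (rule integral_distr[OF Vm gm])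
          also have "\<dots> = (\<integral>\<omega>. h (V 0 \<omega>) \<partial>N)" unfolding h_def by (rule markov_iterate[OF assms(17) g])
          finally show ?thesis .
        qed
        \<comment> \<open>Both integrals are averages of \<open>h\<close> over
          \<open>X \<times> \<E>\<close>, where its oscillation is at most \<epsilon>; first z is
          compared with the stationary average, then z is averaged.\<close>
        let ?c = "\<integral>\<omega>. h (V 0 \<omega>) \<partial>N"
        have osc: "\<bar>h z - h z'\<bar> \<le> \<epsilon>" if "z \<in> X \<times> \<E>" "z' \<in> X \<times> \<E>" for z z'
          unfolding h_def by (rule k0[OF k g that])
        have zc: "h z - \<epsilon> \<le> ?c" "?c \<le> h z + \<epsilon>" if z: "z \<in> X \<times> \<E>" for z
        proof -
          have "AE \<omega> in N. h z - \<epsilon> \<le> h (V 0 \<omega>)" "AE \<omega> in N. h (V 0 \<omega>) \<le> h z + \<epsilon>"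
            using V0 by (eventually_elim, use osc[OF z] in \<open>fastforce simp: abs_le_iff\<close>)+
          then show "h z - \<epsilon> \<le> ?c" "?c \<le> h z + \<epsilon>"
            using N.integral_ge_const[OF hU(2)] N.integral_le_const[OF hU(2)] by blast+
        qed
        have "AE \<omega> in M. ?c - \<epsilon> \<le> h (U 0 \<omega>)" "AE \<omega> in M. h (U 0 \<omega>) \<le> ?c + \<epsilon>"
          using U0 by (eventually_elim, use zc in fastforce)+
        then have "?c - \<epsilon> \<le> (\<integral>\<omega>. h (U 0 \<omega>) \<partial>M)" "(\<integral>\<omega>. h (U 0 \<omega>) \<partial>M) \<le> ?c + \<epsilon>"
          using M.integral_ge_const[OF hU(1)] M.integral_le_const[OF hU(1)] by blast+
        then show ?thesis unfolding 1 2 by (simp add: abs_le_iff)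
      qed
      let ?L = "{f. (\<forall>x\<in>Pi\<^sub>E {..s} (\<lambda>_. X). \<bar>f x\<bar> \<le> 1) \<and>
        (\<forall>x\<in>Pi\<^sub>E {..s} (\<lambda>_. X). \<forall>y\<in>Pi\<^sub>E {..s} (\<lambda>_. X). \<bar>f x - f y\<bar> \<le> sum_dist s x y)}"
      let ?d = "\<lambda>f. \<bar>(\<integral>p. f p \<partial>segment_law M X s (traj u) k) - (\<integral>p. f p \<partial>segment_law N X s (\<lambda>k \<omega>. fst (V k \<omega>)) 0)\<bar>"
      have dev: "deviation k u = (SUP f\<in>?L. ?d f)"
        by (simp only: deviation_def dual_lip_def space_segment_law)
      \<comment> \<open>The zero function makes the set of test functions nonempty and the supremum
        nonnegative.\<close>
      have zero: "(\<lambda>_. 0) \<in> ?L" by (auto simp: sum_dist_def intro!: sum_nonneg)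
      have d: "?d f \<le> \<epsilon>" if "f \<in> ?L" for f
        using that unfolding mem_Collect_eq by (elim conjE) (rule bound)
      have "(SUP f\<in>?L. ?d f) \<le> \<epsilon>"
        by (rule cSUP_least[OF _ d]) (rule notI, drule equals0D[where a = "\<lambda>_. 0"], erule notE, rule zero)
      moreover have "?d (\<lambda>_. 0) \<le> (SUP f\<in>?L. ?d f)"
        by (rule cSUP_upper[OF zero bdd_aboveI2[OF d]])
      ultimately show ?thesis unfolding dev by simp
    qed
    then show ?thesis by blast
  qed
  have ul: "uniform_limit {u. admissible_initial M \<eta> X u} deviation (\<lambda>_. 0) sequentially"
    unfolding uniform_limit_sequentially_iff
  proof (intro allI impI)
    fix e :: real assume "e > 0"
    then obtain k0 where "\<forall>k\<ge>k0. \<forall>u. admissible_initial M \<eta> X u \<longrightarrow> 0 \<le> deviation k u \<and> deviation k u \<le> e / 2"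
      using key[of "e / 2"] by auto
    then show "\<exists>k0. \<forall>k\<ge>k0. \<forall>u\<in>{u. admissible_initial M \<eta> X u}. dist (deviation k u) 0 < e"
      using \<open>e > 0\<close> by (intro exI[of _ k0]) (force simp: dist_real_def)
  qed
  moreover have "(\<lambda>k. deviation k u) \<longlonglongrightarrow> 0" if "admissible_initial M \<eta> X u" for u
    using tendsto_uniform_limitI[OF ul, of u] that by simp
  ultimately show ?thesis by blast
qed

end
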